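(* Let $W=I_2(k)$ with $k\in\{2,3,4,6\}$ (i.e. the Weyl groups of types $A_1\times A_1$, $A_2$, $B_2$, $G_2$), and let $m\ge1$. Then $$\operatorname{Cat}^{(m)}(W;q,1)=\sum_R q^{\operatorname{coh}(R)},$$ where the sum ranges over all positive regions $R$ of the extended Shi arrangement $\mathsf{Shi}^{(m)}(W)$.
   Context: $\operatorname{Cat}^{(m)}(W;q,t)$ is the bigraded Hilbert series of $\mathcal{A}^m/\langle\mathbf{x},\mathbf{y}\rangle\mathcal{A}^m$, where $W$ acts diagonally (identically) on the variables $(x_1,x_2)$, $(y_1,y_2)$ of $\mathbb{C}[\mathbf{x},\mathbf{y}]$, $\mathcal{A}$ is the ideal generated by all polynomials $p$ with $\omega(p)=\det(\omega)p$ for all $\omega\in W$, $\langle\mathbf{x},\mathbf{y}\rangle$ is the ideal of polynomials without constant term, $q$ marks $\mathbf{x}$-degree and $t$ marks $\mathbf{y}$-degree. For a crystallographic $W$ with positive roots $\Phi^+$ in a real Euclidean space $V$ ($N=|\Phi^+|$), $\mathsf{Shi}^{(m)}(W)$ consists of the hyperplanes $H^{(j)}_\alpha=\{x:(\alpha,x)=j\}$ for $\alpha\in\Phi^+$, $-m<j\le m$; a region is a connected component of the complement; it is positive if contained in $\{x:(\alpha,x)>0\ \forall\alpha\in\Phi^+\}$. With $R^0=\{x:0<(\alpha,x)<1\ \forall\alpha\in\Phi^+\}$, $\operatorname{height}(R)$ is the number of hyperplanes of $\mathsf{Shi}^{(m)}(W)$ separating $R$ from $R^0$, and $\operatorname{coh}(R)=mN-\operatorname{height}(R)$.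 *)

theory Defs
  imports "HOL-Analysis.Analysis" "HOL-Library.Function_Algebras"
begin

text \<open>Positive roots of the crystallographic root system of type I_2(k) in the
Euclidean plane real x real: the j-th positive root (j < k) has angle j*pi/k;
short roots have length 1, long roots (odd j for k = 4 resp. k = 6) have length
sqrt 2 (type B_2) resp. sqrt 3 (type G_2).\<close>

definition root_len :: "nat \<Rightarrow> nat \<Rightarrow> real" where
  "root_len k j = (if k = 4 \<and> odd j then sqrt 2 else if k = 6 \<and> odd j then sqrt 3 else 1)"

definition root :: "nat \<Rightarrow> nat \<Rightarrow> real \<times> real" where
  "root k j = root_len k j *\<^sub>R (cos (real j * pi / real k), sin (real j * pi / real k))"

definition pos_roots :: "nat \<Rightarrow> (real \<times> real) set" where
  "pos_roots k = {root k j | j. j < k}"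

definition refl :: "real \<times> real \<Rightarrow> complex \<times> complex \<Rightarrow> complex \<times> complex" where
  "refl a z = (let c = 2 * (of_real (fst a) * fst z + of_real (snd a) * snd z)
                          / of_real (fst a ^ 2 + snd a ^ 2)
               in (fst z - c * of_real (fst a), snd z - c * of_real (snd a)))"

text \<open>The Weyl group W = I_2(k) (generated by the reflections in the positive roots):
its elements are the reflections (determinant -1) and the products of two
reflections, i.e. the rotations (determinant 1). Each element is paired with its
determinant.\<close>

definition weyl :: "nat \<Rightarrow> ((complex \<times> complex \<Rightarrow> complex \<times> complex) \<times> complex) set" where
  "weyl k = {(refl a, -1) | a. a \<in> pos_roots k}
          \<union> {(refl a \<circ> refl b, 1) | a b. a \<in> pos_roots k \<and> b \<in> pos_roots k}"

type_synonym pfun = "(complex \<times> complex) \<times> (complex \<times> complex) \<Rightarrow> complex"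

definition pscale :: "complex \<Rightarrow> pfun \<Rightarrow> pfun" where
  "pscale c f = (\<lambda>v. c * f v)"

definition pspan :: "pfun set \<Rightarrow> pfun set" where
  "pspan S = module.span pscale S"

definition pdim :: "pfun set \<Rightarrow> nat" where
  "pdim S = vector_space.dim pscale S"

definition monomial :: "nat \<Rightarrow> nat \<Rightarrow> nat \<Rightarrow> nat \<Rightarrow> pfun" where
  "monomial a1 a2 b1 b2 = (\<lambda>((x1, x2), (y1, y2)). x1 ^ a1 * x2 ^ a2 * y1 ^ b1 * y2 ^ b2)"

definition Pol :: "pfun set" where
  "Pol = pspan {monomial a1 a2 b1 b2 | a1 a2 b1 b2. True}"

definition bihom :: "nat \<Rightarrow> nat \<Rightarrow> pfun set" where
  "bihom a b = {p \<in> Pol. \<forall>c e x1 x2 y1 y2.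
       p ((c * x1, c * x2), (e * y1, e * y2)) = c ^ a * e ^ b * p ((x1, x2), (y1, y2))}"

definition alt :: "nat \<Rightarrow> pfun set" where
  "alt k = {p \<in> Pol. \<forall>(g, d) \<in> weyl k. \<forall>x y. p (g x, g y) = d * p (x, y)}"

definition ideal_gen :: "pfun set \<Rightarrow> pfun set" where
  "ideal_gen G = pspan {(\<lambda>v. f v * g v) | f g. f \<in> Pol \<and> g \<in> G}"

definition ideal_prod :: "pfun set \<Rightarrow> pfun set \<Rightarrow> pfun set" where
  "ideal_prod I J = pspan {(\<lambda>v. f v * g v) | f g. f \<in> I \<and> g \<in> J}"

definition altIdeal :: "nat \<Rightarrow> pfun set" where
  "altIdeal k = ideal_gen (alt k)"

fun altIdeal_pow :: "nat \<Rightarrow> nat \<Rightarrow> pfun set" where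
  "altIdeal_pow k 0 = Pol"
| "altIdeal_pow k (Suc n) = ideal_prod (altIdeal k) (altIdeal_pow k n)"

definition maxIdeal :: "pfun set" where
  "maxIdeal = {p \<in> Pol. p ((0, 0), (0, 0)) = 0}"

text \<open>Dimension of the (a,b)-bigraded piece of A^m / <x,y> A^m, i.e. the coefficient
of q^a t^b in Cat^(m)(W;q,t).\<close>

definition cat_coeff :: "nat \<Rightarrow> nat \<Rightarrow> nat \<Rightarrow> nat \<Rightarrow> nat" where
  "cat_coeff k m a b =
     pdim (altIdeal_pow k m \<inter> bihom a b)
     - pdim (ideal_prod maxIdeal (altIdeal_pow k m) \<inter> bihom a b)"

definition shi_complement :: "nat \<Rightarrow> nat \<Rightarrow> (real \<times> real) set" where
  "shi_complement k m = {x. \<forall>a \<in> pos_roots k. \<forall>j \<in> {- int m + 1 .. int m}. a \<bullet> x \<noteq> of_int j}"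

definition shi_regions :: "nat \<Rightarrow> nat \<Rightarrow> (real \<times> real) set set" where
  "shi_regions k m = {connected_component_set (shi_complement k m) x | x. x \<in> shi_complement k m}"

definition positive_region :: "nat \<Rightarrow> (real \<times> real) set \<Rightarrow> bool" where
  "positive_region k R \<longleftrightarrow> R \<subseteq> {x. \<forall>a \<in> pos_roots k. a \<bullet> x > 0}"

definition fund_alcove :: "nat \<Rightarrow> (real \<times> real) set" where
  "fund_alcove k = {x. \<forall>a \<in> pos_roots k. 0 < a \<bullet> x \<and> a \<bullet> x < 1}"

definition shi_height :: "nat \<Rightarrow> nat \<Rightarrow> (real \<times> real) set \<Rightarrow> nat" where
  "shi_height k m R = card {(a, j). a \<in> pos_roots k \<and> j \<in> {- int m + 1 .. int m} \<and>
      (\<exists>x \<in> R. \<exists>y \<in> fund_alcove k. (a \<bullet> x < of_int j) \<noteq> (a \<bullet> y < of_int j))}"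

definition shi_coh :: "nat \<Rightarrow> nat \<Rightarrow> (real \<times> real) set \<Rightarrow> nat" where
  "shi_coh k m R = m * card (pos_roots k) - shi_height k m R"

end

theory Submission
  imports Defs
begin

text \<open>In the coordinates \<open>u = x\<^sub>1 + ix\<^sub>2\<close>, \<open>w = ix\<^sub>2 - x\<^sub>1\<close>, \<open>v = y\<^sub>1 + iy\<^sub>2\<close>, \<open>z = iy\<^sub>2 - y\<^sub>1\<close> the reflections are
  \<open>u \<mapsto> \<zeta>w\<close>, \<open>w \<mapsto> \<zeta>\<inverse>u\<close> (likewise for \<open>v\<close>, \<open>z\<close>) with \<open>\<zeta>\<^sup>k = 1\<close>, and averaging monomials over them
  shows that the alternating ideal is generated by \<open>D = uz - wv\<close> and
  \<open>P\<^sub>l = u\<^sup>lv\<^sup>k\<^sup>-\<^sup>l - w\<^sup>lz\<^sup>k\<^sup>-\<^sup>l\<close>, \<open>0 \<le> l \<le> k\<close>. Modulo \<open>D\<^sup>2\<close>, \<open>P\<^sub>l P\<^sub>l\<^sub>'\<close> depends only on \<open>l + l'\<close>, so the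
  \<open>m\<close>-th power is generated by the \<open>D\<^sup>m\<^sup>-\<^sup>j Q\<^sub>j\<^sub>,\<^sub>i\<close> with \<open>j \<le> m\<close>, \<open>i \<le> jk\<close>, where \<open>Q\<^sub>j\<^sub>,\<^sub>i\<close> is one product of \<open>j\<close>
  factors \<open>P\<^sub>l\<close> of \<open>x\<close>-degree \<open>i\<close>. This set is minimal since \<open>D\<close> does not divide \<open>Q\<^sub>j\<^sub>,\<^sub>i\<close>. Hence
  the coefficient of \<open>q\<^sup>a\<close> is the number of such pairs with \<open>m - j + i = a\<close>.

  On the other side, let \<open>s\<close>, \<open>t\<close> be the values of the two simple roots, \<open>s\<close> being the short one for
  \<open>k = 4, 6\<close>. For \<open>k \<le> 4\<close> no two lines cross inside a strip \<open>b < t < b + 1\<close> of the dominant chamber, so its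
  regions are linearly ordered and have the heights \<open>(k - 1)b, \<dots>, (k - 1)m + b\<close>, once each. For
  \<open>k = 6\<close> the lowest height is \<open>4b + min(2b, m)\<close> instead of \<open>5b\<close>, but lines cross at
  \<open>t = b + 1/2\<close>, and the regions created by these crossings have, over all strips, exactly the missing
  heights.\<close>

subsection \<open>Polynomial functions and ideals\<close>

text \<open>Induction rules produce eta-expanded goals, inside which the simplifier would evaluate
  ring operations pointwise.\<close>

lemmas fun_apply = plus_fun_apply zero_fun_apply times_fun_apply one_fun_apply minus_apply uminus_apply

declare fun_apply [simp del]

interpretation pf: vector_space pscale
  by standard (auto simp: pscale_def fun_eq_iff algebra_simps fun_apply)

lemma pspan_eq: "pspan S = pf.span S"
  by (simp add: pspan_def)

lemma pdim_eq: "pdim S = pf.dim S"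
  by (simp add: pdim_def)

lemma pfun_mult_eq: "(\<lambda>v. f v * g v) = f * (g :: pfun)"
  by (simp add: times_fun_def)

lemma pscale_mult_left: "pscale c f * g = pscale c (f * g)"
  and pscale_mult_right: "f * pscale c g = pscale c (f * g)"
  by (auto simp: pscale_def fun_eq_iff fun_apply)

lemma pscale_apply: "pscale c f v = c * f v"
  by (simp add: pscale_def)

lemma power_fun_apply: "(f ^ n) v = (f v :: 'a :: comm_ring_1) ^ n"
  by (induction n) (auto simp: fun_apply)

lemma sum_fun_apply: "(\<Sum>i\<in>I. f i) v = (\<Sum>i\<in>I. (f i v :: 'a :: comm_monoid_add))"
  by (induction I rule: infinite_finite_induct) (auto simp: fun_apply)

text \<open>Bilinearity: for one fixed factor, the elements whose product with it stays in
  \<open>S\<close> form a subspace, so it suffices to test generators, first on one side and then on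
  the other.\<close>

lemma span_mult_mem:
  assumes "pf.subspace S" and AB: "\<And>f g. f \<in> A \<Longrightarrow> g \<in> B \<Longrightarrow> f * g \<in> S"
    and f: "f \<in> pf.span A" and g: "g \<in> pf.span B"
  shows "f * g \<in> S"
proof -
  have sub: "pf.subspace {f. f * b \<in> S}" for b
    using assms(1) unfolding pf.subspace_def
    by (simp only: mem_Collect_eq mult_zero_left distrib_right pscale_mult_left) blast
  have "pf.span A \<subseteq> {f. f * b \<in> S}" if "b \<in> B" for b
    using AB that by (intro pf.span_minimal sub) auto
  then have "pf.span B \<subseteq> {g. g * f \<in> S}"
    using f by (intro pf.span_minimal sub) (auto simp: mult.commute)
  then show ?thesis
    using g by (auto simp: mult.commute)
qed

text \<open>Lets monomials replace arbitrary polynomials as coefficients of ideal elements, which is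
  what makes bidegrees visible later.\<close>

lemma span_products:
  "pf.span {f * g | f g. f \<in> pf.span A \<and> g \<in> B} = pf.span {f * g | f g. f \<in> A \<and> g \<in> B}"
  (is "pf.span ?L = pf.span ?R")
proof
  have base: "f * g \<in> pf.span ?R" if "f \<in> A" "g \<in> B" for f g
    by (rule pf.span_base) (use that in blast)
  have "f * g \<in> pf.span ?R" if "f \<in> pf.span A" "g \<in> B" for f g
    by (rule span_mult_mem[OF pf.subspace_span base that(1) pf.span_base[OF that(2)]])
  then have "?L \<subseteq> pf.span ?R" by blast
  then show "pf.span ?L \<subseteq> pf.span ?R"
    by (rule pf.span_minimal) (rule pf.subspace_span)
  have "?R \<subseteq> ?L" using pf.span_base by blast
  then show "pf.span ?R \<subseteq> pf.span ?L" by (rule pf.span_mono)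
qed

lemma monomial_mult:
  "monomial a b c d * monomial a' b' c' d' = monomial (a + a') (b + b') (c + c') (d + d')"
  by (auto simp: monomial_def fun_eq_iff power_add fun_apply)

lemma monomial_0: "monomial 0 0 0 0 = 1"
  by (auto simp: monomial_def fun_eq_iff fun_apply)

lemma Pol_eq: "Pol = pf.span {monomial a1 a2 b1 b2 | a1 a2 b1 b2. True}"
  by (simp add: Pol_def pspan_eq)

lemma subspace_Pol: "pf.subspace Pol"
  by (simp add: Pol_eq)

lemma Pol_monomial: "monomial a b c d \<in> Pol"
  unfolding Pol_eq by (rule pf.span_base) auto

lemma Pol_one: "1 \<in> Pol"
  using Pol_monomial[of 0 0 0 0] by (simp add: monomial_0)

lemmas Pol_add = pf.subspace_add[OF subspace_Pol]
  and Pol_diff = pf.subspace_diff[OF subspace_Pol]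
  and Pol_scale = pf.subspace_scale[OF subspace_Pol]

lemma Pol_mult: "f * g \<in> Pol" if "f \<in> Pol" "g \<in> Pol"
  using that
  by (intro span_mult_mem[OF subspace_Pol _ that[unfolded Pol_eq]])
    (auto simp: monomial_mult Pol_monomial)

lemma Pol_power: "f ^ n \<in> Pol" if "f \<in> Pol"
  by (induction n) (auto simp: Pol_one Pol_mult that)

text \<open>Eigencoordinates of the rotations; the signs of \<open>cw\<close> and \<open>cz\<close> make the reflection
  in the first root swap \<open>cu\<close> with \<open>cw\<close> and \<open>cv\<close> with \<open>cz\<close>.\<close>

definition cu :: pfun where "cu = (\<lambda>((x1, x2), (y1, y2)). x1 + \<i> * x2)"
definition cw :: pfun where "cw = (\<lambda>((x1, x2), (y1, y2)). \<i> * x2 - x1)"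
definition cv :: pfun where "cv = (\<lambda>((x1, x2), (y1, y2)). y1 + \<i> * y2)"
definition cz :: pfun where "cz = (\<lambda>((x1, x2), (y1, y2)). \<i> * y2 - y1)"

definition lmono :: "nat \<Rightarrow> nat \<Rightarrow> nat \<Rightarrow> nat \<Rightarrow> pfun" where
  "lmono a b c d = cu ^ a * cw ^ b * cv ^ c * cz ^ d"

lemma Pol_cu: "cu \<in> Pol" and Pol_cw: "cw \<in> Pol" and Pol_cv: "cv \<in> Pol" and Pol_cz: "cz \<in> Pol"
proof -
  have "cu = monomial 1 0 0 0 + pscale \<i> (monomial 0 1 0 0)"
    and "cw = pscale \<i> (monomial 0 1 0 0) - monomial 1 0 0 0"
    and "cv = monomial 0 0 1 0 + pscale \<i> (monomial 0 0 0 1)"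
    and "cz = pscale \<i> (monomial 0 0 0 1) - monomial 0 0 1 0"
    by (auto simp: fun_eq_iff cu_def cw_def cv_def cz_def monomial_def pscale_def fun_apply)
  note eq = this
  show "cu \<in> Pol" "cw \<in> Pol" "cv \<in> Pol" "cz \<in> Pol"
    unfolding eq by (intro Pol_add Pol_diff Pol_scale Pol_monomial)+
qed

lemmas Pol_intros = Pol_add Pol_diff Pol_scale Pol_mult Pol_power Pol_one Pol_cu Pol_cw Pol_cv Pol_cz

lemma Pol_lmono: "lmono a b c d \<in> Pol"
  unfolding lmono_def by (intro Pol_intros)

lemma lmono_mult: "lmono a b c d * lmono a' b' c' d' = lmono (a + a') (b + b') (c + c') (d + d')"
  by (simp add: lmono_def power_add algebra_simps)

text \<open>The change to eigencoordinates is linear and invertible. The span of the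
  \<open>lmono\<close> is closed under products and contains the four original coordinates, hence
  all their monomials.\<close>

lemma Pol_eq_span_lmono: "Pol = pf.span {lmono a b c d | a b c d. True}" (is "_ = pf.span ?L")
proof
  show "pf.span ?L \<subseteq> Pol"
    by (rule pf.span_minimal) (auto simp: Pol_lmono subspace_Pol)
  have L: "lmono a b c d \<in> pf.span ?L" for a b c d
    by (rule pf.span_base) auto
  have mult: "f * g \<in> pf.span ?L" if "f \<in> pf.span ?L" "g \<in> pf.span ?L" for f g
  proof (rule span_mult_mem[OF pf.subspace_span _ that])
    fix f g assume "f \<in> ?L" "g \<in> ?L"
    then obtain a b c d a' b' c' d' where "f = lmono a b c d" "g = lmono a' b' c' d'" by blast
    then show "f * g \<in> pf.span ?L" by (simp only: lmono_mult L)
  qed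
  have one: "1 \<in> pf.span ?L"
    using L[of 0 0 0 0] by (simp add: lmono_def)
  have pow: "f ^ n \<in> pf.span ?L" if "f \<in> pf.span ?L" for f n
  proof (induction n)
    case 0 show ?case using one by (simp only: power_0)
  next
    case (Suc n) then show ?case using mult[OF that] by (simp only: power_Suc)
  qed
  have c: "cu \<in> pf.span ?L" "cw \<in> pf.span ?L" "cv \<in> pf.span ?L" "cz \<in> pf.span ?L"
    using L[of 1 0 0 0] L[of 0 1 0 0] L[of 0 0 1 0] L[of 0 0 0 1] by (simp_all add: lmono_def)
  have "monomial a b c d \<in> pf.span ?L" for a b c d
  proof -
    have "monomial a b c d = monomial 1 0 0 0 ^ a * monomial 0 1 0 0 ^ b * monomial 0 0 1 0 ^ c * monomial 0 0 0 1 ^ d"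
      by (auto simp: fun_eq_iff monomial_def power_fun_apply fun_apply)
    moreover have "monomial 1 0 0 0 = pscale (1/2) (cu - cw)" "monomial 0 1 0 0 = pscale (-\<i>/2) (cu + cw)"
      "monomial 0 0 1 0 = pscale (1/2) (cv - cz)" "monomial 0 0 0 1 = pscale (-\<i>/2) (cv + cz)"
      by (auto simp: fun_eq_iff cu_def cw_def cv_def cz_def monomial_def pscale_def fun_apply complex_eq_iff)
    ultimately have eq: "monomial a b c d =
       pscale (1/2) (cu - cw) ^ a * pscale (-\<i>/2) (cu + cw) ^ b *
       pscale (1/2) (cv - cz) ^ c * pscale (-\<i>/2) (cv + cz) ^ d"
      by (simp only:)
    show ?thesis unfolding eq
      by (intro mult pow pf.span_scale pf.span_add pf.span_diff c)
  qed
  then show "Pol \<subseteq> pf.span ?L"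
    unfolding Pol_eq by (intro pf.span_minimal) auto
qed

section \<open>Ideals and products of ideals in terms of generators\<close>

lemma ideal_gen_eq: "ideal_gen G = pf.span {f * g | f g. f \<in> Pol \<and> g \<in> G}"
  by (simp add: ideal_gen_def pspan_eq pfun_mult_eq)

lemma ideal_prod_eq: "ideal_prod I J = pf.span {f * g | f g. f \<in> I \<and> g \<in> J}"
  by (simp add: ideal_prod_def pspan_eq pfun_mult_eq)

lemma subspace_ideal_gen: "pf.subspace (ideal_gen G)"
  by (simp add: ideal_gen_eq)

lemma ideal_gen_mult: "f * g \<in> ideal_gen G" if f: "f \<in> Pol" and g: "g \<in> ideal_gen G"
proof (rule span_mult_mem[OF subspace_ideal_gen _ _ g[unfolded ideal_gen_eq]])
  show "f \<in> pf.span Pol" using f by (rule pf.span_base)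
  fix p q assume p: "p \<in> Pol" and "q \<in> {f * g |f g. f \<in> Pol \<and> g \<in> G}"
  then obtain r s where q: "q = r * s" "r \<in> Pol" "s \<in> G" by auto
  have "p * q = (p * r) * s" using q by (simp add: mult.assoc)
  then show "p * q \<in> ideal_gen G"
    unfolding ideal_gen_eq using Pol_mult[OF p q(2)] q(3) by (intro pf.span_base) blast
qed

lemma ideal_gen_base: "g \<in> G \<Longrightarrow> g \<in> ideal_gen G"
  unfolding ideal_gen_eq using Pol_one by (intro pf.span_base) (metis (mono_tags, lifting) mem_Collect_eq mult_1)

lemma ideal_gen_minimal:
  assumes "G \<subseteq> ideal_gen H" shows "ideal_gen G \<subseteq> ideal_gen H"
  unfolding ideal_gen_eq[of G]
  by (rule pf.span_minimal) (use assms in \<open>auto intro: ideal_gen_mult simp: subspace_ideal_gen\<close>)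

lemma ideal_prod_gen: "ideal_prod (ideal_gen A) (ideal_gen B) = ideal_gen {a * b | a b. a \<in> A \<and> b \<in> B}"
proof
  show "ideal_prod (ideal_gen A) (ideal_gen B) \<subseteq> ideal_gen {a * b | a b. a \<in> A \<and> b \<in> B}" (is "_ \<subseteq> ?R")
    unfolding ideal_prod_eq
  proof (intro pf.span_minimal subspace_ideal_gen, safe)
    fix f g assume fg: "f \<in> ideal_gen A" "g \<in> ideal_gen B"
    show "f * g \<in> ?R"
    proof (rule span_mult_mem[OF subspace_ideal_gen _ fg[unfolded ideal_gen_eq]])
      fix f g assume "f \<in> {f * g |f g. f \<in> Pol \<and> g \<in> A}" "g \<in> {f * g |f g. f \<in> Pol \<and> g \<in> B}"
      then obtain f1 a f2 b where *: "f = f1 * a" "g = f2 * b" "f1 \<in> Pol" "f2 \<in> Pol" "a \<in> A" "b \<in> B"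
        by auto
      have "f * g = (f1 * f2) * (a * b)" using * by (simp add: algebra_simps)
      moreover have "a * b \<in> ?R"
        using * by (intro ideal_gen_base) blast
      ultimately show "f * g \<in> ?R"
        using * \<open>f * g = _\<close> by (simp only: ideal_gen_mult Pol_mult)
    qed
  qed
  show "?R \<subseteq> ideal_prod (ideal_gen A) (ideal_gen B)"
    unfolding ideal_gen_eq[of "{a * b | a b. a \<in> A \<and> b \<in> B}"]
  proof (intro pf.span_minimal, safe)
    fix f g a b assume *: "f \<in> Pol" "a \<in> A" "b \<in> B"
    have "f * (a * b) = (f * a) * b" by (simp add: algebra_simps)
    moreover have "f * a \<in> ideal_gen A" "b \<in> ideal_gen B"
      using * by (simp_all only: ideal_gen_mult ideal_gen_base)
    ultimately show "f * (a * b) \<in> ideal_prod (ideal_gen A) (ideal_gen B)"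
      unfolding ideal_prod_eq by (intro pf.span_base) blast
  qed (simp add: ideal_prod_eq)
qed

section \<open>The ideal of polynomials without constant term\<close>

definition nonconst :: "(nat \<times> nat \<times> nat \<times> nat) set" where
  "nonconst = UNIV - {(0, 0, 0, 0)}"

definition nmono :: "nat \<times> nat \<times> nat \<times> nat \<Rightarrow> pfun" where
  "nmono = (\<lambda>(a1, a2, b1, b2). monomial a1 a2 b1 b2)"

lemma Pol_eq_span_nmono: "Pol = pf.span (range nmono)"
proof -
  have "{monomial a1 a2 b1 b2 | a1 a2 b1 b2. True} = range nmono"
    unfolding nmono_def image_def by fastforce
  then show ?thesis by (simp only: Pol_eq)
qed

lemma maxIdeal_eq: "maxIdeal = pf.span (nmono ` nonconst)"
proof -
  have R: "range nmono = insert 1 (nmono ` nonconst)"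
  proof -
    have "range nmono = nmono ` insert (0, 0, 0, 0) nonconst"
      unfolding nonconst_def by (rule arg_cong[where f = "(`) nmono"]) auto
    then show ?thesis by (simp add: nmono_def monomial_0)
  qed
  have vanish: "p ((0,0),(0,0)) = 0" if "p \<in> pf.span (nmono ` nonconst)" for p
    using that by (induction rule: pf.span_induct_alt)
      (auto simp: pscale_def nmono_def monomial_def nonconst_def fun_apply)
  show ?thesis
  proof
    show "pf.span (nmono ` nonconst) \<subseteq> maxIdeal"
      using vanish pf.span_mono[of "nmono ` nonconst" "range nmono"]
      by (auto simp: maxIdeal_def Pol_eq_span_nmono)
    show "maxIdeal \<subseteq> pf.span (nmono ` nonconst)"
    proof
      fix p assume p: "p \<in> maxIdeal"
      then have "p \<in> pf.span (insert 1 (nmono ` nonconst))"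
        by (simp add: maxIdeal_def Pol_eq_span_nmono R)
      \<comment> \<open>Isolates the constant term \<open>c\<close>; evaluation at the origin, where
        all other monomials vanish, shows that it is 0.\<close>
      then obtain c where c: "p - pscale c 1 \<in> pf.span (nmono ` nonconst)"
        by (auto simp: pf.span_breakdown_eq)
      have "c = 0" using vanish[OF c] p by (simp add: maxIdeal_def pscale_def fun_apply)
      then show "p \<in> pf.span (nmono ` nonconst)" using c by simp
    qed
  qed
qed

lemma ideal_gen_eq_span_nmono:
  "ideal_gen G = pf.span {f * g | f g. f \<in> range nmono \<and> g \<in> G}"
  unfolding ideal_gen_eq Pol_eq_span_nmono by (rule span_products)

text \<open>A polynomial coefficient of a generator is absorbed by the factor without constant term.
  Compared with \<open>ideal_gen_eq_span_nmono\<close> only the constant monomial is missing, so the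
  quotient is spanned by the classes of the generators.\<close>

lemma ideal_prod_max_eq:
  "ideal_prod maxIdeal (ideal_gen G) = pf.span {f * g | f g. f \<in> nmono ` nonconst \<and> g \<in> G}"
proof -
  have "ideal_prod maxIdeal (ideal_gen G) = pf.span {f * g | f g. f \<in> maxIdeal \<and> g \<in> G}"
    unfolding ideal_prod_eq
  proof
    show "pf.span {f * g |f g. f \<in> maxIdeal \<and> g \<in> G} \<subseteq> pf.span {f * g |f g. f \<in> maxIdeal \<and> g \<in> ideal_gen G}"
      by (intro pf.span_mono) (auto intro: ideal_gen_base)
    show "pf.span {f * g |f g. f \<in> maxIdeal \<and> g \<in> ideal_gen G} \<subseteq> pf.span {f * g |f g. f \<in> maxIdeal \<and> g \<in> G}"
    proof (intro pf.span_minimal pf.subspace_span, safe)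
      fix f g assume f: "f \<in> maxIdeal" and g: "g \<in> ideal_gen G"
      show "f * g \<in> pf.span {f * g |f g. f \<in> maxIdeal \<and> g \<in> G}"
      proof (rule span_mult_mem[OF pf.subspace_span _ _ g[unfolded ideal_gen_eq]])
        show "f \<in> pf.span maxIdeal" using f by (rule pf.span_base)
        fix p q assume p: "p \<in> maxIdeal" and "q \<in> {f * g |f g. f \<in> Pol \<and> g \<in> G}"
        then obtain r s where q: "q = r * s" "r \<in> Pol" "s \<in> G" by auto
        have "p * q = (p * r) * s" using q by (simp add: mult.assoc)
        moreover have "p * r \<in> maxIdeal" using p q by (auto simp: maxIdeal_def Pol_mult fun_apply)
        ultimately show "p * q \<in> pf.span {f * g |f g. f \<in> maxIdeal \<and> g \<in> G}"
          using q(3) by (intro pf.span_base) blast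
      qed
    qed
  qed
  then show ?thesis
    by (simp only: maxIdeal_eq span_products)
qed

subsection \<open>Bihomogeneous components and dimensions\<close>

lemma bihom_scaled: "p \<in> bihom a b \<Longrightarrow> p ((c * x1, c * x2), (e * y1, e * y2)) = c ^ a * e ^ b * p ((x1, x2), (y1, y2))"
  by (simp add: bihom_def)

lemma subspace_bihom: "pf.subspace (bihom a b)"
  unfolding pf.subspace_def bihom_def
  by (auto simp: pf.subspace_0[OF subspace_Pol] Pol_add Pol_scale fun_apply pscale_apply algebra_simps)

lemma bihom_mult: "f * g \<in> bihom (a + c) (b + d)" if "f \<in> bihom a b" "g \<in> bihom c d"
  using that unfolding bihom_def by (auto simp: Pol_mult fun_apply power_add)

lemma bihom_power: "f ^ n \<in> bihom (n * a) (n * b)" if "f \<in> bihom a b"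
  using that unfolding bihom_def by (auto simp: Pol_power power_fun_apply power_mult_distrib power_mult mult.commute[of n])

lemma bihom_one: "1 \<in> bihom 0 0"
  unfolding bihom_def by (auto simp: Pol_one fun_apply)

lemma bihom_coords: "cu \<in> bihom 1 0" "cw \<in> bihom 1 0" "cv \<in> bihom 0 1" "cz \<in> bihom 0 1"
  unfolding bihom_def
  by (auto simp: Pol_cu Pol_cw Pol_cv Pol_cz) (auto simp: cu_def cw_def cv_def cz_def algebra_simps)

lemma bihom_monomial: "monomial a1 a2 b1 b2 \<in> bihom (a1 + a2) (b1 + b2)"
  unfolding bihom_def
  by (auto simp: Pol_monomial) (auto simp: monomial_def power_mult_distrib power_add)

text \<open>The identity theorem for polynomials in one variable, applied in \<open>c\<close> for
  fixed \<open>e\<close> and then in \<open>e\<close>.\<close>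

lemma bivariate_zero_imp_coeff_zero:
  fixes r :: "nat \<times> nat \<Rightarrow> complex"
  assumes "finite F" and zero: "\<And>c e. (\<Sum>d\<in>F. r d * c ^ fst d * e ^ snd d) = 0" and "d0 \<in> F"
  shows "r d0 = 0"
proof -
  obtain N where N: "F \<subseteq> {..N} \<times> {..N}"
  proof
    let ?N = "Max (insert 0 (fst ` F \<union> snd ` F))"
    have "fst d \<le> ?N \<and> snd d \<le> ?N" if "d \<in> F" for d
      using assms(1) that by (intro conjI Max_ge) auto
    then show "F \<subseteq> {..?N} \<times> {..?N}" by (auto simp: subset_iff mem_Times_iff)
  qed
  \<comment> \<open>Extension of \<open>r\<close> by zero to a full square of exponents, where the
    sum can be iterated.\<close>
  define r' where "r' d = (if d \<in> F then r d else 0)" for d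
  have "(\<Sum>i\<le>N. (\<Sum>j\<le>N. r' (i, j) * e ^ j) * c ^ i) = 0" for c e
  proof -
    have "(\<Sum>i\<le>N. (\<Sum>j\<le>N. r' (i, j) * e ^ j) * c ^ i) = (\<Sum>d\<in>{..N} \<times> {..N}. r' d * c ^ fst d * e ^ snd d)"
    proof -
      have "(\<Sum>i\<le>N. (\<Sum>j\<le>N. r' (i, j) * e ^ j) * c ^ i) = (\<Sum>i\<le>N. \<Sum>j\<le>N. r' (i, j) * c ^ i * e ^ j)"
        unfolding sum_distrib_right by (intro sum.cong refl) (simp add: mult_ac)
      also have "\<dots> = (\<Sum>(i, j)\<in>{..N} \<times> {..N}. r' (i, j) * c ^ i * e ^ j)"
        by (rule sum.cartesian_product)
      finally show ?thesis by (simp add: case_prod_beta)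
    qed
    also have "\<dots> = (\<Sum>d\<in>F. r d * c ^ fst d * e ^ snd d)"
      by (rule sum.mono_neutral_cong_right) (use N in \<open>auto simp: r'_def\<close>)
    finally show ?thesis using zero by simp
  qed
  then have "\<forall>e. \<forall>i\<le>N. (\<Sum>j\<le>N. r' (i, j) * e ^ j) = 0"
    using polyfun_eq_0[of "\<lambda>i. (\<Sum>j\<le>N. r' (i, j) * _ ^ j)" N] by blast
  then have "\<forall>i\<le>N. \<forall>j\<le>N. r' (i, j) = 0"
    using polyfun_eq_0[of "\<lambda>j. r' (_, j)" N] by blast
  then show ?thesis
    using N assms(3) by (cases d0) (auto simp: r'_def split: if_splits)
qed

text \<open>Grouping the spanning elements by bidegree gives \<open>p\<close> as a finite sum of
  components. Scaling the two groups of variables by independent factors and comparing coefficients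
  shows that only the component of bidegree \<open>(a, b)\<close> survives.\<close>

lemma span_inter_bihom:
  assumes h: "\<And>x. x \<in> X \<Longrightarrow> h x \<in> bihom (da x) (db x)"
  shows "pf.span (h ` X) \<inter> bihom a b = pf.span (h ` {x \<in> X. da x = a \<and> db x = b})"
proof
  define Y where "Y d = {x \<in> X. (da x, db x) = d}" for d
  have Yb: "pf.span (h ` Y d) \<subseteq> bihom (fst d) (snd d)" for d
    by (rule pf.span_minimal[OF _ subspace_bihom]) (use h in \<open>auto simp: Y_def\<close>)
  have Yab: "Y (a, b) = {x \<in> X. da x = a \<and> db x = b}" by (auto simp: Y_def)
  show "pf.span (h ` {x \<in> X. da x = a \<and> db x = b}) \<subseteq> pf.span (h ` X) \<inter> bihom a b"
    using Yb[of "(a, b)"] pf.span_mono[of "h ` Y (a, b)" "h ` X"] by (auto simp: Yab)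
  show "pf.span (h ` X) \<inter> bihom a b \<subseteq> pf.span (h ` {x \<in> X. da x = a \<and> db x = b})"
  proof safe
    fix p assume p: "p \<in> pf.span (h ` X)" and pb: "p \<in> bihom a b"
    have "\<exists>q F. finite F \<and> (\<forall>d. q d \<in> pf.span (h ` Y d)) \<and> (\<forall>d. d \<notin> F \<longrightarrow> q d = 0) \<and> p = sum q F"
      using p
    proof (induction rule: pf.span_induct_alt)
      case base
      show ?case
        by (rule exI[of _ "\<lambda>_. 0"], rule exI[of _ "{}"]) (simp add: pf.span_zero)
    next
      case (step c x y)
      then obtain q F i where qF: "finite F" "\<And>d. q d \<in> pf.span (h ` Y d)" "\<And>d. d \<notin> F \<Longrightarrow> q d = 0"
        "y = sum q F" and i: "i \<in> X" "x = h i" by blast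
      define d0 where "d0 = (da i, db i)"
      define q' where "q' d = (if d = d0 then pscale c x else 0) + q d" for d
      have "x \<in> pf.span (h ` Y d0)"
        using i by (intro pf.span_base) (auto simp: Y_def d0_def)
      then have "q' d \<in> pf.span (h ` Y d)" for d
        unfolding q'_def by (auto intro!: pf.span_add pf.span_scale qF pf.span_zero)
      moreover have "q' d = 0" if "d \<notin> insert d0 F" for d
        using that qF(3) by (simp add: q'_def)
      moreover have "pscale c x + y = sum q' (insert d0 F)"
      proof -
        have "sum q (insert d0 F) = sum q F"
          using qF(1,3) by (cases "d0 \<in> F") (auto simp: insert_absorb)
        then show ?thesis
          using qF(1) by (simp add: q'_def sum.distrib sum.delta qF(4))
      qed
      ultimately show ?case
        using qF(1) by (intro exI[of _ q'] exI[of _ "insert d0 F"]) auto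
    qed
    then obtain q F where F: "finite F" and q: "\<And>d. q d \<in> pf.span (h ` Y d)"
      and q0: "\<And>d. d \<notin> F \<Longrightarrow> q d = 0" and pq: "p = sum q F" by blast
    have qb: "q d \<in> bihom (fst d) (snd d)" for d
      using q Yb by blast
    have "p v = q (a, b) v" for v
    proof -
      obtain x1 x2 y1 y2 where v: "v = ((x1, x2), (y1, y2))" by (metis surj_pair)
      \<comment> \<open>Coefficients of the difference of two expressions for \<open>p\<close> at
        the scaled point: the sum over the components, and the single term that the bihomogeneity of
        \<open>p\<close> provides.\<close>
      define r where "r d = q d v - (if d = (a, b) then p v else 0)" for d
      have "(\<Sum>d\<in>insert (a, b) F. r d * c ^ fst d * e ^ snd d) = 0" for c e
      proof -
        have "p ((c * x1, c * x2), (e * y1, e * y2)) = (\<Sum>d\<in>F. q d v * c ^ fst d * e ^ snd d)"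
          unfolding pq sum_fun_apply v
          by (rule sum.cong) (use bihom_scaled[OF qb] in auto)
        also have "\<dots> = (\<Sum>d\<in>insert (a, b) F. q d v * c ^ fst d * e ^ snd d)"
          by (rule sum.mono_neutral_left) (use F q0 in \<open>auto simp: fun_apply\<close>)
        finally have "c ^ a * e ^ b * p v = (\<Sum>d\<in>insert (a, b) F. q d v * c ^ fst d * e ^ snd d)"
          using bihom_scaled[OF pb, of c x1 x2 e y1 y2] v by simp
        moreover have "(\<Sum>d\<in>insert (a, b) F. (if d = (a, b) then p v else 0) * c ^ fst d * e ^ snd d)
            = (\<Sum>d\<in>insert (a, b) F. if d = (a, b) then p v * c ^ a * e ^ b else 0)"
          by (rule sum.cong) auto
        moreover have "\<dots> = p v * c ^ a * e ^ b"
          using F by (subst sum.delta) auto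
        moreover have "(\<Sum>d\<in>insert (a, b) F. r d * c ^ fst d * e ^ snd d)
            = (\<Sum>d\<in>insert (a, b) F. q d v * c ^ fst d * e ^ snd d)
              - (\<Sum>d\<in>insert (a, b) F. (if d = (a, b) then p v else 0) * c ^ fst d * e ^ snd d)"
          by (simp only: r_def left_diff_distrib sum_subtractf)
        ultimately show ?thesis by (simp add: mult_ac del: sum.insert)
      qed
      from bivariate_zero_imp_coeff_zero[OF _ this] have "r (a, b) = 0"
        using F by (meson finite_insert insertI1)
      then show ?thesis by (simp add: r_def)
    qed
    then have "p = q (a, b)" by (simp add: fun_eq_iff)
    then show "p \<in> pf.span (h ` {x \<in> X. da x = a \<and> db x = b})"
      using q[of "(a, b)"] Yab by simp
  qed
qed

section \<open>Dimension of a span enlarged by vectors independent modulo it\<close>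

context vector_space
begin

lemma span_Un_image_finite:
  assumes "finite J" "x \<in> span (A \<union> g ` J)"
  shows "\<exists>c. x - (\<Sum>j\<in>J. c j *s g j) \<in> span A"
  using assms
proof (induction J arbitrary: x rule: finite_induct)
  case (insert j J)
  then have "x \<in> span (insert (g j) (A \<union> g ` J))" by simp
  then obtain k where "x - k *s g j \<in> span (A \<union> g ` J)"
    by (auto simp: span_breakdown_eq)
  from insert.IH[OF this] obtain c where c: "x - k *s g j - (\<Sum>j\<in>J. c j *s g j) \<in> span A" by blast
  have "(\<Sum>i\<in>J. (c(j := k)) i *s g i) = (\<Sum>j\<in>J. c j *s g j)"
    by (rule sum.cong) (use insert(2) in auto)
  then have "x - (\<Sum>i\<in>insert j J. (c(j := k)) i *s g i) \<in> span A"
    using c insert(1,2) by (simp add: algebra_simps)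
  then show ?case by blast
qed auto

text \<open>Independence modulo \<open>span A\<close> is stated for coefficients indexed by
  \<open>J\<close>, so that it also makes \<open>g\<close> injective on \<open>J\<close>. In the
  application \<open>g\<close> runs through the generators of one bidegree and \<open>A\<close>
  spans the part coming from the maximal ideal.\<close>

lemma dim_span_Un_image:
  assumes "finite A" "finite J"
    and ind: "\<And>c. (\<Sum>j\<in>J. c j *s g j) \<in> span A \<Longrightarrow> \<forall>j\<in>J. c j = 0"
  shows "dim (span (A \<union> g ` J)) = dim (span A) + card J"
proof -
  obtain B where B: "B \<subseteq> A" "independent B" "A \<subseteq> span B" "card B = dim A"
    using basis_exists by blast
  have sBA: "span B = span A"
    using B by (intro span_eq[THEN iffD2]) (auto intro: span_base)
  have "independent (B \<union> g ` I) \<and> card (B \<union> g ` I) = card B + card I" if "I \<subseteq> J" for I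
    using finite_subset[OF that assms(2)] that
  proof (induction I rule: finite_induct)
    case empty
    then show ?case using B by simp
  next
    case (insert j I)
    have notin: "g j \<notin> span (B \<union> g ` I)"
    proof
      assume "g j \<in> span (B \<union> g ` I)"
      then obtain c where c: "g j - (\<Sum>i\<in>I. c i *s g i) \<in> span A"
        using span_Un_image_finite[OF insert(1)] sBA by metis
      \<comment> \<open>The relation for \<open>g j\<close> rewritten as a relation with coefficient
        1 at \<open>j\<close>, in conflict with \<open>ind\<close>.\<close>
      define c' where "c' i = (if i = j then 1 else if i \<in> I then - c i else 0)" for i
      have "(\<Sum>i\<in>J. c' i *s g i) = (\<Sum>i\<in>insert j I. c' i *s g i)"
        by (rule sum.mono_neutral_right) (use insert assms(2) in \<open>auto simp: c'_def\<close>)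
      also have "\<dots> = g j + (\<Sum>i\<in>I. c' i *s g i)"
        using insert(1,2) by (simp add: c'_def)
      also have "(\<Sum>i\<in>I. c' i *s g i) = - (\<Sum>i\<in>I. c i *s g i)"
        unfolding sum_negf[symmetric]
        by (rule sum.cong) (use insert(2) in \<open>auto simp: c'_def\<close>)
      finally have "c' j = 0" using ind[of c'] c insert.prems by auto
      then show False by (simp add: c'_def)
    qed
    then have "g j \<notin> B \<union> g ` I" by (meson span_base)
    moreover have "finite (B \<union> g ` I)"
      using insert(1) B(1) assms(1) finite_subset by auto
    ultimately show ?case
      using insert notin by (simp add: independent_insert)
  qed
  from this[of J] have "independent (B \<union> g ` J)" "card (B \<union> g ` J) = card B + card J" by auto
  moreover have "span (B \<union> g ` J) = span (A \<union> g ` J)"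
    by (simp add: span_Un sBA)
  ultimately show ?thesis
    using dim_eq_card[of "B \<union> g ` J" "span (A \<union> g ` J)"] B(4) by (simp add: span_span)
qed

end

subsection \<open>Generators of the ideal of alternating polynomials\<close>

definition act :: "nat \<Rightarrow> nat \<Rightarrow> pfun \<Rightarrow> pfun" where
  "act k j f = (\<lambda>(x, y). f (refl (Defs.root k j) x, refl (Defs.root k j) y))"

lemma act_mult: "act k j (f * g) = act k j f * act k j g"
  and act_add: "act k j (f + g) = act k j f + act k j g"
  and act_diff: "act k j (f - g) = act k j f - act k j g"
  and act_uminus: "act k j (- f) = - act k j f"
  and act_pscale: "act k j (pscale c f) = pscale c (act k j f)"
  and act_one: "act k j 1 = 1"
  by (auto simp: act_def fun_eq_iff fun_apply pscale_def)

lemma act_power: "act k j (f ^ n) = act k j f ^ n"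
  by (induction n) (simp_all add: act_one act_mult)

text \<open>For a real vector, read as a complex number \<open>x\<close>, the reflection in the root
  of angle \<open>\<theta>\<close> is \<open>x \<mapsto> cis (2 * \<theta>) * (- cnj x)\<close>. The
  form \<open>\<i> * z2 - z1\<close> is the complex bilinear substitute for \<open>- cnj x\<close>.
  The length of the root cancels.\<close>

lemma refl_polar:
  fixes z1 z2 :: complex
  assumes "r \<noteq> 0" and z': "z' = refl (r *\<^sub>R (cos \<theta>, sin \<theta>)) (z1, z2)"
  shows "fst z' + \<i> * snd z' = cis (2 * \<theta>) * (\<i> * z2 - z1)"
    and "\<i> * snd z' - fst z' = cis (- (2 * \<theta>)) * (z1 + \<i> * z2)"
proof -
  define C where "C = complex_of_real (cos \<theta>)"
  define S where "S = complex_of_real (sin \<theta>)"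
  have CS: "C * C + S * S = 1"
    unfolding C_def S_def by (metis of_real_1 of_real_add of_real_mult power2_eq_square sin_cos_squared_add2)
  have nrm: "(r * cos \<theta>)\<^sup>2 + (r * sin \<theta>)\<^sup>2 = r\<^sup>2"
    by (simp add: power_mult_distrib flip: distrib_left)
  have fs: "fst z' = z1 - 2 * (C * z1 + S * z2) * C" "snd z' = z2 - 2 * (C * z1 + S * z2) * S"
  proof -
    have cancel: "(R * a) / (R * R) * (R * b) = a * b" if "R \<noteq> 0" for R a b :: complex
      using that by simp
    have R: "complex_of_real r \<noteq> 0" using assms(1) by simp
    have num: "2 * (of_real (r * cos \<theta>) * z1 + of_real (r * sin \<theta>) * z2) = of_real r * (2 * (C * z1 + S * z2))"
      by (simp add: C_def S_def algebra_simps)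
    have den: "complex_of_real ((r * cos \<theta>)\<^sup>2 + (r * sin \<theta>)\<^sup>2) = of_real r * of_real r"
      unfolding nrm by (simp add: power2_eq_square)
    have cs: "complex_of_real (r * cos \<theta>) = of_real r * C" "complex_of_real (r * sin \<theta>) = of_real r * S"
      by (simp_all add: C_def S_def)
    show "fst z' = z1 - 2 * (C * z1 + S * z2) * C" "snd z' = z2 - 2 * (C * z1 + S * z2) * S"
      unfolding z' refl_def Let_def scaleR_Pair real_scaleR_def fst_conv snd_conv num den
      unfolding cs cancel[OF R] by (rule HOL.refl)+
  qed
  have cis: "cis (2 * \<theta>) = C * C - S * S + 2 * \<i> * S * C"
    "cis (- (2 * \<theta>)) = C * C - S * S - 2 * \<i> * S * C"
    by (simp_all add: C_def S_def complex_eq_iff cos_double sin_double power2_eq_square)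
  have ii: "\<i> * \<i> = -1" by simp
  show "fst z' + \<i> * snd z' = cis (2 * \<theta>) * (\<i> * z2 - z1)"
    unfolding fs cis using CS ii by algebra
  show "\<i> * snd z' - fst z' = cis (- (2 * \<theta>)) * (z1 + \<i> * z2)"
    unfolding fs cis using CS ii by algebra
qed

definition zeta :: "nat \<Rightarrow> nat \<Rightarrow> complex" where
  "zeta k j = cis (2 * (real j * pi / real k))"

lemma zeta_nonzero: "zeta k j \<noteq> 0"
  by (simp add: zeta_def)

lemma zeta_power: "k > 0 \<Longrightarrow> zeta k j ^ k = 1"
proof -
  assume "k > 0"
  then have "zeta k j ^ k = cis (2 * pi * real_of_int (int j))"
    unfolding zeta_def Complex.DeMoivre by (simp add: field_simps)
  then show ?thesis by (simp only: cis_multiple_2pi Ints_of_int)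
qed

lemma act_coords:
  "act k j cu = pscale (zeta k j) cw" "act k j cv = pscale (zeta k j) cz"
  "act k j cw = pscale (inverse (zeta k j)) cu" "act k j cz = pscale (inverse (zeta k j)) cv"
proof -
  have r: "root_len k j \<noteq> 0" by (auto simp: root_len_def)
  have [simp]: "inverse (zeta k j) = cis (- (2 * (real j * pi / real k)))"
    by (simp add: zeta_def cis_inverse)
  note p = refl_polar[OF r refl, of "real j * pi / real k", folded Defs.root_def zeta_def]
  show "act k j cu = pscale (zeta k j) cw" "act k j cv = pscale (zeta k j) cz"
    "act k j cw = pscale (inverse (zeta k j)) cu" "act k j cz = pscale (inverse (zeta k j)) cv"
    using p by (auto simp: fun_eq_iff act_def cu_def cv_def cw_def cz_def pscale_def split: prod.splits)
       (metis fst_conv snd_conv)+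
qed

text \<open>In a product of two reflections the two signs cancel, so only the reflections impose
  conditions.\<close>

lemma alt_eq: "alt k = {p \<in> Pol. \<forall>j<k. act k j p = - p}"
proof -
  have "(\<forall>(g, d)\<in>weyl k. \<forall>x y. p (g x, g y) = d * p (x, y)) \<longleftrightarrow> (\<forall>j<k. act k j p = - p)" for p
  proof
    assume L: "\<forall>(g, d)\<in>weyl k. \<forall>x y. p (g x, g y) = d * p (x, y)"
    show "\<forall>j<k. act k j p = - p"
    proof (intro allI impI)
      fix j assume "j < k"
      then have "(refl (Defs.root k j), -1) \<in> weyl k"
        unfolding weyl_def pos_roots_def by blast
      then have "p (refl (Defs.root k j) x, refl (Defs.root k j) y) = - p (x, y)" for x y
        using L by fastforce
      then show "act k j p = - p" by (auto simp: act_def fun_eq_iff fun_apply)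
    qed
  next
    assume R: "\<forall>j<k. act k j p = - p"
    have *: "p (refl a x, refl a y) = - p (x, y)" if "a \<in> pos_roots k" for a x y
    proof -
      from that obtain j where "a = Defs.root k j" "j < k" by (auto simp: pos_roots_def)
      then show ?thesis using fun_cong[OF R[rule_format, of j], of "(x, y)"] by (simp add: act_def fun_apply)
    qed
    have "p (g x, g y) = d * p (x, y)" if gd: "(g, d) \<in> weyl k" for g d x y
    proof -
      from gd consider a where "a \<in> pos_roots k" "g = refl a" "d = -1"
        | a b where "a \<in> pos_roots k" "b \<in> pos_roots k" "g = refl a \<circ> refl b" "d = 1"
        unfolding weyl_def by blast
      then show ?thesis by cases (simp_all add: *)
    qed
    then show "\<forall>(g, d)\<in>weyl k. \<forall>x y. p (g x, g y) = d * p (x, y)" by blast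
  qed
  then show ?thesis by (simp add: alt_def)
qed

text \<open>\<open>Df\<close> is \<open>2 * \<i>\<close> times the determinant
  \<open>x1 * y2 - x2 * y1\<close>. \<open>Pf k k\<close> is, up to a scalar, the product of the
  positive roots in the variables x, and the other \<open>Pf k l\<close> are its
  polarizations.\<close>

definition Df :: pfun where "Df = cu * cz - cw * cv"
definition Pf :: "nat \<Rightarrow> nat \<Rightarrow> pfun" where "Pf k l = cu ^ l * cv ^ (k - l) - cw ^ l * cz ^ (k - l)"

lemma Pol_Df: "Df \<in> Pol" and Pol_Pf: "Pf k l \<in> Pol"
  unfolding Df_def Pf_def by (intro Pol_intros)+

lemma pscale_power: "pscale c f ^ n = pscale (c ^ n) (f ^ n)"
  by (simp add: fun_eq_iff power_fun_apply pscale_apply power_mult_distrib)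

lemma act_lmono: "act k j (lmono a b c d) = pscale (zeta k j ^ (a + c) * inverse (zeta k j) ^ (b + d)) (lmono b a d c)"
  unfolding lmono_def act_mult act_power act_coords pscale_power pscale_mult_left pscale_mult_right pf.scale_scale
  by (simp add: power_add mult_ac)

lemma Df_alt: "Df \<in> alt k"
proof -
  have "act k j Df = - Df" for j
    unfolding Df_def act_diff act_mult act_coords pscale_mult_left pscale_mult_right pf.scale_scale
    by (simp add: zeta_nonzero)
  then show ?thesis by (simp add: alt_eq Pol_Df)
qed

lemma Pf_alt: "Pf k l \<in> alt k" if "l \<le> k" "k > 0"
proof -
  have Pf: "Pf k l = lmono l 0 (k - l) 0 - lmono 0 l 0 (k - l)"
    by (simp add: Pf_def lmono_def)
  have "act k j (Pf k l) = - Pf k l" for j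
    using zeta_power[of k j] that unfolding Pf act_diff act_lmono by (simp add: power_inverse)
  then show ?thesis by (simp add: alt_eq Pol_Pf)
qed

lemma power_diff_dvd: "\<exists>g\<in>Pol. x ^ n - y ^ n = (x - y) * g" if "x \<in> Pol" "y \<in> Pol" for x y :: pfun
proof (induction n)
  case 0
  show ?case using pf.subspace_0[OF subspace_Pol] by (intro bexI[of _ 0]) auto
next
  case (Suc n)
  then obtain g where g: "g \<in> Pol" "x ^ n - y ^ n = (x - y) * g" by blast
  have "x ^ Suc n - y ^ Suc n = x * (x ^ n - y ^ n) + (x - y) * y ^ n"
    by (simp add: algebra_simps)
  also have "\<dots> = (x - y) * (x * g + y ^ n)"
    unfolding g(2) by (simp add: algebra_simps)
  finally show ?case
    using g(1) that by (metis Pol_add Pol_mult Pol_power)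
qed

section \<open>Antisymmetrized monomials lie in the ideal of the generators\<close>

definition gens1 :: "nat \<Rightarrow> pfun set" where
  "gens1 k = insert Df (Pf k ` {..k})"

lemmas ideal_gen_add = pf.subspace_add[OF subspace_ideal_gen]
  and ideal_gen_neg = pf.subspace_neg[OF subspace_ideal_gen]
  and ideal_gen_scale = pf.subspace_scale[OF subspace_ideal_gen]
  and ideal_gen_zero = pf.subspace_0[OF subspace_ideal_gen]

text \<open>Once the common powers are taken out, \<open>(cu * cz) ^ e - (cw * cv) ^ e\<close>
  remains, which is divisible by \<open>Df\<close>.\<close>

lemma lmono_swap_diff_0:
  assumes "a + c = b + d" shows "lmono a b c d - lmono b a d c \<in> ideal_gen (gens1 k)"
proof -
  have *: "lmono a b c d - lmono b a d c \<in> ideal_gen (gens1 k)" if "b \<le> a" "a + c = b + d" for a b c d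
  proof -
    define e where "e = a - b"
    have a: "a = b + e" and d: "d = c + e" using that by (auto simp: e_def)
    obtain g where g: "g \<in> Pol" "(cu * cz) ^ e - (cw * cv) ^ e = (cu * cz - cw * cv) * g"
      using power_diff_dvd[of "cu * cz" "cw * cv" e] by (metis Pol_mult Pol_cu Pol_cv Pol_cw Pol_cz)
    have "lmono a b c d - lmono b a d c = lmono b b c c * ((cu * cz) ^ e - (cw * cv) ^ e)"
      unfolding a d lmono_def by (simp add: power_add power_mult_distrib algebra_simps)
    also have "\<dots> = (lmono b b c c * g) * Df"
      unfolding g(2) Df_def by (simp add: mult_ac)
    finally show ?thesis
      using g(1) by (simp only: ideal_gen_mult Pol_mult Pol_lmono ideal_gen_base gens1_def insertI1)
  qed
  show ?thesis
  proof (cases "b \<le> a")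
    case False
    then have "lmono b a d c - lmono a b c d \<in> ideal_gen (gens1 k)"
      using * assms by simp
    from ideal_gen_neg[OF this] show ?thesis by simp
  qed (use * assms in auto)
qed

text \<open>Modulo a multiple of some \<open>Pf k i\<close>, a factor
  \<open>cu ^ i * cv ^ (k - i)\<close> may be exchanged for \<open>cw ^ i * cz ^ (k - i)\<close>.
  The rest of the monomial has an excess smaller by \<open>k\<close>, to which the induction
  hypothesis applies.\<close>

lemma lmono_swap_diff_pos:
  assumes "a + c = b + d + k * n" shows "lmono a b c d - lmono b a d c \<in> ideal_gen (gens1 k)"
  using assms
proof (induction n arbitrary: a c)
  case 0
  then show ?case using lmono_swap_diff_0 by simp
next
  case (Suc n)
  \<comment> \<open>A factor of degree \<open>k\<close> is removed from
    \<open>cu ^ a * cv ^ c\<close>, with as many \<open>cu\<close> as possible; the bound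
    \<open>a + c \<ge> k\<close> ensures that enough \<open>cv\<close> are left.\<close>
  define i where "i = min a k"
  define a' where "a' = a - i"
  define c' where "c' = c - (k - i)"
  have ac: "a = i + a'" "c = (k - i) + c'"
    using Suc.prems unfolding a'_def c'_def i_def by auto
  have "a' + c' = b + d + k * n" using Suc.prems unfolding a'_def c'_def i_def by (auto simp: min_def)
  note IH = Suc.IH[OF this]
  have "i \<le> k" by (simp add: i_def)
  then have P: "Pf k i \<in> ideal_gen (gens1 k)" by (intro ideal_gen_base) (simp add: gens1_def)
  have "lmono a b c d - lmono b a d c =
      lmono a' b c' d * Pf k i + lmono 0 i 0 (k - i) * (lmono a' b c' d - lmono b a' d c')"
    unfolding ac Pf_def lmono_def by (simp add: power_add algebra_simps)
  then show ?case
    using IH P by (simp only: ideal_gen_add ideal_gen_mult Pol_lmono)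
qed

lemma lmono_swap_diff:
  assumes "int k dvd int (a + c) - int (b + d)"
  shows "lmono a b c d - lmono b a d c \<in> ideal_gen (gens1 k)"
proof -
  obtain s where s: "int (a + c) - int (b + d) = int k * s" using assms by blast
  show ?thesis
  proof (cases "s \<ge> 0")
    case True
    then have "a + c = b + d + k * nat s"
      using s by (metis add.commute diff_add_cancel int_nat_eq of_nat_add of_nat_eq_iff of_nat_mult)
    then show ?thesis by (rule lmono_swap_diff_pos)
  next
    case False
    then have "int (b + d) = int (a + c) + int k * int (nat (- s))"
      using s by simp
    then have "b + d = a + c + k * nat (- s)"
      by (metis of_nat_add of_nat_eq_iff of_nat_mult)
    from ideal_gen_neg[OF lmono_swap_diff_pos[OF this]] show ?thesis by simp
  qed
qed

text \<open>Orthogonality of characters of the cyclic group: the summands are the powers of a single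
  \<open>k\<close>-th root of unity \<open>w\<close>, and \<open>w = 1\<close> is the stated
  congruence.\<close>

lemma sum_zeta:
  assumes "k > 0"
  shows "(\<Sum>j<k. zeta k j ^ p * inverse (zeta k j) ^ q) = (if int k dvd int p - int q then of_nat k else 0)"
proof -
  define w where "w = cis (2 * pi * (real p - real q) / real k)"
  have zw: "zeta k j ^ p * inverse (zeta k j) ^ q = w ^ j" for j
    unfolding zeta_def w_def cis_inverse Complex.DeMoivre cis_mult
    by (rule arg_cong[where f = cis]) (use assms in \<open>simp add: field_simps\<close>)
  have "w ^ k = cis (2 * pi * real_of_int (int p - int q))"
    unfolding w_def Complex.DeMoivre using assms by simp
  then have wk: "w ^ k = 1" by (simp only: cis_multiple_2pi Ints_of_int)
  have one: "w = 1 \<longleftrightarrow> int k dvd int p - int q"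
  proof
    assume "w = 1"
    then obtain n :: int where "2 * pi * (real p - real q) / real k = real_of_int (2 * n) * pi"
      unfolding w_def by (auto simp: complex_eq_iff cos_one_2pi_int mult_ac)
    then have "(2 * pi) * (real p - real q) = (2 * pi) * real_of_int (int k * n)"
      using assms by (simp add: field_simps)
    then have "real p - real q = real_of_int (int k * n)"
      by (subst (asm) mult_cancel_left) simp
    then have "int p - int q = int k * n"
      by (metis of_int_diff of_int_eq_iff of_int_of_nat_eq)
    then show "int k dvd int p - int q" by simp
  next
    assume "int k dvd int p - int q"
    then obtain n where "int p - int q = int k * n" by blast
    then have "real p - real q = real k * real_of_int n"
      by (metis of_int_diff of_int_mult of_int_of_nat_eq)
    then have "2 * pi * (real p - real q) / real k = 2 * pi * real_of_int n"
      using assms by simp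
    then have "w = cis (2 * pi * real_of_int n)"
      unfolding w_def by (rule arg_cong)
    then show "w = 1" by (simp only: cis_multiple_2pi Ints_of_int)
  qed
  have "(\<Sum>j<k. w ^ j) = (if w = 1 then of_nat k else 0)"
    using sum_gp_strict[of w k] wk by simp
  then show ?thesis unfolding zw one .
qed

text \<open>\<open>R\<close> sums over the reflections, and composing it with the reflection
  \<open>0\<close> gives the sum over the rotations, so \<open>T\<close> is the unnormalized
  antisymmetrizer. It multiplies an alternating \<open>p\<close> by \<open>2 * k\<close>. A monomial
  goes to 0 or to \<open>k\<close> times a difference of swapped monomials whose degrees satisfy the
  congruence of \<open>lmono_swap_diff\<close>.\<close>

lemma alt_subset: assumes "k > 0" shows "alt k \<subseteq> ideal_gen (gens1 k)"
proof
  fix p assume "p \<in> alt k"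
  then have pP: "p \<in> Pol" and p: "\<And>j. j < k \<Longrightarrow> act k j p = - p" by (auto simp: alt_eq)
  define R where "R f = (\<Sum>j<k. act k j f)" for f
  define T where "T f = act k 0 (R f) - R f" for f
  have R_lin: "R (f + g) = R f + R g" "R (pscale c f) = pscale c (R f)" for f g c
    by (simp_all add: R_def act_add act_pscale sum.distrib pf.scale_sum_right)
  have T_lin: "T (f + g) = T f + T g" "T (pscale c f) = pscale c (T f)" for f g c
    by (simp_all add: T_def R_lin act_add act_pscale pf.scale_right_diff_distrib)
  have T_lmono: "T (lmono a b c d) \<in> ideal_gen (gens1 k)" for a b c d
  proof -
    define s where "s = (\<Sum>j<k. zeta k j ^ (a + c) * inverse (zeta k j) ^ (b + d))"
    have "R (lmono a b c d) = pscale s (lmono b a d c)"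
      unfolding R_def act_lmono s_def by (simp add: pf.scale_sum_left)
    then have "T (lmono a b c d) = pscale s (lmono a b c d - lmono b a d c)"
      by (simp add: T_def act_pscale act_lmono zeta_def pf.scale_right_diff_distrib)
    then show ?thesis
      using lmono_swap_diff[of k a c b d] sum_zeta[OF assms, of "a + c" "b + d"]
      by (auto simp: s_def[symmetric] ideal_gen_scale ideal_gen_zero split: if_splits)
  qed
  have "pf.subspace {f. T f \<in> ideal_gen (gens1 k)}"
    unfolding pf.subspace_def using T_lin(2)[of 0 0]
    by (auto simp: T_lin ideal_gen_add ideal_gen_scale ideal_gen_zero)
  then have "Pol \<subseteq> {f. T f \<in> ideal_gen (gens1 k)}"
    unfolding Pol_eq_span_lmono by (intro pf.span_minimal) (auto simp: T_lmono)
  then have "T p \<in> ideal_gen (gens1 k)" using pP by blast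
  moreover have "T p = pscale (of_nat (2 * k)) p"
  proof -
    have "R p = pscale (of_nat k) (- p)"
      unfolding R_def using p by (auto simp: fun_eq_iff fun_apply sum_fun_apply pscale_def)
    then show ?thesis
      unfolding T_def using p[of 0] assms
      by (simp add: act_pscale act_uminus) (auto simp: fun_eq_iff pscale_def fun_apply)
  qed
  ultimately have "pscale (inverse (of_nat (2 * k))) (pscale (of_nat (2 * k)) p) \<in> ideal_gen (gens1 k)"
    by (simp only: ideal_gen_scale)
  then show "p \<in> ideal_gen (gens1 k)" using assms by simp
qed

lemma altIdeal_eq: assumes "k > 0" shows "altIdeal k = ideal_gen (gens1 k)"
proof
  show "altIdeal k \<subseteq> ideal_gen (gens1 k)"
    unfolding altIdeal_def by (rule ideal_gen_minimal[OF alt_subset[OF assms]])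
  show "ideal_gen (gens1 k) \<subseteq> altIdeal k"
    unfolding altIdeal_def
    by (rule ideal_gen_minimal) (use Df_alt Pf_alt assms in \<open>auto simp: gens1_def intro!: ideal_gen_base\<close>)
qed

subsection \<open>Generators of its powers\<close>

text \<open>The greedy product of \<open>j\<close> factors with x-degree
  \<open>i \<le> j * k\<close>: as many \<open>Pf k k\<close> as possible, then one remainder, then
  copies of \<open>Pf k 0\<close>.\<close>

fun Qf :: "nat \<Rightarrow> nat \<Rightarrow> nat \<Rightarrow> pfun" where
  "Qf k 0 i = 1"
| "Qf k (Suc j) i = Pf k (min i k) * Qf k j (i - k)"

definition Gf :: "nat \<Rightarrow> nat \<Rightarrow> nat \<times> nat \<Rightarrow> pfun" where
  "Gf k m = (\<lambda>(j, i). Df ^ (m - j) * Qf k j i)"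

definition idx :: "nat \<Rightarrow> nat \<Rightarrow> (nat \<times> nat) set" where
  "idx k m = {(j, i). j \<le> m \<and> i \<le> j * k}"

definition powI :: "nat \<Rightarrow> nat \<Rightarrow> pfun set" where
  "powI k m = ideal_gen (Gf k m ` idx k m)"

lemma Pol_Qf: "Qf k j i \<in> Pol"
  by (induction k j i rule: Qf.induct) (simp_all only: Qf.simps Pol_one Pol_mult Pol_Pf)

lemma Pol_Gf: "Gf k m x \<in> Pol"
  by (cases x) (simp add: Gf_def Pol_mult Pol_power Pol_Df Pol_Qf)

lemma ideal_gen_mult_into:
  assumes G: "\<And>g. g \<in> G \<Longrightarrow> h * g \<in> ideal_gen H" and x: "x \<in> ideal_gen G"
  shows "h * x \<in> ideal_gen H"
proof -
  have "pf.subspace {x. h * x \<in> ideal_gen H}"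
    unfolding pf.subspace_def
    by (auto simp: distrib_left pscale_mult_right ideal_gen_add ideal_gen_scale ideal_gen_zero)
  moreover have "h * (f * g) \<in> ideal_gen H" if "f \<in> Pol" "g \<in> G" for f g
    using ideal_gen_mult[OF that(1) G[OF that(2)]] by (simp add: mult_ac)
  ultimately have "ideal_gen G \<subseteq> {x. h * x \<in> ideal_gen H}"
    unfolding ideal_gen_eq[of G] by (intro pf.span_minimal) auto
  then show ?thesis using x by blast
qed

lemma Gf_in_powI: "j \<le> m \<Longrightarrow> i \<le> j * k \<Longrightarrow> Df ^ (m - j) * Qf k j i \<in> powI k m"
  unfolding powI_def by (rule ideal_gen_base) (force simp: Gf_def idx_def)

lemma powI_mult: "f \<in> Pol \<Longrightarrow> x \<in> powI k m \<Longrightarrow> f * x \<in> powI k m"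
  unfolding powI_def by (rule ideal_gen_mult)

lemma powI_add: "x \<in> powI k m \<Longrightarrow> y \<in> powI k m \<Longrightarrow> x + y \<in> powI k m"
  unfolding powI_def by (rule ideal_gen_add)

lemma powI_mult_into:
  assumes "\<And>j i. j \<le> m \<Longrightarrow> i \<le> j * k \<Longrightarrow> h * (Df ^ (m - j) * Qf k j i) \<in> powI k m'" and "x \<in> powI k m"
  shows "h * x \<in> powI k m'"
  using assms(2) unfolding powI_def
  by (rule ideal_gen_mult_into[rotated]) (use assms(1) in \<open>auto simp: powI_def Gf_def idx_def\<close>)

lemma Df_powI: "x \<in> powI k m \<Longrightarrow> Df * x \<in> powI k (Suc m)"
proof (erule powI_mult_into[rotated])
  fix j i assume "j \<le> m" "i \<le> j * k"
  then show "Df * (Df ^ (m - j) * Qf k j i) \<in> powI k (Suc m)"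
    using Gf_in_powI[of j "Suc m" i k] by (simp add: Suc_diff_le mult_ac)
qed

lemma Df_power_powI: "x \<in> powI k m \<Longrightarrow> Df ^ n * x \<in> powI k (m + n)"
proof (induction n)
  case (Suc n)
  then have "Df * (Df ^ n * x) \<in> powI k (Suc (m + n))" by (intro Df_powI)
  then show ?case by (simp add: mult.assoc)
qed simp

text \<open>The difference of the two products is a monomial times two differences of powers of
  \<open>cu * cz\<close> and \<open>cw * cv\<close>, each divisible by \<open>Df\<close>. The second
  factor \<open>Df\<close> matters: multiplied by a product with one factor fewer it still lies in
  the required power.\<close>

lemma Pf_mult_Pf:
  assumes "l \<le> k" "l' \<le> k"
  shows "\<exists>g\<in>Pol. Pf k l * Pf k l' = Pf k (min (l + l') k) * Pf k (l + l' - k) + Df * (Df * g)"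
proof -
  define M where "M = min (l + l') k"
  define N where "N = l + l' - k"
  \<comment> \<open>With this choice \<open>k = N + n + n' + r\<close>, and all exponents are sums
    of these four numbers, whether or not \<open>l + l'\<close> exceeds \<open>k\<close>.\<close>
  define n where "n = l - N"
  define n' where "n' = l' - N"
  define r where "r = k - M"
  have eqs: "l = N + n" "l' = N + n'" "M = N + n + n'" "k - l = n' + r" "k - l' = n + r"
    "k - M = r" "k - N = n + n' + r"
    using assms unfolding n_def n'_def r_def M_def N_def by auto
  obtain g where g: "g \<in> Pol" "(cu * cz) ^ n - (cw * cv) ^ n = (cu * cz - cw * cv) * g"
    using power_diff_dvd[of "cu * cz" "cw * cv" n] by (metis Pol_mult Pol_cu Pol_cv Pol_cw Pol_cz)
  obtain g' where g': "g' \<in> Pol" "(cu * cz) ^ n' - (cw * cv) ^ n' = (cu * cz - cw * cv) * g'"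
    using power_diff_dvd[of "cu * cz" "cw * cv" n'] by (metis Pol_mult Pol_cu Pol_cv Pol_cw Pol_cz)
  let ?c = "cu ^ N * cw ^ N * cv ^ r * cz ^ r"
  have "Pf k l * Pf k l' - Pf k M * Pf k N =
      ?c * ((cu * cz) ^ n - (cw * cv) ^ n) * ((cu * cz) ^ n' - (cw * cv) ^ n')"
    unfolding Pf_def eqs(4-7) unfolding eqs(1-3)
    by (simp add: power_add power_mult_distrib algebra_simps)
  also have "\<dots> = Df * (Df * (?c * g * g'))"
    unfolding g(2) g'(2) Df_def by (simp only: mult_ac)
  finally have "Pf k l * Pf k l' = Pf k M * Pf k N + Df * (Df * (?c * g * g'))"
    by (simp add: diff_eq_eq add.commute)
  moreover have "?c * g * g' \<in> Pol"
    by (intro Pol_intros g(1) g'(1))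
  ultimately show ?thesis unfolding M_def N_def by blast
qed

text \<open>Up to multiples of \<open>Df\<close>, a product of \<open>j\<close> factors \<open>Pf k l\<close> depends only on the sum of the
  \<open>l\<close>; the product \<open>Qf k j i\<close> is the representative with sum \<open>i\<close>.\<close>

lemma Pf_powI_step:
  assumes C: "\<And>j i l. j \<le> m \<Longrightarrow> i \<le> j * k \<Longrightarrow> l \<le> k \<Longrightarrow>
      \<exists>e\<in>powI k j. Pf k l * Qf k j i = Qf k (Suc j) (i + l) + Df * e"
    and x: "x \<in> powI k m" and l: "l \<le> k"
  shows "Pf k l * x \<in> powI k (Suc m)"
proof (rule powI_mult_into[OF _ x])
  fix j i assume ji: "j \<le> m" "i \<le> j * k"
  then obtain e where e: "e \<in> powI k j" "Pf k l * Qf k j i = Qf k (Suc j) (i + l) + Df * e"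
    using C l by blast
  have "Pf k l * (Df ^ (m - j) * Qf k j i) = Df ^ (m - j) * (Pf k l * Qf k j i)"
    by (simp only: mult_ac)
  also have "\<dots> = Df ^ (Suc m - Suc j) * Qf k (Suc j) (i + l) + Df ^ Suc (m - j) * e"
    unfolding e(2) by (simp add: algebra_simps)
  moreover have "Df ^ (Suc m - Suc j) * Qf k (Suc j) (i + l) \<in> powI k (Suc m)"
    by (rule Gf_in_powI) (use ji l in auto)
  moreover have "Df ^ Suc (m - j) * e \<in> powI k (Suc m)"
    using Df_power_powI[OF e(1), of "Suc (m - j)"] ji by simp
  ultimately show "Pf k l * (Df ^ (m - j) * Qf k j i) \<in> powI k (Suc m)"
    by (simp only: powI_add)
qed

lemma Qf_in_powI: "i \<le> j * k \<Longrightarrow> Qf k j i \<in> powI k j"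
  using Gf_in_powI[of j j i k] by simp

text \<open>The new factor is merged with the leading factor \<open>l'\<close> of the greedy
  product. The larger part \<open>M\<close> becomes the new leading factor, the remainder
  \<open>N\<close> is pushed into the other factors by induction. The induction hypothesis also
  supplies the premise of \<open>Pf_powI_step\<close>, which controls the error multiplied by
  \<open>Pf k M\<close>.\<close>

lemma Pf_Qf:
  "i \<le> j * k \<Longrightarrow> l \<le> k \<Longrightarrow> \<exists>e\<in>powI k j. Pf k l * Qf k j i = Qf k (Suc j) (i + l) + Df * e"
proof (induction j arbitrary: i l rule: less_induct)
  case (less j)
  show ?case
  proof (cases j)
    case 0
    have "0 \<in> powI k 0" unfolding powI_def by (rule ideal_gen_zero)
    then show ?thesis using less.prems 0 by (intro bexI[of _ 0]) (auto simp: min_def)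
  next
    case (Suc j')
    define l' where "l' = min i k"
    define M where "M = min (l + l') k"
    define N where "N = l + l' - k"
    obtain g where g: "g \<in> Pol" "Pf k l * Pf k l' = Pf k M * Pf k N + Df * (Df * g)"
      using Pf_mult_Pf[of l k l'] less.prems unfolding M_def N_def l'_def by auto
    have i': "i - k \<le> j' * k" using less.prems(1) Suc by auto
    have N: "N \<le> k" using less.prems(2) by (auto simp: N_def l'_def)
    have M: "M \<le> k" by (simp add: M_def)
    obtain e where e: "e \<in> powI k j'" "Pf k N * Qf k j' (i - k) = Qf k (Suc j') (i - k + N) + Df * e"
      using less.IH[of j' "i - k" N] i' N Suc by blast
    have Me: "Pf k M * e \<in> powI k j"
      unfolding Suc by (rule Pf_powI_step[OF _ e(1) M]) (use less.IH Suc in auto)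
    have "Df * Qf k j' (i - k) \<in> powI k j"
      unfolding Suc by (intro Df_powI Qf_in_powI i')
    then have gQ: "g * (Df * Qf k j' (i - k)) \<in> powI k j" by (rule powI_mult[OF g(1)])
    have *: "min (i + l) k = M" "i + l - k = i - k + N"
      unfolding M_def N_def l'_def using less.prems by auto
    have Q: "Qf k (Suc j) (i + l) = Pf k M * Qf k (Suc j') (i - k + N)"
      unfolding Qf.simps(2)[of k j] * unfolding Suc ..
    have "Pf k l * Qf k j i = (Pf k l * Pf k l') * Qf k j' (i - k)"
      by (simp add: Suc l'_def mult.assoc)
    also have "\<dots> = Pf k M * (Pf k N * Qf k j' (i - k)) + Df * (g * (Df * Qf k j' (i - k)))"
      unfolding g(2) by (simp add: algebra_simps)
    also have "\<dots> = Qf k (Suc j) (i + l) + Df * (Pf k M * e + g * (Df * Qf k j' (i - k)))"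
      unfolding e(2) Q by (simp add: algebra_simps del: Qf.simps)
    finally show ?thesis using powI_add[OF Me gQ] by blast
  qed
qed

lemma Pf_powI: "x \<in> powI k m \<Longrightarrow> l \<le> k \<Longrightarrow> Pf k l * x \<in> powI k (Suc m)"
  by (rule Pf_powI_step[OF Pf_Qf])

text \<open>Multiplying by \<open>Df\<close> or some \<open>Pf k l\<close> stays within the family
  of ideals \<open>powI\<close>. Conversely every new generator has a factor in
  \<open>gens1 k\<close>: \<open>Df\<close> if \<open>j \<le> m\<close>, and otherwise the leading
  factor of \<open>Qf\<close>.\<close>

lemma altIdeal_pow_eq: "k > 0 \<Longrightarrow> altIdeal_pow k m = powI k m"
proof (induction m)
  case 0
  have "1 \<in> powI k 0" using Qf_in_powI[of 0 0 k] by simp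
  then have "f \<in> powI k 0" if "f \<in> Pol" for f
    using powI_mult[OF that, of 1] by simp
  moreover have "powI k 0 \<subseteq> Pol"
    unfolding powI_def ideal_gen_eq
    by (rule pf.span_minimal[OF _ subspace_Pol]) (auto simp: Pol_mult Pol_Gf)
  ultimately show ?case by auto
next
  case (Suc m)
  then have IH: "altIdeal_pow k m = powI k m" by simp
  let ?AB = "{a * b |a b. a \<in> gens1 k \<and> b \<in> Gf k m ` idx k m}"
  have "altIdeal_pow k (Suc m) = ideal_gen ?AB"
    unfolding altIdeal_pow.simps IH altIdeal_eq[OF \<open>k > 0\<close>] powI_def ideal_prod_gen ..
  also have "\<dots> = powI k (Suc m)"
  proof
    have "a * b \<in> powI k (Suc m)" if "a \<in> gens1 k" "b \<in> Gf k m ` idx k m" for a b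
    proof -
      have b: "b \<in> powI k m" unfolding powI_def using that(2) by (rule ideal_gen_base)
      show ?thesis
        using that(1) b unfolding gens1_def by (auto simp: Df_powI Pf_powI)
    qed
    then have "?AB \<subseteq> powI k (Suc m)" by blast
    then show "ideal_gen ?AB \<subseteq> powI k (Suc m)"
      unfolding powI_def by (rule ideal_gen_minimal)
    have "Gf k (Suc m) x \<in> ?AB" if xi: "x \<in> idx k (Suc m)" for x
    proof -
      obtain j i where x: "x = (j, i)" "j \<le> Suc m" "i \<le> j * k"
        using xi unfolding idx_def by blast
      show ?thesis
      proof (cases "j \<le> m")
        case True
        then have "Gf k (Suc m) x = Df * Gf k m (j, i)"
          by (simp add: Gf_def x Suc_diff_le mult.assoc)
        moreover have "(j, i) \<in> idx k m" using x True by (simp add: idx_def)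
        ultimately show ?thesis unfolding gens1_def by blast
      next
        case False
        then have j: "j = Suc m" using x by simp
        then have "Gf k (Suc m) x = Pf k (min i k) * Gf k m (m, i - k)"
          by (simp add: Gf_def x)
        moreover have "(m, i - k) \<in> idx k m" using x j by (auto simp: idx_def)
        moreover have "min i k \<in> {..k}" by simp
        ultimately show ?thesis unfolding gens1_def by blast
      qed
    qed
    then have "Gf k (Suc m) ` idx k (Suc m) \<subseteq> ideal_gen ?AB"
      using ideal_gen_base by blast
    then show "powI k (Suc m) \<subseteq> ideal_gen ?AB"
      unfolding powI_def by (rule ideal_gen_minimal)
  qed
  finally show ?case .
qed

subsection \<open>Minimality of the generators\<close>

lemma Pf_bihom: "l \<le> k \<Longrightarrow> Pf k l \<in> bihom l (k - l)"
proof -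
  assume "l \<le> k"
  have "cu ^ l * cv ^ (k - l) \<in> bihom (l * 1 + (k - l) * 0) (l * 0 + (k - l) * 1)"
    "cw ^ l * cz ^ (k - l) \<in> bihom (l * 1 + (k - l) * 0) (l * 0 + (k - l) * 1)"
    by (intro bihom_mult bihom_power bihom_coords)+
  then show ?thesis
    unfolding Pf_def by (intro pf.subspace_diff[OF subspace_bihom]) simp_all
qed

lemma Df_bihom: "Df \<in> bihom 1 1"
proof -
  have "cu * cz \<in> bihom (1 + 0) (0 + 1)" "cw * cv \<in> bihom (1 + 0) (0 + 1)"
    by (intro bihom_mult bihom_coords)+
  then show ?thesis
    unfolding Df_def by (intro pf.subspace_diff[OF subspace_bihom]) simp_all
qed

lemma Qf_bihom: "i \<le> j * k \<Longrightarrow> Qf k j i \<in> bihom i (j * k - i)"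
proof (induction k j i rule: Qf.induct)
  case (1 k i)
  then show ?case by (simp add: bihom_one)
next
  case (2 k j i)
  have "Qf k (Suc j) i \<in> bihom (min i k + (i - k)) ((k - min i k) + (j * k - (i - k)))"
    unfolding Qf.simps by (intro bihom_mult Pf_bihom 2) (use 2(2) in auto)
  moreover have "min i k + (i - k) = i" "(k - min i k) + (j * k - (i - k)) = Suc j * k - i"
    using 2(2) by (auto simp: min_def)
  ultimately show ?case by metis
qed

definition deg_x :: "nat \<Rightarrow> nat \<times> nat \<Rightarrow> nat" where "deg_x m = (\<lambda>(j, i). m - j + i)"
definition deg_y :: "nat \<Rightarrow> nat \<Rightarrow> nat \<times> nat \<Rightarrow> nat" where "deg_y k m = (\<lambda>(j, i). m - j + (j * k - i))"

lemma Gf_bihom: "g \<in> idx k m \<Longrightarrow> Gf k m g \<in> bihom (deg_x m g) (deg_y k m g)"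
proof -
  assume "g \<in> idx k m"
  then obtain j i where g: "g = (j, i)" "j \<le> m" "i \<le> j * k" unfolding idx_def by blast
  have "Df ^ (m - j) * Qf k j i \<in> bihom ((m - j) * 1 + i) ((m - j) * 1 + (j * k - i))"
    by (intro bihom_mult bihom_power Df_bihom Qf_bihom g)
  then show ?thesis unfolding g(1) Gf_def deg_x_def deg_y_def prod.case by (simp only: mult_1_right)
qed

text \<open>On the line \<open>u = v = 1\<close>, \<open>w = 0\<close>, \<open>z = \<epsilon>\<close>, the polynomial \<open>Df\<close> takes the value \<open>\<epsilon>\<close>, while all
  \<open>Qf k j i\<close> tend to \<open>1\<close> for \<open>\<epsilon> \<rightarrow> 0\<close>; hence \<open>Df\<close> does not divide \<open>Qf k j i\<close>.\<close>

definition line_pt :: "complex \<Rightarrow> (complex \<times> complex) \<times> (complex \<times> complex)" where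
  "line_pt \<epsilon> = ((1/2, -\<i>/2), ((1 - \<epsilon>)/2, -\<i> * (1 + \<epsilon>)/2))"

lemma coords_line_pt: "cu (line_pt \<epsilon>) = 1" "cw (line_pt \<epsilon>) = 0" "cv (line_pt \<epsilon>) = 1" "cz (line_pt \<epsilon>) = \<epsilon>"
  by (simp_all add: line_pt_def cu_def cv_def cw_def cz_def field_simps)

lemma Df_line_pt: "Df (line_pt \<epsilon>) = \<epsilon>"
  by (simp add: Df_def fun_apply coords_line_pt)

lemma Qf_line_pt_0: "k > 0 \<Longrightarrow> Qf k j i (line_pt 0) = 1"
proof (induction k j i rule: Qf.induct)
  case (2 k j i)
  have "Pf k l (line_pt 0) = 1" if "l \<le> k" for l
    using that 2(2) by (cases "l = 0") (auto simp: Pf_def fun_apply power_fun_apply coords_line_pt)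
  then show ?case using 2 by (simp add: fun_apply)
qed (simp add: fun_apply)

lemma isCont_line_pt: assumes "f \<in> Pol" shows "isCont (\<lambda>\<epsilon>. f (line_pt \<epsilon>)) x"
proof -
  have "pf.subspace {f. isCont (\<lambda>\<epsilon>. f (line_pt \<epsilon>)) x}"
    unfolding pf.subspace_def by (auto simp: fun_apply pscale_def intro!: continuous_intros)
  moreover have "isCont (\<lambda>\<epsilon>. monomial a b c d (line_pt \<epsilon>)) x" for a b c d
    by (auto simp: monomial_def line_pt_def intro!: continuous_intros)
  ultimately have "Pol \<subseteq> {f. isCont (\<lambda>\<epsilon>. f (line_pt \<epsilon>)) x}"
    unfolding Pol_eq by (intro pf.span_minimal) auto
  then show ?thesis using assms by blast
qed

text \<open>Away from \<open>\<epsilon> = 0\<close> the powers of \<open>Df\<close> cancel pointwise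
  on the line. By continuity the resulting identity persists at 0, where it would read
  \<open>1 = 0\<close>.\<close>

lemma Df_not_dvd_Qf:
  assumes "k > 0" "f \<in> Pol"
  shows "Df ^ n * Qf k j i \<noteq> Df ^ Suc n * f"
proof
  assume eq: "Df ^ n * Qf k j i = Df ^ Suc n * f"
  define F where "F \<epsilon> = Qf k j i (line_pt \<epsilon>) - \<epsilon> * f (line_pt \<epsilon>)" for \<epsilon>
  have F0: "F \<epsilon> = 0" if "\<epsilon> \<noteq> 0" for \<epsilon>
    using fun_cong[OF eq, of "line_pt \<epsilon>"] that
    by (simp add: F_def fun_apply power_fun_apply Df_line_pt)
  have "isCont F 0"
    unfolding F_def by (intro continuous_intros isCont_line_pt assms Pol_Qf)
  then have "(F \<longlongrightarrow> F 0) (at 0)" by (simp add: isCont_def)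
  moreover have "(F \<longlongrightarrow> 0) (at 0)"
    by (rule tendsto_eventually) (use F0 in \<open>auto simp: eventually_at_filter\<close>)
  ultimately have "F 0 = 0" using LIM_unique by blast
  then show False using Qf_line_pt_0[OF assms(1)] by (simp add: F_def)
qed

lemma subspace_Df_multiples: "pf.subspace {Df ^ n * f | f. f \<in> Pol}"
proof -
  have "{Df ^ n * f | f. f \<in> Pol} = {x. \<exists>f\<in>Pol. x = Df ^ n * f}" by blast
  moreover have "0 = Df ^ n * 0" "Df ^ n * f + Df ^ n * g = Df ^ n * (f + g)"
    "pscale c (Df ^ n * f) = Df ^ n * pscale c f" for f g c
    by (simp_all add: distrib_left pscale_mult_right)
  ultimately show ?thesis
    unfolding pf.subspace_def
    using pf.subspace_0[OF subspace_Pol] Pol_add Pol_scale by (auto; metis)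
qed

lemma Df_power_mult_multiple: "n \<le> n' \<Longrightarrow> f \<in> Pol \<Longrightarrow> Df ^ n' * f \<in> {Df ^ n * f | f. f \<in> Pol}"
proof -
  assume *: "n \<le> n'" "f \<in> Pol"
  then have "Df ^ n' * f = Df ^ n * (Df ^ (n' - n) * f)"
    by (simp add: mult.assoc[symmetric] power_add[symmetric])
  moreover have "Df ^ (n' - n) * f \<in> Pol"
    using * by (intro Pol_intros Pol_Df) auto
  ultimately show ?thesis by blast
qed

section \<open>Counting the generators by bidegree\<close>

definition gen_idx :: "nat \<Rightarrow> nat \<Rightarrow> nat \<Rightarrow> nat \<Rightarrow> (nat \<times> nat) set" where
  "gen_idx k m a b = {g \<in> idx k m. deg_x m g = a \<and> deg_y k m g = b}"

lemma idx_subset: "idx k m \<subseteq> {..m} \<times> {..m * k}"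
  by (auto simp: idx_def intro: order_trans mult_le_mono1)

lemma finite_idx: "finite (idx k m)"
  by (rule finite_subset[OF idx_subset]) simp

text \<open>For \<open>k > 2\<close> a smaller total degree means a smaller \<open>j\<close>, that
  is, a higher power of \<open>Df\<close>; for \<open>k = 2\<close> all generators have total degree
  \<open>2 * m\<close>.\<close>

lemma deg_sum: "g \<in> idx k m \<Longrightarrow> k \<ge> 2 \<Longrightarrow> deg_x m g + deg_y k m g = 2 * m + fst g * (k - 2)"
proof -
  assume g: "g \<in> idx k m" "k \<ge> 2"
  then obtain j i where ji: "g = (j, i)" "j \<le> m" "i \<le> j * k" unfolding idx_def by blast
  obtain r where "k = 2 + r" using g(2) le_Suc_ex by blast
  then show ?thesis using ji by (simp add: deg_x_def deg_y_def algebra_simps)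
qed

text \<open>The generators of bidegree \<open>(a, b)\<close> must be independent modulo the part
  from the maximal ideal. In a relation let \<open>j0\<close> be the largest first index with
  nonzero coefficient. Another generator of the same bidegree in the relation has a smaller index,
  and so do the generators of lower total degree. Everything but the term of \<open>j0\<close> is
  thus divisible by \<open>Df ^ Suc (m - j0)\<close>, which \<open>Df_not_dvd_Qf\<close>
  forbids.\<close>

lemma cat_coeff_eq:
  assumes k: "k \<ge> 2"
  shows "cat_coeff k m a b = card (gen_idx k m a b)"
proof -
  define h where "h = (\<lambda>(\<iota>, g). nmono \<iota> * Gf k m g)"
  define da where "da = (\<lambda>((a1, a2, b1 :: nat, b2 :: nat), g). a1 + a2 + deg_x m g :: nat)"
  define db where "db = (\<lambda>((a1 :: nat, a2 :: nat, b1, b2), g). b1 + b2 + deg_y k m g :: nat)"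
  define XU where "XU = {x \<in> nonconst \<times> idx k m. da x = a \<and> db x = b}"
  let ?J = "gen_idx k m a b"
  have hdeg: "h x \<in> bihom (da x) (db x)" if "snd x \<in> idx k m" for x
  proof -
    obtain a1 a2 b1 b2 g where x: "x = ((a1, a2, b1, b2), g)" by (metis surj_pair)
    show ?thesis
      using that unfolding x h_def da_def db_def nmono_def prod.case
      by (intro bihom_mult bihom_monomial Gf_bihom) simp
  qed
  have pow: "altIdeal_pow k m = pf.span (h ` (UNIV \<times> idx k m))"
  proof -
    have "{f * g |f g. f \<in> range nmono \<and> g \<in> Gf k m ` idx k m} = h ` (UNIV \<times> idx k m)"
      unfolding h_def by fastforce
    then show ?thesis
      using altIdeal_pow_eq[of k m] k by (simp add: powI_def ideal_gen_eq_span_nmono)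
  qed
  have max: "ideal_prod maxIdeal (altIdeal_pow k m) = pf.span (h ` (nonconst \<times> idx k m))"
  proof -
    have "{f * g |f g. f \<in> nmono ` nonconst \<and> g \<in> Gf k m ` idx k m} = h ` (nonconst \<times> idx k m)"
      unfolding h_def by fastforce
    then show ?thesis
      using altIdeal_pow_eq[of k m] k by (simp add: powI_def ideal_prod_max_eq)
  qed
  have U: "ideal_prod maxIdeal (altIdeal_pow k m) \<inter> bihom a b = pf.span (h ` XU)"
    unfolding max XU_def by (rule span_inter_bihom) (auto intro: hdeg)
  have "h ` {x \<in> UNIV \<times> idx k m. da x = a \<and> db x = b} = h ` XU \<union> Gf k m ` ?J"
  proof -
    have "{x \<in> UNIV \<times> idx k m. da x = a \<and> db x = b} = XU \<union> Pair (0, 0, 0, 0) ` ?J"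
      unfolding XU_def nonconst_def gen_idx_def by (auto simp: da_def db_def image_iff)
    then show ?thesis
      by (simp add: image_Un image_image h_def nmono_def monomial_0)
  qed
  then have V: "altIdeal_pow k m \<inter> bihom a b = pf.span (h ` XU \<union> Gf k m ` ?J)"
    unfolding pow using span_inter_bihom[of "UNIV \<times> idx k m" h da db a b] hdeg by auto
  have finXU: "finite XU"
  proof (rule finite_subset)
    show "XU \<subseteq> ({..a} \<times> {..a} \<times> {..b} \<times> {..b}) \<times> idx k m"
      unfolding XU_def by (auto simp: da_def db_def)
  qed (simp add: finite_idx)
  have ind: "\<forall>g\<in>?J. c g = 0" if c: "(\<Sum>g\<in>?J. pscale (c g) (Gf k m g)) \<in> pf.span (h ` XU)" for c
  proof (rule ccontr)
    assume nz: "\<not> (\<forall>g\<in>?J. c g = 0)"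
    define K where "K = {g \<in> ?J. c g \<noteq> 0}"
    have finJ: "finite ?J" unfolding gen_idx_def using finite_idx by simp
    have finK: "finite K" and "K \<noteq> {}"
      using finJ nz unfolding K_def by auto
    then have "Max (fst ` K) \<in> fst ` K" by (intro Max_in) auto
    then obtain g0 where g0: "g0 \<in> K" "fst g0 = Max (fst ` K)" by auto
    have le: "fst g \<le> fst g0" if "g \<in> K" for g
      unfolding g0(2) using finK that by (intro Max_ge) auto
    obtain j0 i0 where ji: "g0 = (j0, i0)" by force
    have g0i: "g0 \<in> idx k m" "deg_x m g0 = a" "deg_y k m g0 = b" "c g0 \<noteq> 0"
      using g0 by (auto simp: K_def gen_idx_def)
    have j0m: "j0 \<le> m" using g0i ji by (auto simp: idx_def)
    define E where "E = {Df ^ Suc (m - j0) * f | f. f \<in> Pol}"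
    have subE: "pf.subspace E" unfolding E_def by (rule subspace_Df_multiples)
    have GE: "Gf k m g \<in> E" if "fst g < j0" for g
    proof (cases g)
      case (Pair j i)
      have "Df ^ (m - j) * Qf k j i \<in> E"
        unfolding E_def by (rule Df_power_mult_multiple[OF _ Pol_Qf]) (use that j0m Pair in auto)
      then show ?thesis by (simp add: Gf_def Pair)
    qed
    have "h x \<in> E" if "x \<in> XU" for x
    proof -
      obtain a1 a2 b1 b2 g where x: "x = ((a1, a2, b1, b2), g)" by (metis surj_pair)
      have gi: "g \<in> idx k m" "a1 + a2 + b1 + b2 > 0"
        and "a1 + a2 + deg_x m g = a" "b1 + b2 + deg_y k m g = b"
        using that unfolding XU_def x nonconst_def da_def db_def by auto
      then have "deg_x m g + deg_y k m g < deg_x m g0 + deg_y k m g0"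
        using g0i(2,3) by linarith
      \<comment> \<open>For \<open>k = 2\<close> this reads \<open>0 < 0\<close>: then no proper
        multiple of a generator has bidegree \<open>(a, b)\<close>.\<close>
      then have "fst g * (k - 2) < j0 * (k - 2)"
        using deg_sum gi(1) g0i(1) k ji by simp
      then have "fst g < j0" by simp
      then have "Gf k m g \<in> E" by (rule GE)
      then obtain f where f: "f \<in> Pol" "Gf k m g = Df ^ Suc (m - j0) * f"
        unfolding E_def by blast
      have "h x = Df ^ Suc (m - j0) * (nmono (a1, a2, b1, b2) * f)"
        unfolding h_def x prod.case f(2) by (simp only: mult_ac)
      moreover have "nmono (a1, a2, b1, b2) * f \<in> Pol"
        using f(1) by (simp add: nmono_def Pol_mult Pol_monomial)
      ultimately show ?thesis unfolding E_def by blast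
    qed
    then have "pf.span (h ` XU) \<subseteq> E" by (intro pf.span_minimal subE) auto
    then have SE: "(\<Sum>g\<in>?J. pscale (c g) (Gf k m g)) \<in> E" using c by blast
    have "pscale (c g) (Gf k m g) \<in> E" if "g \<in> ?J - {g0}" for g
    proof (cases "c g = 0")
      case True
      then show ?thesis using pf.subspace_0[OF subE] by simp
    next
      case False
      then have gK: "g \<in> K" using that by (simp add: K_def)
      have "fst g \<noteq> fst g0"
      proof
        assume "fst g = fst g0"
        moreover have "deg_x m g = deg_x m g0"
          using that g0i by (simp add: gen_idx_def)
        ultimately have "g = g0" by (cases g; cases g0) (simp add: deg_x_def)
        then show False using that by simp
      qed
      then have "fst g < j0" using le[OF gK] ji by simp
      then show ?thesis using pf.subspace_scale[OF subE GE] by blast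
    qed
    then have RE: "(\<Sum>g\<in>?J - {g0}. pscale (c g) (Gf k m g)) \<in> E"
      by (rule pf.subspace_sum[OF subE])
    have "g0 \<in> ?J" using g0(1) by (simp add: K_def)
    then have "pscale (c g0) (Gf k m g0)
        = (\<Sum>g\<in>?J. pscale (c g) (Gf k m g)) - (\<Sum>g\<in>?J - {g0}. pscale (c g) (Gf k m g))"
      using finJ by (simp add: sum.remove[of _ g0])
    then have "pscale (c g0) (Gf k m g0) \<in> E"
      using pf.subspace_diff[OF subE SE RE] by simp
    from pf.subspace_scale[OF subE this, of "inverse (c g0)"] have "Gf k m g0 \<in> E"
      using g0i(4) by simp
    then obtain f where "f \<in> Pol" "Df ^ (m - j0) * Qf k j0 i0 = Df ^ Suc (m - j0) * f"
      unfolding E_def by (auto simp: Gf_def ji)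
    then show False using Df_not_dvd_Qf k by (metis less_le_trans pos2)
  qed
  have "pf.dim (pf.span (h ` XU \<union> Gf k m ` ?J)) = pf.dim (pf.span (h ` XU)) + card ?J"
    by (rule pf.dim_span_Un_image) (use finXU finite_idx ind in \<open>auto simp: gen_idx_def\<close>)
  then show ?thesis
    unfolding cat_coeff_def pdim_eq U V by simp
qed

lemma cat_coeff_finite:
  assumes "k \<ge> 2" shows "finite {(a, b). cat_coeff k m a b \<noteq> 0}"
proof (rule finite_subset)
  show "{(a, b). cat_coeff k m a b \<noteq> 0} \<subseteq> (\<lambda>g. (deg_x m g, deg_y k m g)) ` idx k m"
    using finite_idx by (auto simp: cat_coeff_eq[OF assms] gen_idx_def)
qed (simp add: finite_idx)

lemma sum_cat_coeff:
  assumes k: "k \<ge> 2"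
  shows "(\<Sum>b \<in> {b. cat_coeff k m a b \<noteq> 0}. cat_coeff k m a b) = card {g \<in> idx k m. deg_x m g = a}"
proof -
  let ?B = "{b. cat_coeff k m a b \<noteq> 0}"
  have fin: "finite (gen_idx k m a b)" for b
    unfolding gen_idx_def using finite_idx by simp
  have "finite ?B"
    by (rule finite_subset[OF _ finite_imageI[OF cat_coeff_finite[OF k], of snd m]]) force
  have "(\<Sum>b\<in>?B. cat_coeff k m a b) = (\<Sum>b\<in>?B. card (gen_idx k m a b))"
    by (simp add: cat_coeff_eq[OF k])
  also have "\<dots> = card (\<Union>b\<in>?B. gen_idx k m a b)"
    by (rule card_UN_disjoint[symmetric]) (use \<open>finite ?B\<close> fin in \<open>auto simp: gen_idx_def\<close>)
  also have "(\<Union>b\<in>?B. gen_idx k m a b) = {g \<in> idx k m. deg_x m g = a}"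
  proof -
    have "g \<in> gen_idx k m a b \<Longrightarrow> cat_coeff k m a b \<noteq> 0" for g b
      using fin[of b] by (auto simp: cat_coeff_eq[OF k])
    then show ?thesis by (fastforce simp: gen_idx_def)
  qed
  finally show ?thesis .
qed

subsection \<open>Sweeping strips of the dominant chamber\<close>

text \<open>As \<open>s\<close> grows, the number of positions below it is a step function. At a
  position \<open>p\<close> it jumps from the count with \<open><\<close> to the count with
  \<open>\<le>\<close>, and the values missed are those strictly inside a jump.\<close>

lemma card_below_attained_iff:
  fixes pos :: "'a \<Rightarrow> real"
  assumes fin: "finite L"
  shows "(\<exists>s>0. s \<notin> pos ` L \<and> card {l \<in> L. pos l < s} = h) \<longleftrightarrow>
    card {l \<in> L. pos l \<le> 0} \<le> h \<and> h \<le> card L \<and>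
    \<not> (\<exists>p>0. card {l \<in> L. pos l < p} < h \<and> h < card {l \<in> L. pos l \<le> p})"
proof
  assume "\<exists>s>0. s \<notin> pos ` L \<and> card {l \<in> L. pos l < s} = h"
  then obtain s where s: "s > 0" "s \<notin> pos ` L" and h: "card {l \<in> L. pos l < s} = h" by blast
  have "card {l \<in> L. pos l \<le> 0} \<le> h" "h \<le> card L"
    unfolding h[symmetric] using fin s by (auto intro!: card_mono)
  moreover have "h \<le> card {l \<in> L. pos l < p}" if "s \<le> p" for p
    unfolding h[symmetric] using fin that by (auto intro!: card_mono)
  moreover have "card {l \<in> L. pos l \<le> p} \<le> h" if "p < s" for p
    unfolding h[symmetric] using fin that by (auto intro!: card_mono)
  ultimately show "card {l \<in> L. pos l \<le> 0} \<le> h \<and> h \<le> card L \<and>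
    \<not> (\<exists>p>0. card {l \<in> L. pos l < p} < h \<and> h < card {l \<in> L. pos l \<le> p})"
    by (meson leD le_less_linear)
next
  assume A: "card {l \<in> L. pos l \<le> 0} \<le> h \<and> h \<le> card L \<and>
    \<not> (\<exists>p>0. card {l \<in> L. pos l < p} < h \<and> h < card {l \<in> L. pos l \<le> p})"
  \<comment> \<open>The maximum \<open>q\<close> of this set is the last position, or 0, up to which
    at most \<open>h\<close> positions lie; just after it the count is exactly
    \<open>h\<close>.\<close>
  define A where "A = {q \<in> insert 0 (pos ` L). 0 \<le> q \<and> card {l \<in> L. pos l \<le> q} \<le> h}"
  have finA: "finite A" and "0 \<in> A" using fin A by (auto simp: A_def)
  define q where "q = Max A"
  have q: "q \<in> A" "\<And>r. r \<in> A \<Longrightarrow> r \<le> q"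
    using finA \<open>0 \<in> A\<close> unfolding q_def by (auto intro: Max_in)
  then have q0: "0 \<le> q" "card {l \<in> L. pos l \<le> q} \<le> h" by (auto simp: A_def)
  define M where "M = {r \<in> pos ` L. q < r}"
  have finM: "finite M" using fin by (auto simp: M_def)
  show "\<exists>s>0. s \<notin> pos ` L \<and> card {l \<in> L. pos l < s} = h"
  proof (cases "M = {}")
    case True
    then have "{l \<in> L. pos l \<le> q} = L" unfolding M_def by (auto simp: not_less[symmetric])
    then have "card L = h" using q0(2) A by simp
    moreover have "{l \<in> L. pos l < q + 1} = L" "q + 1 \<notin> pos ` L"
      using True unfolding M_def by force+
    ultimately show ?thesis using q0(1) by (intro exI[of _ "q + 1"]) auto
  next
    case False
    define r where "r = Min M"
    have r: "r \<in> M" "\<And>x. x \<in> M \<Longrightarrow> r \<le> x"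
      using finM False unfolding r_def by (auto intro: Min_in)
    then have qr: "q < r" and rL: "r \<in> pos ` L" by (auto simp: M_def)
    have between: "x \<le> q" if "x \<in> pos ` L" "x < r" for x
      using r(2)[of x] that unfolding M_def by (auto simp: not_less[symmetric])
    have "r \<notin> A" using q(2)[of r] qr by auto
    then have "card {l \<in> L. pos l \<le> r} > h"
      using qr q0(1) rL unfolding A_def by auto
    then have "\<not> card {l \<in> L. pos l < r} < h" using A qr q0(1) by auto
    moreover have "{l \<in> L. pos l < r} = {l \<in> L. pos l \<le> q}"
      using between qr by force
    ultimately have ch: "card {l \<in> L. pos l \<le> q} = h" using q0(2) by simp
    define s where "s = (q + r) / 2"
    have s: "q < s" "s < r" using qr by (auto simp: s_def)
    have "{l \<in> L. pos l < s} = {l \<in> L. pos l \<le> q}"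
    proof (intro Collect_cong conj_cong refl)
      fix l assume "l \<in> L"
      then show "(pos l < s) = (pos l \<le> q)" using between[of "pos l"] s by auto
    qed
    moreover have "s \<notin> pos ` L" using between[of s] s by auto
    ultimately show ?thesis using s q0(1) ch by (intro exI[of _ s]) auto
  qed
qed

lemma card_leq_inj_on:
  fixes pos :: "'a \<Rightarrow> real"
  assumes "finite L" "inj_on pos L"
  shows "card {l \<in> L. pos l \<le> p} \<le> Suc (card {l \<in> L. pos l < p})"
proof (cases "p \<in> pos ` L")
  case True
  then obtain l0 where l0: "l0 \<in> L" "pos l0 = p" by auto
  then have "{l \<in> L. pos l \<le> p} = insert l0 {l \<in> L. pos l < p}"
    using assms(2) by (force simp: inj_on_def less_le)
  then show ?thesis using assms(1) by (simp add: card_insert_if)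
next
  case False
  then have "{l \<in> L. pos l \<le> p} = {l \<in> L. pos l < p}" by force
  then show ?thesis by simp
qed

text \<open>The coefficients of the positive roots with respect to the simple roots; the first simple
  root is the short one for \<open>k = 4\<close> and \<open>k = 6\<close>.\<close>

definition coefs :: "nat \<Rightarrow> (nat \<times> nat) set" where
  "coefs k = {(1, 0), (0, 1)} \<union> (if k \<ge> 3 then {(1, 1)} else {}) \<union> (if k \<ge> 4 then {(2, 1)} else {})
     \<union> (if k = 6 then {(3, 1), (3, 2)} else {})"

text \<open>The root \<open>(0, 1)\<close> is left out because its lines bound the strips; the lines
  of every other root meet each level \<open>t\<close> in exactly one point.\<close>

definition pcoefs :: "nat \<Rightarrow> (nat \<times> nat) set" where
  "pcoefs k = coefs k - {(0, 1)}"

definition lin :: "nat \<times> nat \<Rightarrow> real \<times> real \<Rightarrow> real" where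
  "lin e p = real (fst e) * fst p + real (snd e) * snd p"

text \<open>For a generic point these are the hyperplanes separating it from the fundamental alcove.
  The set will serve as the name of a region, and its cardinality is the height.\<close>

definition below :: "nat \<Rightarrow> nat \<Rightarrow> real \<times> real \<Rightarrow> ((nat \<times> nat) \<times> nat) set" where
  "below k m p = {(e, j). e \<in> coefs k \<and> j \<in> {1..m} \<and> real j < lin e p}"

definition generic :: "nat \<Rightarrow> nat \<Rightarrow> real \<times> real \<Rightarrow> bool" where
  "generic k m p \<longleftrightarrow> fst p > 0 \<and> snd p > 0 \<and> (\<forall>e\<in>coefs k. \<forall>j\<in>{1..m}. lin e p \<noteq> real j)"

lemma finite_coefs: "finite (coefs k)"
  by (simp add: coefs_def)

lemma finite_pcoefs: "finite (pcoefs k)"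
  by (simp add: pcoefs_def finite_coefs)

lemma finite_below: "finite (below k m p)"
  by (rule finite_subset[of _ "coefs k \<times> {1..m}"]) (auto simp: below_def finite_coefs)

lemma pcoefs_pos: "e \<in> pcoefs k \<Longrightarrow> fst e > 0"
  by (auto simp: pcoefs_def coefs_def split: if_splits)

lemma coefs_eq: "coefs k = insert (0, 1) (pcoefs k)"
  by (auto simp: pcoefs_def coefs_def)

definition level_heights :: "nat \<Rightarrow> nat \<Rightarrow> real \<Rightarrow> nat set" where
  "level_heights k m t = {card (below k m (s, t)) | s. generic k m (s, t)}"

definition cnt_less :: "nat \<Rightarrow> nat \<Rightarrow> real \<Rightarrow> real \<Rightarrow> nat" where
  "cnt_less k m t s = (\<Sum>e\<in>pcoefs k. card {j \<in> {1..m}. real j < lin e (s, t)})"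

definition cnt_leq :: "nat \<Rightarrow> nat \<Rightarrow> real \<Rightarrow> real \<Rightarrow> nat" where
  "cnt_leq k m t s = (\<Sum>e\<in>pcoefs k. card {j \<in> {1..m}. real j \<le> lin e (s, t)})"

text \<open>The \<open>s\<close>-coordinate at which the line of a root meets the level
  \<open>t\<close>.\<close>

definition cross :: "real \<Rightarrow> (nat \<times> nat) \<times> nat \<Rightarrow> real" where
  "cross t = (\<lambda>(e, j). (real j - real (snd e) * t) / real (fst e))"

lemma cross_iff:
  assumes "e \<in> pcoefs k"
  shows "cross t (e, j) < s \<longleftrightarrow> real j < lin e (s, t)"
    and "cross t (e, j) \<le> s \<longleftrightarrow> real j \<le> lin e (s, t)"
    and "cross t (e, j) = s \<longleftrightarrow> lin e (s, t) = real j"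
  using pcoefs_pos[OF assms] by (auto simp: cross_def lin_def field_simps)

lemma card_pcoefs_lines:
  fixes m :: nat
  shows "card {l \<in> pcoefs k \<times> {1..m}. P l} = (\<Sum>e\<in>pcoefs k. card {j \<in> {1..m}. P (e, j)})"
proof -
  have "{l \<in> pcoefs k \<times> {1..m}. P l} = (SIGMA e:pcoefs k. {j \<in> {1..m}. P (e, j)})" by auto
  moreover have "card (SIGMA e:pcoefs k. {j \<in> {1..m}. P (e, j)}) = (\<Sum>e\<in>pcoefs k. card {j \<in> {1..m}. P (e, j)})"
    by (rule card_SigmaI) (auto simp: finite_pcoefs intro: finite_subset[OF _ finite_atLeastAtMost[of 1 m]])
  ultimately show ?thesis by simp
qed

lemma cnt_eq:
  "cnt_less k m t s = card {l \<in> pcoefs k \<times> {1..m}. cross t l < s}"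
  "cnt_leq k m t s = card {l \<in> pcoefs k \<times> {1..m}. cross t l \<le> s}"
  unfolding card_pcoefs_lines cnt_less_def cnt_leq_def
  by (auto intro!: sum.cong simp: cross_iff)

lemma card_less_real:
  assumes "real n < y" "y \<le> real n + 1" shows "card {j \<in> {1..m}. real j < y} = min m n"
proof -
  have "real j < y \<longleftrightarrow> j \<le> n" for j using assms by linarith
  then have "{j \<in> {1..m}. real j < y} = {j \<in> {1..m}. j \<le> n}" by (simp only:)
  also have "\<dots> = {1..min m n}" by auto
  finally show ?thesis by simp
qed

lemma card_leq_real:
  assumes "real n \<le> y" "y < real n + 1" shows "card {j \<in> {1..m}. real j \<le> y} = min m n"
proof -
  have "real j \<le> y \<longleftrightarrow> j \<le> n" for j using assms by linarith
  then have "{j \<in> {1..m}. real j \<le> y} = {j \<in> {1..m}. j \<le> n}" by (simp only:)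
  also have "\<dots> = {1..min m n}" by auto
  finally show ?thesis by simp
qed

lemma card_below:
  assumes "real b < t" "t < real b + 1" "b \<le> m"
  shows "card (below k m (s, t)) = b + cnt_less k m t s"
proof -
  have "card (below k m (s, t)) = (\<Sum>e\<in>coefs k. card {j \<in> {1..m}. real j < lin e (s, t)})"
  proof -
    have "below k m (s, t) = (SIGMA e:coefs k. {j \<in> {1..m}. real j < lin e (s, t)})"
      by (auto simp: below_def)
    then show ?thesis by (simp add: finite_coefs)
  qed
  also have "\<dots> = card {j \<in> {1..m}. real j < lin (0, 1) (s, t)} + cnt_less k m t s"
    unfolding cnt_less_def coefs_eq
    by (subst sum.insert) (auto simp: pcoefs_def finite_coefs)
  also have "card {j \<in> {1..m}. real j < lin (0, 1) (s, t)} = b"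
    using card_less_real[of b t m] assms by (simp add: lin_def)
  finally show ?thesis .
qed

text \<open>Inside strip \<open>b\<close> exactly \<open>b\<close> lines of the root
  \<open>(0, 1)\<close> lie below. The other lines are counted by the step function with jumps at
  the points \<open>cross t\<close>.\<close>

lemma level_heights_iff:
  assumes t: "real b < t" "t < real b + 1" and b: "b \<le> m"
  shows "h \<in> level_heights k m t \<longleftrightarrow> b + cnt_leq k m t 0 \<le> h \<and> h \<le> b + card (pcoefs k) * m \<and>
    \<not> (\<exists>s>0. b + cnt_less k m t s < h \<and> h < b + cnt_leq k m t s)"
proof -
  let ?L = "pcoefs k \<times> {1..m}"
  have "t \<noteq> real j" for j
  proof -
    have "j \<le> b \<or> b + 1 \<le> j" by linarith
    then have "real j \<le> real b \<or> real b + 1 \<le> real j" by linarith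
    then show ?thesis using t by auto
  qed
  then have gen: "generic k m (s, t) \<longleftrightarrow> s > 0 \<and> s \<notin> cross t ` ?L" for s
  proof -
    have "s \<in> cross t ` ?L \<longleftrightarrow> (\<exists>e\<in>pcoefs k. \<exists>j\<in>{1..m}. cross t (e, j) = s)"
      unfolding image_def by blast
    also have "\<dots> \<longleftrightarrow> (\<exists>e\<in>pcoefs k. \<exists>j\<in>{1..m}. lin e (s, t) = real j)"
      by (simp add: cross_iff)
    finally show ?thesis
      using t \<open>\<And>j. t \<noteq> real j\<close> unfolding generic_def coefs_eq by (auto simp: lin_def)
  qed
  have "h \<in> level_heights k m t \<longleftrightarrow> b \<le> h \<and> (\<exists>s>0. s \<notin> cross t ` ?L \<and> cnt_less k m t s = h - b)"
    unfolding level_heights_def mem_Collect_eq card_below[OF t b] gen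
    by (auto) (metis le_add_diff_inverse)
  also have "\<dots> \<longleftrightarrow> b \<le> h \<and> (cnt_leq k m t 0 \<le> h - b \<and> h - b \<le> card ?L \<and>
     \<not> (\<exists>s>0. cnt_less k m t s < h - b \<and> h - b < cnt_leq k m t s))"
    unfolding cnt_eq by (subst card_below_attained_iff) (auto simp: pcoefs_def finite_coefs)
  finally have eq: "h \<in> level_heights k m t \<longleftrightarrow> \<dots>" .
  show ?thesis
  proof (cases "b \<le> h")
    case True
    then obtain h' where "h = b + h'" using le_Suc_ex by blast
    then show ?thesis using eq by (simp add: card_cartesian_product)
  next
    case False
    then show ?thesis using eq by simp
  qed
qed

text \<open>Eliminating \<open>s\<close> from \<open>c * s + d * t = i\<close> and
  \<open>c' * s + d' * t = j\<close> leaves this determinant times \<open>t\<close> equal to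
  \<open>c' * i - c * j\<close>. Lines therefore meet only at levels where its product with
  \<open>t\<close> is an integer.\<close>

definition coef_det :: "nat \<times> nat \<Rightarrow> nat \<times> nat \<Rightarrow> int" where
  "coef_det e e' = int (fst e') * int (snd e) - int (fst e) * int (snd e')"

text \<open>Bound 1 means crossings at integral levels only, hence none inside a strip; bound 2 also
  admits half-integral levels.\<close>

definition crossing_bound :: "nat \<Rightarrow> int" where
  "crossing_bound k = (if k = 6 then 2 else 1)"

text \<open>The second alternative is meant for \<open>(3, 1)\<close> and \<open>(3, 2)\<close>,
  whose determinant has absolute value 3; the common coefficient 3 of \<open>s\<close> can be
  cancelled first.\<close>

lemma coef_det_bound:
  assumes "k \<in> {2, 3, 4, 6}" "e \<in> pcoefs k" "e' \<in> pcoefs k"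
  shows "\<bar>coef_det e e'\<bar> \<le> crossing_bound k \<or> fst e = fst e' \<and> \<bar>int (snd e) - int (snd e')\<bar> \<le> crossing_bound k"
  using assms by (auto simp: pcoefs_def coefs_def coef_det_def crossing_bound_def split: if_splits)

lemma coef_det_zero:
  assumes "k \<in> {2, 3, 4, 6}" "e \<in> pcoefs k" "e' \<in> pcoefs k" "coef_det e e' = 0"
  shows "e = e'"
  using assms by (auto simp: pcoefs_def coefs_def coef_det_def split: if_splits)

lemma inj_on_cross:
  assumes k: "k \<in> {2, 3, 4, 6}"
    and t: "\<And>d n. d \<noteq> 0 \<Longrightarrow> \<bar>d\<bar> \<le> crossing_bound k \<Longrightarrow> real_of_int d * t \<noteq> real_of_int n"
  shows "inj_on (cross t) (pcoefs k \<times> {1..m})"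
proof (rule inj_onI, safe)
  fix c d i c' d' j
  assume e: "(c, d) \<in> pcoefs k" "(c', d') \<in> pcoefs k" and eq: "cross t ((c, d), i) = cross t ((c', d'), j)"
  have pos: "c > 0" "c' > 0" using pcoefs_pos e by fastforce+
  have "real c' * (real i - real d * t) = real c * (real j - real d' * t)"
    using eq pos by (simp add: cross_def field_simps)
  then have *: "real_of_int (coef_det (c, d) (c', d')) * t = real_of_int (int c' * int i - int c * int j)"
    by (simp add: coef_det_def algebra_simps)
  have ee: "(c, d) = (c', d')"
  proof (rule ccontr)
    assume "(c, d) \<noteq> (c', d')"
    then have d0: "coef_det (c, d) (c', d') \<noteq> 0" using coef_det_zero[OF k e] by blast
    then have "\<not> \<bar>coef_det (c, d) (c', d')\<bar> \<le> crossing_bound k" using t[OF d0] * by metis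
    then have cc: "c = c'" "\<bar>int d - int d'\<bar> \<le> crossing_bound k" using coef_det_bound[OF k e] by auto
    then have "int d - int d' \<noteq> 0" using d0 by (auto simp: coef_det_def)
    moreover have "real c * (real_of_int (int d - int d') * t) = real c * real_of_int (int i - int j)"
      using * cc(1) by (simp add: coef_det_def algebra_simps)
    then have "real_of_int (int d - int d') * t = real_of_int (int i - int j)"
      using pos by (subst (asm) mult_cancel_left) simp
    ultimately show False using t cc(2) by blast
  qed
  then have "real c * real i = real c * real j" using * by (simp add: coef_det_def)
  then show "c = c'" "d = d'" "i = j" using ee pos by auto
qed

text \<open>Within \<open>T\<close> no crossing level is passed. The weak inequality on one side
  makes every single level uncrossed, even one at which lines meet.\<close>

definition uncrossed :: "nat \<Rightarrow> real set \<Rightarrow> bool" where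
  "uncrossed k T \<longleftrightarrow> (\<forall>t\<in>T. \<forall>t'\<in>T. \<forall>d n. \<bar>d\<bar> \<le> crossing_bound k \<longrightarrow>
     \<not> (real_of_int d * t > real_of_int n \<and> real_of_int n \<ge> real_of_int d * t'))"

text \<open>If each of two points had a line below it that is not below the other, eliminating
  \<open>s\<close> from the four inequalities would show that the crossing of these two lines is
  passed between the two levels. Consequently there is at most one set of each size.\<close>

lemma below_chain:
  assumes k: "k \<in> {2, 3, 4, 6}" and T: "uncrossed k T" and p: "snd p \<in> T" "snd p' \<in> T"
  shows "below k m p \<subseteq> below k m p' \<or> below k m p' \<subseteq> below k m p"
proof (rule ccontr)
  assume "\<not> ?thesis"
  then obtain x x' where x: "x \<in> below k m p" "x \<notin> below k m p'"
    and x': "x' \<in> below k m p'" "x' \<notin> below k m p" by blast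
  obtain e i e' j where "x = (e, i)" "x' = (e', j)" by (metis surj_pair)
  then have e: "(e, i) \<in> below k m p" "(e, i) \<notin> below k m p'"
    and e': "(e', j) \<in> below k m p'" "(e', j) \<notin> below k m p" using x x' by simp_all
  obtain c d where cd: "e = (c, d)" by force
  obtain c' d' where cd': "e' = (c', d')" by force
  obtain s t where st: "p = (s, t)" by force
  obtain s' t' where st': "p' = (s', t')" by force
  have 1: "e \<in> coefs k" "real i < c * s + d * t" "real i \<ge> c * s' + d * t'"
    and 2: "e' \<in> coefs k" "real j < c' * s' + d' * t'" "real j \<ge> c' * s + d' * t"
    using e e' by (auto simp: below_def lin_def cd cd' st st')
  have T': "\<not> (real_of_int x * t > real_of_int n \<and> real_of_int n \<ge> real_of_int x * t')"
    "\<not> (real_of_int x * t' > real_of_int n \<and> real_of_int n \<ge> real_of_int x * t)"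
    if "\<bar>x\<bar> \<le> crossing_bound k" for x n
    using T p that unfolding uncrossed_def st st' by auto
  have one: "\<bar>1\<bar> \<le> crossing_bound k" by (simp add: crossing_bound_def)
  have "e \<in> pcoefs k"
    using 1 T'(1)[OF one, of "int i"] cd unfolding coefs_eq by auto
  moreover have "e' \<in> pcoefs k"
    using 2 T'(2)[OF one, of "int j"] cd' unfolding coefs_eq by auto
  ultimately have pos: "c > 0" "c' > 0" and dete: "e \<in> pcoefs k" "e' \<in> pcoefs k"
    using pcoefs_pos cd cd' by fastforce+
  have m1: "c' * real i < c' * (c * s + d * t)" "c * real j < c * (c' * s' + d' * t')"
    using 1 2 pos by auto
  have m2: "c' * real i \<ge> c' * (c * s' + d * t')" "c * real j \<ge> c * (c' * s + d' * t)"
    using 1 2 by (auto intro: mult_left_mono)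
  from coef_det_bound[OF k dete] show False
  proof
    assume "\<bar>coef_det e e'\<bar> \<le> crossing_bound k"
    moreover have "real_of_int (coef_det e e') * t > real_of_int (int c' * int i - int c * int j)"
      "real_of_int (int c' * int i - int c * int j) \<ge> real_of_int (coef_det e e') * t'"
      using m1 m2 by (simp_all add: coef_det_def cd cd' algebra_simps)
    ultimately show False using T'(1) by blast
  next
    assume D: "fst e = fst e' \<and> \<bar>int (snd e) - int (snd e')\<bar> \<le> crossing_bound k"
    then have "c = c'" by (simp add: cd cd')
    then have "real_of_int (int (snd e) - int (snd e')) * t > real_of_int (int i - int j)"
      "real_of_int (int i - int j) \<ge> real_of_int (int (snd e) - int (snd e')) * t'"
      using 1 2 by (simp_all add: cd cd' algebra_simps)
    then show False using T'(1) D by blast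
  qed
qed

definition strip_sets :: "nat \<Rightarrow> nat \<Rightarrow> real set \<Rightarrow> nat \<Rightarrow> ((nat \<times> nat) \<times> nat) set set" where
  "strip_sets k m T h = {below k m p | p. generic k m p \<and> snd p \<in> T \<and> card (below k m p) = h}"

lemma strip_sets_nonempty: "strip_sets k m T h \<noteq> {} \<longleftrightarrow> (\<exists>t\<in>T. h \<in> level_heights k m t)"
  unfolding strip_sets_def level_heights_def by force

lemma card_strip_sets:
  assumes "k \<in> {2, 3, 4, 6}" "uncrossed k T"
  shows "card (strip_sets k m T h) = of_bool (\<exists>t\<in>T. h \<in> level_heights k m t)"
    and "finite (strip_sets k m T h)"
proof -
  have eq: "B = B'" if B: "B \<in> strip_sets k m T h" "B' \<in> strip_sets k m T h" for B B'
  proof -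
    obtain p p' where p: "B = below k m p" "snd p \<in> T" "card B = h"
      and p': "B' = below k m p'" "snd p' \<in> T" "card B' = h"
      using B unfolding strip_sets_def by blast
    have "finite B" "finite B'" "card B = card B'" "B \<subseteq> B' \<or> B' \<subseteq> B"
      using below_chain[OF assms p(2) p'(2), of m] p p' by (simp_all add: finite_below)
    then show ?thesis by (metis card_subset_eq)
  qed
  then have "strip_sets k m T h = {} \<or> (\<exists>B. strip_sets k m T h = {B})" by blast
  then show "card (strip_sets k m T h) = of_bool (\<exists>t\<in>T. h \<in> level_heights k m t)"
    "finite (strip_sets k m T h)"
    unfolding strip_sets_nonempty[symmetric] by auto
qed

subsection \<open>Heights in a strip\<close>

lemma pcoefs_eqs:
  "pcoefs 2 = {(1, 0)}" "pcoefs 3 = {(1, 0), (1, 1)}" "pcoefs 4 = {(1, 0), (1, 1), (2, 1)}"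
  "pcoefs 6 = {(1, 0), (1, 1), (2, 1), (3, 1), (3, 2)}"
  by (auto simp: pcoefs_def coefs_def)

lemma card_pcoefs: "k \<in> {2, 3, 4, 6} \<Longrightarrow> card (pcoefs k) = k - 1"
  by (auto simp: pcoefs_eqs)

text \<open>At the wall \<open>s = 0\<close> the second simple root and the \<open>k - 2\<close>
  non-simple roots all have the value \<open>t\<close>.\<close>

lemma cnt_leq_0:
  assumes "k \<in> {2, 3, 4}" "real b < t" "t < real b + 1" "b \<le> m"
  shows "b + cnt_leq k m t 0 = (k - 1) * b"
proof -
  have "card {j \<in> {1..m}. real j \<le> t} = b"
    using card_leq_real[of b t m] assms by simp
  moreover have "card {j \<in> {1..m}. real j \<le> 0} = 0"
    using card_leq_real[of 0 0 m] by simp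
  ultimately show ?thesis
    using assms(1) by (auto simp: cnt_leq_def pcoefs_eqs lin_def)
qed

text \<open>At the wall four roots have the value \<open>t\<close>, but \<open>3s + 2t\<close> has
  the value \<open>2t\<close>. Its integer part \<open>n\<close> differs in the two halves of the
  strip.\<close>

lemma cnt_leq_6_0:
  assumes "real b < t" "t < real b + 1" "b \<le> m" "real n \<le> 2 * t" "2 * t < real n + 1"
  shows "b + cnt_leq 6 m t 0 = 4 * b + min m n"
proof -
  have "card {j \<in> {1..m}. real j \<le> t} = b"
    using card_leq_real[of b t m] assms by simp
  moreover have "card {j \<in> {1..m}. real j \<le> 0} = 0"
    using card_leq_real[of 0 0 m] by simp
  moreover have "card {j \<in> {1..m}. real j \<le> 2 * t} = min m n"
    using card_leq_real[of n "2 * t" m] assms by simp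
  ultimately show ?thesis
    by (auto simp: cnt_leq_def pcoefs_eqs lin_def)
qed

text \<open>When the crossing points are distinct, all jumps have size one and no height is
  missed.\<close>

lemma level_heights_inj:
  assumes "inj_on (cross t) (pcoefs k \<times> {1..m})" "real b < t" "t < real b + 1" "b \<le> m"
  shows "h \<in> level_heights k m t \<longleftrightarrow> b + cnt_leq k m t 0 \<le> h \<and> h \<le> b + card (pcoefs k) * m"
proof -
  have le: "cnt_leq k m t s \<le> Suc (cnt_less k m t s)" for s
    unfolding cnt_eq using card_leq_inj_on[OF _ assms(1)] by (simp add: finite_pcoefs)
  have "\<not> (b + cnt_less k m t s < h \<and> h < b + cnt_leq k m t s)" for s
    using le[of s] by linarith
  then show ?thesis
    unfolding level_heights_iff[OF assms(2-)] by blast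
qed

text \<open>Sample levels, one in each half of a strip: no multiple of them by a nonzero
  \<open>d\<close> with \<open>\<bar>d\<bar> \<le> 2\<close> is an integer.\<close>

lemma inj_on_cross_quarter:
  assumes "k \<in> {2, 3, 4, 6}" "t = real b + 1 / 4 \<or> t = real b + 3 / 4"
  shows "inj_on (cross t) (pcoefs k \<times> {1..m})"
proof (rule inj_on_cross[OF assms(1)])
  fix d n :: int
  assume d: "d \<noteq> 0" "\<bar>d\<bar> \<le> crossing_bound k"
  show "real_of_int d * t \<noteq> real_of_int n"
  proof
    assume eq: "real_of_int d * t = real_of_int n"
    obtain r :: int where r: "r = 1 \<or> r = 3" "t = real b + real_of_int r / 4"
      using assms(2) by (metis of_int_1 of_int_numeral)
    have "real_of_int (d * (4 * int b + r)) = real_of_int (4 * n)"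
      using eq r(2) by (simp add: algebra_simps)
    then have "d * (4 * int b + r) = 4 * n" by linarith
    then have "4 dvd d * (4 * int b + r)" by simp
    moreover have "d \<in> {-2, -1, 1, 2}"
      using d by (auto simp: crossing_bound_def split: if_splits)
    ultimately show False using r(1) by (elim insertE emptyE disjE; hypsubst; presburger)
  qed
qed

text \<open>An integer passed by \<open>d * t\<close> for a smaller \<open>d\<close> would, after
  multiplication, give an integer strictly between \<open>N\<close> and
  \<open>N + 1\<close>.\<close>

lemma uncrossed_interval:
  assumes T: "\<And>t. t \<in> T \<Longrightarrow> real_of_int N < of_int (crossing_bound k) * t \<and> of_int (crossing_bound k) * t < real_of_int N + 1"
  shows "uncrossed k T"
  unfolding uncrossed_def
proof (intro ballI allI impI notI)
  fix t t' d n
  assume t: "t \<in> T" "t' \<in> T" and d: "\<bar>d\<bar> \<le> crossing_bound k"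
    and c: "real_of_int d * t > real_of_int n \<and> real_of_int n \<ge> real_of_int d * t'"
  have nb: "\<not> (real_of_int N < real_of_int x \<and> real_of_int x < real_of_int (N + 1))" for x
    unfolding of_int_less_iff by linarith
  show False
  proof (cases "crossing_bound k = 1")
    case True
    have "d = 0 \<or> d = 1 \<or> d = -1" using d True by auto
    moreover have "real_of_int N < t" "t < real_of_int (N + 1)" "real_of_int N < t'" "t' < real_of_int (N + 1)"
      using T[OF t(1)] T[OF t(2)] True by auto
    ultimately show False using c nb[of n] nb[of "- n"] by (elim disjE; simp)
  next
    case False
    then have 2: "crossing_bound k = 2" by (simp add: crossing_bound_def split: if_splits)
    have "d = 0 \<or> d = 1 \<or> d = -1 \<or> d = 2 \<or> d = -2" using d 2 by auto
    moreover have "real_of_int N < 2 * t" "2 * t < real_of_int (N + 1)" "real_of_int N < 2 * t'" "2 * t' < real_of_int (N + 1)"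
      using T[OF t(1)] T[OF t(2)] 2 by auto
    ultimately show False using c nb[of n] nb[of "- n"] nb[of "2 * n"] nb[of "- 2 * n"]
      by (elim disjE; simp)
  qed
qed

lemma card_strip_small:
  assumes k: "k \<in> {2, 3, 4}" and b: "b \<le> m"
  shows "card (strip_sets k m {real b<..<real b + 1} h) = of_bool ((k - 1) * b \<le> h \<and> h \<le> b + (k - 1) * m)"
    and "finite (strip_sets k m {real b<..<real b + 1} h)"
proof -
  have k': "k \<in> {2, 3, 4, 6}" using k by auto
  have U: "uncrossed k {real b<..<real b + 1}"
    by (rule uncrossed_interval[of _ "int b"]) (use k in \<open>auto simp: crossing_bound_def\<close>)
  show "finite (strip_sets k m {real b<..<real b + 1} h)" by (rule card_strip_sets[OF k' U])
  have "(\<exists>t\<in>{real b<..<real b + 1}. h \<in> level_heights k m t) \<longleftrightarrow> (k - 1) * b \<le> h \<and> h \<le> b + (k - 1) * m"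
  proof
    assume "\<exists>t\<in>{real b<..<real b + 1}. h \<in> level_heights k m t"
    then obtain t where "real b < t" "t < real b + 1" "h \<in> level_heights k m t" by auto
    then show "(k - 1) * b \<le> h \<and> h \<le> b + (k - 1) * m"
      using cnt_leq_0[OF k] b by (auto simp: level_heights_iff card_pcoefs[OF k'])
  next
    assume h: "(k - 1) * b \<le> h \<and> h \<le> b + (k - 1) * m"
    let ?t = "real b + 1 / 4"
    have t: "real b < ?t" "?t < real b + 1" by auto
    have "h \<in> level_heights k m ?t"
      unfolding level_heights_inj[OF inj_on_cross_quarter[OF k'] t b, OF disjI1[OF refl]]
        cnt_leq_0[OF k t b] card_pcoefs[OF k'] using h .
    then show "\<exists>t\<in>{real b<..<real b + 1}. h \<in> level_heights k m t" using t by auto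
  qed
  then show "card (strip_sets k m {real b<..<real b + 1} h) = of_bool ((k - 1) * b \<le> h \<and> h \<le> b + (k - 1) * m)"
    using card_strip_sets(1)[OF k' U] by simp
qed

text \<open>For \<open>k = 6\<close>, lines cross inside the strip \<open>b < t < b + 1\<close> exactly in its middle \<open>t = b + 1/2\<close>:
  the line \<open>s = i\<close> meets \<open>3s + 2t = 3i + 2b + 1\<close>, and \<open>s + t = b + e\<close> meets \<open>3s + t = 3e + b - 1\<close>.
  Each such crossing is responsible for a second region of the same height.\<close>

definition extra :: "nat \<Rightarrow> nat \<Rightarrow> nat \<Rightarrow> bool" where
  "extra m b h \<longleftrightarrow> (\<exists>i\<ge>1. 3 * i + 2 * b < m \<and> 10 * i + 6 * b = h) \<or>
     (\<exists>e\<ge>1. 3 * e + b \<le> m + 1 \<and> 7 * e + 4 * b + min m (3 * e + 2 * b - 1) = h + 4)"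

lemma cnt_6:
  "cnt_less 6 m t s = card {j \<in> {1..m}. real j < s} + card {j \<in> {1..m}. real j < s + t} +
     card {j \<in> {1..m}. real j < 2 * s + t} + card {j \<in> {1..m}. real j < 3 * s + t} +
     card {j \<in> {1..m}. real j < 3 * s + 2 * t}"
  "cnt_leq 6 m t s = card {j \<in> {1..m}. real j \<le> s} + card {j \<in> {1..m}. real j \<le> s + t} +
     card {j \<in> {1..m}. real j \<le> 2 * s + t} + card {j \<in> {1..m}. real j \<le> 3 * s + t} +
     card {j \<in> {1..m}. real j \<le> 3 * s + 2 * t}"
  by (simp_all add: cnt_less_def cnt_leq_def pcoefs_eqs lin_def)

lemma card_leq_not_nat:
  assumes "\<And>j. y \<noteq> real j" shows "card {j \<in> {1..m}. real j \<le> y} = card {j \<in> {1..m}. real j < y}"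
  using assms by (metis (no_types, lifting) order_le_less)

lemma card_leq_Suc: "card {j \<in> {1..m}. real j \<le> y} \<le> Suc (card {j \<in> {1..m}. real j < y})"
  using card_leq_inj_on[of "{1..m}" real y] by (simp add: inj_on_def)

text \<open>A missed height requires a jump of at least two. It occurs only where \<open>s\<close>
  or \<open>s + t\<close> is an integer, and there exactly two lines meet, provided that the index
  of the second one is at most \<open>m\<close>. The jump then skips a single height.\<close>

lemma crossing_heights:
  assumes "t = real b + 1 / 2"
  shows "(\<exists>s>0. b + cnt_less 6 m t s < h \<and> h < b + cnt_leq 6 m t s) \<longleftrightarrow> extra m b h"
proof -
  have A: "cnt_less 6 m t (real i) = min m (i - 1) + min m (i + b) + min m (2 * i + b) + min m (3 * i + b) + min m (3 * i + 2 * b)"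
    "cnt_leq 6 m t (real i) = min m i + min m (i + b) + min m (2 * i + b) + min m (3 * i + b) + min m (3 * i + 2 * b + 1)"
    if "i \<ge> 1" for i
    unfolding cnt_6 assms
    by (intro arg_cong2[where f = "(+)"] card_less_real card_leq_real; use that in \<open>simp add: of_nat_diff\<close>)+
  have B: "cnt_less 6 m t (real e - 1/2) = min m (e - 1) + min m (e + b - 1) + min m (2 * e + b - 1) + min m (3 * e + b - 2) + min m (3 * e + 2 * b - 1)"
    "cnt_leq 6 m t (real e - 1/2) = min m (e - 1) + min m (e + b) + min m (2 * e + b - 1) + min m (3 * e + b - 1) + min m (3 * e + 2 * b - 1)"
    if "e \<ge> 1" for e
    unfolding cnt_6 assms
    by (intro arg_cong2[where f = "(+)"] card_less_real card_leq_real; use that in \<open>simp add: of_nat_diff\<close>)+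
  have B': "cnt_less 6 m t (real e - 1/2) = (e - 1) + (e + b - 1) + (2 * e + b - 1) + (3 * e + b - 2) + min m (3 * e + 2 * b - 1)"
    "cnt_leq 6 m t (real e - 1/2) = (e - 1) + (e + b) + (2 * e + b - 1) + (3 * e + b - 1) + min m (3 * e + 2 * b - 1)"
    if "e \<ge> 1" "3 * e + b \<le> m + 1" for e
    unfolding B[OF that(1)] using that by (simp_all add: min_absorb2)
  have A': "cnt_less 6 m t (real i) = (i - 1) + (i + b) + (2 * i + b) + (3 * i + b) + (3 * i + 2 * b)"
    "cnt_leq 6 m t (real i) = i + (i + b) + (2 * i + b) + (3 * i + b) + (3 * i + 2 * b + 1)"
    if "i \<ge> 1" "3 * i + 2 * b < m" for i
    unfolding A[OF that(1)] using that by (simp_all add: min_absorb2)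
  show ?thesis
  proof
    assume "\<exists>s>0. b + cnt_less 6 m t s < h \<and> h < b + cnt_leq 6 m t s"
    then obtain s where s: "s > 0" "b + cnt_less 6 m t s < h" "h < b + cnt_leq 6 m t s" by blast
    consider i where "s = real i" | e where "s + t = real e" | "\<And>i. s \<noteq> real i" "\<And>e. s + t \<noteq> real e"
      by blast
    then show "extra m b h"
    proof cases
      case 1
      then have i: "i \<ge> 1" using s(1) by (cases i) auto
      have "min m i \<le> Suc (min m (i - 1))" by arith
      \<comment> \<open>The line \<open>s = i\<close> contributes at most one to the jump, so the
        line of \<open>3s + 2t\<close> must contribute as well.\<close>
      then have "min m (3 * i + 2 * b) < min m (3 * i + 2 * b + 1)"
        using s(2,3) unfolding 1 A[OF i] by linarith
      then have lt: "3 * i + 2 * b < m" by (auto simp: min_def split: if_splits)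
      have "10 * i + 6 * b = h"
        using s(2,3) i unfolding 1 A'[OF i lt] by linarith
      with lt have "3 * i + 2 * b < m \<and> 10 * i + 6 * b = h" ..
      then show ?thesis unfolding extra_def using i by blast
    next
      case 2
      define e' where "e' = e - b"
      have "real e > real b" using 2 s(1) assms by linarith
      then have e': "e' \<ge> 1" "real e = real e' + real b" unfolding e'_def by auto
      have s': "s = real e' - 1/2" using 2 e' assms by simp
      have "min m (e' + b) \<le> Suc (min m (e' + b - 1))" by arith
      then have "min m (3 * e' + b - 2) < min m (3 * e' + b - 1)"
        using s(2,3) unfolding s' B[OF e'(1)] by linarith
      then have le: "3 * e' + b \<le> m + 1" by (auto simp: min_def split: if_splits)
      have "7 * e' + 4 * b + min m (3 * e' + 2 * b - 1) = h + 4"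
        using s(2,3) e'(1) unfolding s' B'[OF e'(1) le] by linarith
      with le have "3 * e' + b \<le> m + 1 \<and> 7 * e' + 4 * b + min m (3 * e' + 2 * b - 1) = h + 4" ..
      then show ?thesis unfolding extra_def using e'(1) by blast
    next
      case 3
      have nt: "t \<noteq> real x - real y" for x y
      proof
        assume "t = real x - real y"
        then have "real_of_int (2 * (int x - int y - int b)) = 1" using assms by simp
        then have "2 * (int x - int y - int b) = 1" by linarith
        then show False by presburger
      qed
      have ns: "s \<noteq> real x - real y" for x y
      proof
        assume e: "s = real x - real y"
        then have "s = real (x - y)" using s(1) by (simp add: of_nat_diff)
        then show False using 3(1) by blast
      qed
      have nst: "s + t \<noteq> real x - real y" for x y
      proof
        assume e: "s + t = real x - real y"
        then have "s + t = real (x - y)" using s(1) assms by (simp add: of_nat_diff)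
        then show False using 3(2) by blast
      qed
      \<comment> \<open>If two of the three remaining roots had integral values, then
        \<open>s\<close>, \<open>s + t\<close> or \<open>t\<close> would be integral, by
        subtraction.\<close>
      consider "\<And>x. 2 * s + t \<noteq> real x" "\<And>x. 3 * s + t \<noteq> real x"
        | "\<And>x. 2 * s + t \<noteq> real x" "\<And>x. 3 * s + 2 * t \<noteq> real x"
        | "\<And>x. 3 * s + t \<noteq> real x" "\<And>x. 3 * s + 2 * t \<noteq> real x"
      proof -
        have "\<not> (2 * s + t = real x \<and> 3 * s + t = real y)" for x y using ns[of y x] by argo
        moreover have "\<not> (2 * s + t = real x \<and> 3 * s + 2 * t = real y)" for x y using nst[of y x] by argo
        moreover have "\<not> (3 * s + t = real x \<and> 3 * s + 2 * t = real y)" for x y using nt[of y x] by argo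
        ultimately show ?thesis using that by metis
      qed
      then have "cnt_leq 6 m t s \<le> Suc (cnt_less 6 m t s)"
      proof cases
        case 1
        then show ?thesis
          unfolding cnt_6
            using 3(1,2)[THEN card_leq_not_nat, of m] 1(1,2)[THEN card_leq_not_nat, of m]
              card_leq_Suc[of m "3 * s + 2 * t"] by linarith
      next
        case 2
        then show ?thesis
          unfolding cnt_6
            using 3(1,2)[THEN card_leq_not_nat, of m] 2(1,2)[THEN card_leq_not_nat, of m]
              card_leq_Suc[of m "3 * s + t"] by linarith
      next
        case c3: 3
        then show ?thesis
          unfolding cnt_6
            using 3(1,2)[THEN card_leq_not_nat, of m] c3(1,2)[THEN card_leq_not_nat, of m]
              card_leq_Suc[of m "2 * s + t"] by linarith
      qed
      then show ?thesis using s(2,3) by linarith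
    qed
  next
    assume "extra m b h"
    then consider i where "i \<ge> 1" "3 * i + 2 * b < m" "10 * i + 6 * b = h"
      | e where "e \<ge> 1" "3 * e + b \<le> m + 1" "7 * e + 4 * b + min m (3 * e + 2 * b - 1) = h + 4"
      unfolding extra_def by blast
    then show "\<exists>s>0. b + cnt_less 6 m t s < h \<and> h < b + cnt_leq 6 m t s"
    proof cases
      case 1
      then show ?thesis
        by (intro exI[of _ "real i"] conjI) (auto simp: A')
    next
      case 2
      then have "real e - 1/2 > 0" by simp
      moreover have "b + cnt_less 6 m t (real e - 1/2) < h" "h < b + cnt_leq 6 m t (real e - 1/2)"
        unfolding B'[OF 2(1,2)] using 2(1,3) by linarith+
      ultimately show ?thesis by blast
    qed
  qed
qed

lemma extra_bounds: "extra m b h \<Longrightarrow> 4 * b + min m (2 * b + 1) \<le> h \<and> h \<le> b + 5 * m"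
  unfolding extra_def by (auto simp: min_def split: if_splits)

subsection \<open>Counting by height\<close>

text \<open>Finitely many strict inequalities persist near \<open>t\<close>. This moves a generic
  point off the middle level of a strip.\<close>

lemma perturb:
  assumes "generic k m (s, t)"
  shows "eventually (\<lambda>t'. generic k m (s, t') \<and> below k m (s, t') = below k m (s, t)) (at t)"
proof -
  have "eventually (\<lambda>t'. lin e (s, t') \<noteq> real j \<and> (real j < lin e (s, t') \<longleftrightarrow> real j < lin e (s, t))) (at t)"
    if "(e, j) \<in> coefs k \<times> {1..m}" for e j
  proof -
    have lim: "((\<lambda>t'. lin e (s, t')) \<longlongrightarrow> lin e (s, t)) (at t)"
      unfolding lin_def by (auto intro!: tendsto_intros)
    have "lin e (s, t) \<noteq> real j" using assms that by (auto simp: generic_def)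
    then consider "lin e (s, t) < real j" | "lin e (s, t) > real j" by linarith
    then show ?thesis
    proof cases
      case 1
      from order_tendstoD(2)[OF lim 1] show ?thesis by eventually_elim (use 1 in auto)
    next
      case 2
      from order_tendstoD(1)[OF lim 2] show ?thesis by eventually_elim (use 2 in auto)
    qed
  qed
  then have "eventually (\<lambda>t'. \<forall>x\<in>coefs k \<times> {1..m}. lin (fst x) (s, t') \<noteq> real (snd x) \<and>
      (real (snd x) < lin (fst x) (s, t') \<longleftrightarrow> real (snd x) < lin (fst x) (s, t))) (at t)"
    by (intro eventually_ball_finite) (auto simp: finite_coefs)
  moreover have "eventually (\<lambda>t'. 0 < t') (at t)"
    using assms order_tendstoD(1)[OF tendsto_ident_at] by (auto simp: generic_def)
  ultimately show ?thesis
  proof eventually_elim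
    case (elim t')
    then have "\<forall>e\<in>coefs k. \<forall>j\<in>{1..m}. lin e (s, t') \<noteq> real j \<and> (real j < lin e (s, t') \<longleftrightarrow> real j < lin e (s, t))"
      by auto
    with elim(2) assms show ?case unfolding generic_def below_def by auto
  qed
qed

lemma convex_below:
  assumes g: "generic k m p" "generic k m p'" and eq: "below k m p = below k m p'"
    and u: "0 \<le> u" "u \<le> 1"
  defines "q \<equiv> ((1 - u) * fst p + u * fst p', (1 - u) * snd p + u * snd p')"
  shows "generic k m q \<and> below k m q = below k m p"
proof -
  have comb: "(1 - u) * x + u * y > c" if "x > c" "y > c" for x y c :: real
  proof (cases "u = 1")
    case False
    have "(1 - u) * x + u * y - c = (1 - u) * (x - c) + u * (y - c)" by (simp add: algebra_simps)
    moreover have "(1 - u) * (x - c) > 0" "u * (y - c) \<ge> 0" using False u that by auto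
    ultimately show ?thesis by linarith
  qed (use that in simp)
  have comb': "(1 - u) * x + u * y < c" if "x < c" "y < c" for x y c :: real
    using comb[of "- c" "- x" "- y"] that by (simp add: algebra_simps)
  have lin: "lin e q = (1 - u) * lin e p + u * lin e p'" for e
    by (simp add: lin_def q_def algebra_simps)
  have side: "lin e q \<noteq> real j \<and> (real j < lin e q \<longleftrightarrow> real j < lin e p)" if "e \<in> coefs k" "j \<in> {1..m}" for e j
  proof -
    have "(e, j) \<in> below k m x \<longleftrightarrow> real j < lin e x" for x
      using that by (simp add: below_def)
    then have "real j < lin e p \<longleftrightarrow> real j < lin e p'" using eq by blast
    moreover have "lin e p \<noteq> real j" "lin e p' \<noteq> real j"
      using g that by (auto simp: generic_def)
    ultimately consider "lin e p < real j" "lin e p' < real j" | "lin e p > real j" "lin e p' > real j"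
      by linarith
    then show ?thesis unfolding lin by cases (use comb comb' in fastforce)+
  qed
  have "fst q > 0" "snd q > 0" using g comb unfolding q_def generic_def by auto
  then show ?thesis using side unfolding generic_def below_def by auto
qed

text \<open>A region meeting the middle level also meets both halves, by \<open>perturb\<close>. A
  region meeting both halves meets the middle level, by convexity.\<close>

lemma strip_sets_6_halves:
  "strip_sets 6 m {real b<..<real b + 1} h =
     strip_sets 6 m {real b<..<real b + 1/2} h \<union> strip_sets 6 m {real b + 1/2<..<real b + 1} h"
  "strip_sets 6 m {real b<..<real b + 1/2} h \<inter> strip_sets 6 m {real b + 1/2<..<real b + 1} h
     = strip_sets 6 m {real b + 1/2} h" (is "?Lo \<inter> ?Up = ?Mid")
proof -
  have mono: "strip_sets 6 m T h \<subseteq> strip_sets 6 m T' h" if "T \<subseteq> T'" for T T'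
    unfolding strip_sets_def using that by blast
  have mid: "?Mid \<subseteq> ?Lo \<inter> ?Up"
  proof
    fix B assume "B \<in> ?Mid"
    then obtain s where s: "B = below 6 m (s, real b + 1/2)" "generic 6 m (s, real b + 1/2)" "card B = h"
      unfolding strip_sets_def by auto
    let ?t = "real b + 1/2"
    have "eventually (\<lambda>t'. generic 6 m (s, t') \<and> below 6 m (s, t') = B) (at_left ?t)"
      "eventually (\<lambda>t'. generic 6 m (s, t') \<and> below 6 m (s, t') = B) (at_right ?t)"
      using perturb[OF s(2)] unfolding s(1) eventually_at_split by auto
    moreover have "eventually (\<lambda>t'. t' \<in> {real b<..<?t}) (at_left ?t)"
      "eventually (\<lambda>t'. t' \<in> {?t<..<real b + 1}) (at_right ?t)"
      by (intro eventually_at_leftI[of "real b"] eventually_at_rightI[of _ "real b + 1"]; simp)+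
    ultimately have "eventually (\<lambda>t'. (generic 6 m (s, t') \<and> below 6 m (s, t') = B) \<and> t' \<in> {real b<..<?t}) (at_left ?t)"
      and "eventually (\<lambda>t'. (generic 6 m (s, t') \<and> below 6 m (s, t') = B) \<and> t' \<in> {?t<..<real b + 1}) (at_right ?t)"
      by (simp_all only: eventually_conj_iff)
    note ev = this
    obtain t1 where t1: "generic 6 m (s, t1)" "below 6 m (s, t1) = B" "t1 \<in> {real b<..<?t}"
      using eventually_happens'[OF trivial_limit_at_left_real ev(1)] by blast
    obtain t2 where t2: "generic 6 m (s, t2)" "below 6 m (s, t2) = B" "t2 \<in> {?t<..<real b + 1}"
      using eventually_happens'[OF trivial_limit_at_right_real ev(2)] by blast
    have "B \<in> ?Lo"
      unfolding strip_sets_def using t1 s(3) by (intro CollectI exI[of _ "(s, t1)"]) simp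
    moreover have "B \<in> ?Up"
      unfolding strip_sets_def using t2 s(3) by (intro CollectI exI[of _ "(s, t2)"]) simp
    ultimately show "B \<in> ?Lo \<inter> ?Up" by blast
  qed
  have "?Lo \<inter> ?Up \<subseteq> ?Mid"
  proof
    fix B assume "B \<in> ?Lo \<inter> ?Up"
    then obtain p p' where p: "B = below 6 m p" "generic 6 m p" "snd p \<in> {real b<..<real b + 1/2}" "card B = h"
      and p': "B = below 6 m p'" "generic 6 m p'" "snd p' \<in> {real b + 1/2<..<real b + 1}"
      unfolding strip_sets_def by blast
    \<comment> \<open>The parameter at which the segment from \<open>p\<close> to \<open>p'\<close>
      reaches the middle level.\<close>
    define u where "u = (real b + 1/2 - snd p) / (snd p' - snd p)"
    have pos: "snd p' - snd p > 0" using p(3) p'(3) by auto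
    have u: "0 \<le> u" "u \<le> 1" using p(3) p'(3) pos unfolding u_def by (auto simp: field_simps)
    have "u * (snd p' - snd p) = real b + 1/2 - snd p" using pos by (simp add: u_def)
    then have "(1 - u) * snd p + u * snd p' = real b + 1/2" by (simp add: algebra_simps)
    with convex_below[OF p(2) p'(2) _ u] p(1,4) p'(1) show "B \<in> ?Mid"
      unfolding strip_sets_def by fastforce
  qed
  with mid show "?Lo \<inter> ?Up = ?Mid" by blast
  have "B \<in> ?Lo \<union> ?Up" if B: "B \<in> strip_sets 6 m {real b<..<real b + 1} h" for B
  proof -
    obtain p where p: "B = below 6 m p" "generic 6 m p" "snd p \<in> {real b<..<real b + 1}" "card B = h"
      using B unfolding strip_sets_def by blast
    consider "snd p \<in> {real b<..<real b + 1/2}" | "snd p \<in> {real b + 1/2<..<real b + 1}" | "snd p \<in> {real b + 1/2}"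
      using p(3) by force
    moreover have "B \<in> strip_sets 6 m T h" if "snd p \<in> T" for T
      unfolding strip_sets_def using p(1,2,4) that by blast
    ultimately show ?thesis using mid by cases blast+
  qed
  moreover have "?Lo \<subseteq> strip_sets 6 m {real b<..<real b + 1} h" "?Up \<subseteq> strip_sets 6 m {real b<..<real b + 1} h"
    by (rule mono; fastforce)+
  ultimately show "strip_sets 6 m {real b<..<real b + 1} h = ?Lo \<union> ?Up" by blast
qed

text \<open>Here \<open>n\<close> is the integer part of \<open>2 * t\<close> on the whole half
  strip. No lines cross inside it, so each height occurs at most once, and the quarter level already
  shows every possible height.\<close>

lemma half_strip_heights:
  assumes T: "T = {real b<..<real b + 1/2} \<and> n = 2 * b \<or> T = {real b + 1/2<..<real b + 1} \<and> n = 2 * b + 1"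
    and b: "b \<le> m"
  shows "card (strip_sets 6 m T h) = of_bool (4 * b + min m n \<le> h \<and> h \<le> b + 5 * m)"
    and "finite (strip_sets 6 m T h)"
proof -
  have k: "6 \<in> {2, 3, 4, 6 :: nat}" by simp
  have 1: "real b < t" "t < real b + 1" "real n \<le> 2 * t" "2 * t < real n + 1" if "t \<in> T" for t
    using T that by auto
  have U: "uncrossed 6 T"
    by (rule uncrossed_interval[of _ "int n"]) (use T in \<open>auto simp: crossing_bound_def\<close>)
  show "finite (strip_sets 6 m T h)" by (rule card_strip_sets[OF k U])
  have cp: "card (pcoefs 6) = 5" using card_pcoefs[OF k] by simp
  have "(\<exists>t\<in>T. h \<in> level_heights 6 m t) \<longleftrightarrow> 4 * b + min m n \<le> h \<and> h \<le> b + 5 * m"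
  proof
    assume "\<exists>t\<in>T. h \<in> level_heights 6 m t"
    then obtain t where t: "t \<in> T" "h \<in> level_heights 6 m t" by auto
    show "4 * b + min m n \<le> h \<and> h \<le> b + 5 * m"
      using t(2) unfolding level_heights_iff[OF 1(1,2)[OF t(1)] b] cnt_leq_6_0[OF 1(1,2)[OF t(1)] b 1(3,4)[OF t(1)]] cp
      by simp
  next
    assume h: "4 * b + min m n \<le> h \<and> h \<le> b + 5 * m"
    obtain t where t: "t \<in> T" "t = real b + 1/4 \<or> t = real b + 3/4"
    proof -
      have "real b + 1/4 \<in> T \<or> real b + 3/4 \<in> T" using T by auto
      then show ?thesis using that by blast
    qed
    have "h \<in> level_heights 6 m t"
      unfolding level_heights_inj[OF inj_on_cross_quarter[OF k t(2)] 1(1,2)[OF t(1)] b]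
        cnt_leq_6_0[OF 1(1,2)[OF t(1)] b 1(3,4)[OF t(1)]] cp using h .
    then show "\<exists>t\<in>T. h \<in> level_heights 6 m t" using t(1) by auto
  qed
  then show "card (strip_sets 6 m T h) = of_bool (4 * b + min m n \<le> h \<and> h \<le> b + 5 * m)"
    using card_strip_sets(1)[OF k U] by simp
qed

text \<open>Inclusion and exclusion for the two halves. The upper half and the middle level have the
  same range of heights, except that the middle level misses those in \<open>extra\<close>; their
  difference is the second summand.\<close>

lemma card_strip_6:
  assumes b: "b \<le> m"
  shows "card (strip_sets 6 m {real b<..<real b + 1} h)
      = of_bool (4 * b + min m (2 * b) \<le> h \<and> h \<le> b + 5 * m) + of_bool (extra m b h)"
    and "finite (strip_sets 6 m {real b<..<real b + 1} h)"
proof -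
  let ?Lo = "strip_sets 6 m {real b<..<real b + 1/2} h"
  let ?Up = "strip_sets 6 m {real b + 1/2<..<real b + 1} h"
  let ?Mid = "strip_sets 6 m {real b + 1/2} h"
  have lo: "card ?Lo = of_bool (4 * b + min m (2 * b) \<le> h \<and> h \<le> b + 5 * m)" "finite ?Lo"
    using half_strip_heights[of "{real b<..<real b + 1/2}" b "2 * b"] b by simp_all
  have up: "card ?Up = of_bool (4 * b + min m (2 * b + 1) \<le> h \<and> h \<le> b + 5 * m)" "finite ?Up"
    using half_strip_heights[of "{real b + 1/2<..<real b + 1}" b "2 * b + 1"] b by simp_all
  have k: "6 \<in> {2, 3, 4, 6 :: nat}" by simp
  have U: "uncrossed 6 {real b + 1/2}"
    unfolding uncrossed_def by auto
  let ?t = "real b + 1/2"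
  have t: "real b < ?t" "?t < real b + 1" "real (2 * b + 1) \<le> 2 * ?t" "2 * ?t < real (2 * b + 1) + 1" by auto
  have cp: "card (pcoefs 6) = 5" using card_pcoefs[OF k] by simp
  have "card ?Mid = of_bool (h \<in> level_heights 6 m ?t)"
    using card_strip_sets(1)[OF k U] by simp
  also have "h \<in> level_heights 6 m ?t \<longleftrightarrow> 4 * b + min m (2 * b + 1) \<le> h \<and> h \<le> b + 5 * m \<and> \<not> extra m b h"
    unfolding level_heights_iff[OF t(1,2) b] cnt_leq_6_0[OF t(1,2) b t(3,4)] cp crossing_heights[OF refl] by simp
  finally have mid: "card ?Mid = of_bool (4 * b + min m (2 * b + 1) \<le> h \<and> h \<le> b + 5 * m \<and> \<not> extra m b h)" .
  have "card ?Lo + card ?Up = card (?Lo \<union> ?Up) + card (?Lo \<inter> ?Up)"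
    by (rule card_Un_Int) (use lo up in auto)
  then have "card (strip_sets 6 m {real b<..<real b + 1} h) + card ?Mid = card ?Lo + card ?Up"
    by (simp only: strip_sets_6_halves)
  then show "card (strip_sets 6 m {real b<..<real b + 1} h)
      = of_bool (4 * b + min m (2 * b) \<le> h \<and> h \<le> b + 5 * m) + of_bool (extra m b h)"
    using extra_bounds[of m b h] unfolding lo up mid by (auto simp: of_bool_def split: if_splits)
  show "finite (strip_sets 6 m {real b<..<real b + 1} h)"
    unfolding strip_sets_6_halves(1) using lo up by simp
qed

text \<open>Above \<open>t = m\<close> every root involving \<open>t\<close> exceeds
  \<open>m\<close>, so only the value of \<open>s\<close> matters. The unbounded upper part of the
  chamber thus has the same regions as strip \<open>m\<close>.\<close>

lemma below_top_strip:
  assumes "generic k m (s, t)" "t > real m"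
  shows "generic k m (s, real m + 1/2) \<and> below k m (s, real m + 1/2) = below k m (s, t)"
proof -
  have "lin e (s, real m + 1/2) \<noteq> real j \<and> (real j < lin e (s, real m + 1/2) \<longleftrightarrow> real j < lin e (s, t))"
    if "e \<in> coefs k" "j \<in> {1..m}" for e j
  proof (cases "snd e = 0")
    case True
    have "lin e (s, t) \<noteq> real j" using assms(1) that unfolding generic_def by blast
    then show ?thesis using True by (simp add: lin_def)
  next
    case False
    have s: "s > 0" using assms by (simp add: generic_def)
    have "real j < lin e (s, x)" if x: "x > real m" for x
    proof -
      have "real (snd e) \<ge> 1" using False by simp
      then have "real (snd e) * x \<ge> 1 * x" by (intro mult_right_mono) (use x in auto)
      moreover have "real (fst e) * s \<ge> 0" using s by simp
      moreover have "real j \<le> real m" using \<open>j \<in> {1..m}\<close> by simp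
      ultimately show ?thesis using x unfolding lin_def fst_conv snd_conv by linarith
    qed
    from this[of "real m + 1/2"] this[OF assms(2)] show ?thesis by auto
  qed
  moreover have "s > 0" using assms by (simp add: generic_def)
  ultimately show ?thesis unfolding generic_def below_def by (auto simp: add_nonneg_pos)
qed

lemma below_sets_partition:
  "{B \<in> below k m ` Collect (generic k m). card B = h} = (\<Union>b\<le>m. strip_sets k m {real b<..<real b + 1} h)"
proof
  show "(\<Union>b\<le>m. strip_sets k m {real b<..<real b + 1} h) \<subseteq> {B \<in> below k m ` Collect (generic k m). card B = h}"
    unfolding strip_sets_def by blast
  show "{B \<in> below k m ` Collect (generic k m). card B = h} \<subseteq> (\<Union>b\<le>m. strip_sets k m {real b<..<real b + 1} h)"
  proof safe
    fix s t assume g: "generic k m (s, t)"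
    show "below k m (s, t) \<in> (\<Union>b\<le>m. strip_sets k m {real b<..<real b + 1} (card (below k m (s, t))))"
    proof (cases "t > real m")
      case True
      have "below k m (s, t) \<in> strip_sets k m {real m<..<real m + 1} (card (below k m (s, t)))"
        unfolding strip_sets_def using below_top_strip[OF g True]
        by (intro CollectI exI[of _ "(s, real m + 1/2)"]) auto
      then show ?thesis by blast
    next
      case False
      define b where "b = nat \<lfloor>t\<rfloor>"
      have t0: "t > 0" using g by (simp add: generic_def)
      then have b: "real b \<le> t" "t < real b + 1" unfolding b_def by linarith+
      have bm: "b \<le> m" using b False by linarith
      have "real b \<noteq> t"
      proof
        assume e: "real b = t"
        then have "b \<in> {1..m}" using t0 bm by auto
        moreover have "(0, 1) \<in> coefs k" by (simp add: coefs_def)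
        ultimately have "lin (0, 1) (s, t) \<noteq> real b" using g unfolding generic_def by blast
        then show False using e by (simp add: lin_def)
      qed
      then have "below k m (s, t) \<in> strip_sets k m {real b<..<real b + 1} (card (below k m (s, t)))"
        unfolding strip_sets_def using g b by (intro CollectI exI[of _ "(s, t)"]) auto
      then show ?thesis using bm by blast
    qed
  qed
qed

lemma strip_sets_disjoint:
  assumes "b < b'" "b' \<le> m"
  shows "strip_sets k m {real b<..<real b + 1} h \<inter> strip_sets k m {real b'<..<real b' + 1} h = {}"
proof -
  have in1: "(0, 1) \<in> coefs k" by (simp add: coefs_def)
  have "((0, 1), b') \<in> B" if "B \<in> strip_sets k m {real b'<..<real b' + 1} h" for B
    using that assms in1 by (auto simp: strip_sets_def below_def lin_def)
  moreover have "((0, 1), b') \<notin> B" if B: "B \<in> strip_sets k m {real b<..<real b + 1} h" for B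
  proof -
    have "real b + 1 \<le> real b'" using assms(1) by linarith
    then show ?thesis using B by (auto simp: strip_sets_def below_def lin_def)
  qed
  ultimately show ?thesis by blast
qed

lemma card_below_sets:
  assumes "\<And>b. b \<le> m \<Longrightarrow> finite (strip_sets k m {real b<..<real b + 1} h)"
  shows "card {B \<in> below k m ` Collect (generic k m). card B = h}
    = (\<Sum>b\<le>m. card (strip_sets k m {real b<..<real b + 1} h))"
  unfolding below_sets_partition
proof (rule card_UN_disjoint)
  show "\<forall>i\<in>{..m}. \<forall>j\<in>{..m}. i \<noteq> j \<longrightarrow>
      strip_sets k m {real i<..<real i + 1} h \<inter> strip_sets k m {real j<..<real j + 1} h = {}"
  proof (intro ballI impI)
    fix i j assume "i \<in> {..m}" "j \<in> {..m}" "i \<noteq> j"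
    then show "strip_sets k m {real i<..<real i + 1} h \<inter> strip_sets k m {real j<..<real j + 1} h = {}"
      using strip_sets_disjoint[of i j m k h] strip_sets_disjoint[of j i m k h] by (cases "i < j") auto
  qed
qed (use assms in auto)

text \<open>The crossing of \<open>s = i\<close> in strip \<open>b\<close> compensates for a height \<open>h\<close> missing in strip
  \<open>B = b + 2i\<close>, the crossing of \<open>s + t = b + e\<close> for one missing in strip \<open>B = b + 2e - 1\<close>. The following
  function recovers \<open>b\<close> from \<open>B\<close>; its second case occurs when \<open>min m (3e + 2b - 1) = m\<close>.\<close>

definition extra_strip :: "nat \<Rightarrow> nat \<Rightarrow> nat \<Rightarrow> nat" where
  "extra_strip m h B = (if 3 * B + (h - 5 * B) < 2 * m then h - 5 * B else 3 * B + 2 * (h - 5 * B) + 1 - 2 * m)"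

text \<open>Put \<open>c = h - 5 * B\<close>. In the first case of \<open>extra_strip\<close> one
  has \<open>b = c\<close>, and the parity of \<open>B - c\<close> tells the two kinds of crossings
  apart. In the second case the crossing index satisfies \<open>m = c + B + e\<close>.\<close>

lemma bij_betw_extra:
  "bij_betw (extra_strip m h) {B. B \<le> m \<and> 5 * B \<le> h \<and> h < 4 * B + min m (2 * B)} {b. b \<le> m \<and> extra m b h}"
proof (rule bij_betw_imageI)
  show "inj_on (extra_strip m h) {B. B \<le> m \<and> 5 * B \<le> h \<and> h < 4 * B + min m (2 * B)}"
  proof (rule inj_onI, clarify)
    fix B B' assume *: "5 * B \<le> h" "h < 4 * B + min m (2 * B)" "5 * B' \<le> h" "h < 4 * B' + min m (2 * B')"
      "extra_strip m h B = extra_strip m h B'"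
    obtain c c' where c: "h = 5 * B + c" "h = 5 * B' + c'" using * le_Suc_ex by metis
    have "h - 5 * B = c" "h - 5 * B' = c'" using c by linarith+
    then show "B = B'" using * c unfolding extra_strip_def by (auto split: if_splits)
  qed
  show "extra_strip m h ` {B. B \<le> m \<and> 5 * B \<le> h \<and> h < 4 * B + min m (2 * B)} = {b. b \<le> m \<and> extra m b h}"
  proof (intro set_eqI iffI)
    fix b assume "b \<in> extra_strip m h ` {B. B \<le> m \<and> 5 * B \<le> h \<and> h < 4 * B + min m (2 * B)}"
    then obtain B where B: "B \<le> m" "5 * B \<le> h" "h < 4 * B + m" "h < 6 * B" and b: "b = extra_strip m h B"
      by auto
    obtain c where c: "h = 5 * B + c" using B le_Suc_ex by metis
    have hc: "h - 5 * B = c" using c by simp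
    show "b \<in> {b. b \<le> m \<and> extra m b h}"
    proof (cases "3 * B + c < 2 * m")
      case True
      then have bc: "b = c" using b hc by (simp add: extra_strip_def)
      obtain n where n: "B = c + n" "n \<ge> 1" 
      proof -
        have "c < B" using B(4) c by linarith
        then show ?thesis using that[of "B - c"] by simp
      qed
      \<comment> \<open>Even \<open>n\<close> belongs to the crossing on \<open>s = i\<close>, odd
        \<open>n\<close> to the one on \<open>s + t = b + e\<close> with
        \<open>e = i + 1\<close>.\<close>
      show ?thesis
      proof (cases "even n")
        case True
        then obtain i where i: "n = 2 * i" by blast
        have "i \<ge> 1 \<and> 3 * i + 2 * b < m \<and> 10 * i + 6 * b = h"
          using \<open>3 * B + c < 2 * m\<close> n i bc c by auto
        then show ?thesis unfolding extra_def by auto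
      next
        case False
        then obtain i where i: "n = 2 * i + 1" by (rule oddE)
        have "3 * (i + 1) + b \<le> m + 1" "3 * (i + 1) + 2 * b - 1 \<le> m"
          using \<open>3 * B + c < 2 * m\<close> n i bc by auto
        then have "i + 1 \<ge> 1 \<and> 3 * (i + 1) + b \<le> m + 1 \<and> 7 * (i + 1) + 4 * b + min m (3 * (i + 1) + 2 * b - 1) = h + 4"
          using n i bc c by (auto simp: min_absorb2)
        then show ?thesis unfolding extra_def by auto
      qed
    next
      case False
      then have bB: "b + 2 * m = 3 * B + 2 * c + 1" using b hc by (simp add: extra_strip_def)
      \<comment> \<open>Obtained by adding \<open>B = b + 2 * e - 1\<close> and
        \<open>c = m + 1 - 3 * e - b\<close>.\<close>
      define e where "e = m - c - B"
      have e: "m = c + B + e" "e \<ge> 1" using B c unfolding e_def by auto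
      have "3 * e + b \<le> m + 1" "m \<le> 3 * e + 2 * b - 1" using bB e B False by auto
      then have "3 * e + b \<le> m + 1 \<and> 7 * e + 4 * b + min m (3 * e + 2 * b - 1) = h + 4"
        using bB e c by (auto simp: min_absorb1)
      then show ?thesis unfolding extra_def using e(2) by auto
    qed
  next
    fix b assume b: "b \<in> {b. b \<le> m \<and> extra m b h}"
    consider i where "i \<ge> 1" "3 * i + 2 * b < m" "10 * i + 6 * b = h"
      | e where "e \<ge> 1" "3 * e + b \<le> m + 1" "3 * e + 2 * b \<le> m + 1" "10 * e + 6 * b = h + 5"
      | e where "e \<ge> 1" "3 * e + b \<le> m + 1" "3 * e + 2 * b > m + 1" "7 * e + 4 * b + m = h + 4"
    proof -
      from b have "extra m b h" by simp
      then consider i where "i \<ge> 1" "3 * i + 2 * b < m" "10 * i + 6 * b = h"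
        | e where "e \<ge> 1" "3 * e + b \<le> m + 1" "7 * e + 4 * b + min m (3 * e + 2 * b - 1) = h + 4"
        unfolding extra_def by blast
      then show ?thesis
      proof cases
        case 1
        then show ?thesis using that(1) by blast
      next
        case 2
        show ?thesis
        proof (cases "3 * e + 2 * b \<le> m + 1")
          case True
          then have "10 * e + 6 * b = h + 5" using 2 by linarith
          then show ?thesis using True 2 that(2) by blast
        next
          case False
          then have "7 * e + 4 * b + m = h + 4" using 2 by linarith
          then show ?thesis using False 2 that(3)[of e] by linarith
        qed
      qed
    qed
    then show "b \<in> extra_strip m h ` {B. B \<le> m \<and> 5 * B \<le> h \<and> h < 4 * B + min m (2 * B)}"
    proof cases
      case 1
      have "h = 5 * (b + 2 * i) + b" using 1(3) by simp
      then have hc: "h - 5 * (b + 2 * i) = b" by linarith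
      show ?thesis
        by (rule image_eqI[of _ _ "b + 2 * i"]) (use 1 hc in \<open>auto simp: extra_strip_def\<close>)
    next
      case 2
      have "h = 5 * (b + 2 * e - 1) + b" using 2 by linarith
      then have hc: "h - 5 * (b + 2 * e - 1) = b" by linarith
      show ?thesis
        by (rule image_eqI[of _ _ "b + 2 * e - 1"]) (use 2 hc in \<open>auto simp: extra_strip_def\<close>)
    next
      case 3
      have "h = 5 * (b + 2 * e - 1) + (m + 1 - 3 * e - b)" using 3 by linarith
      then have hc: "h - 5 * (b + 2 * e - 1) = m + 1 - 3 * e - b" by linarith
      show ?thesis
        by (rule image_eqI[of _ _ "b + 2 * e - 1"]) (use 3 hc in \<open>auto simp: extra_strip_def\<close>)
    qed
  qed
qed

text \<open>For \<open>k = 6\<close> the strips lack the heights from \<open>5 * b\<close> up to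
  \<open>4 * b + min m (2 * b)\<close>, the latter excluded. The additional regions at crossings
  have these heights, so the count takes the same form as for the other \<open>k\<close>.\<close>

lemma count_strips:
  assumes k: "k \<in> {2, 3, 4, 6}"
  shows "card {B \<in> below k m ` Collect (generic k m). card B = h}
    = card {b. b \<le> m \<and> (k - 1) * b \<le> h \<and> h \<le> b + (k - 1) * m}"
proof (cases "k = 6")
  case False
  then have k': "k \<in> {2, 3, 4}" using k by auto
  have "card {B \<in> below k m ` Collect (generic k m). card B = h}
      = (\<Sum>b\<le>m. of_bool ((k - 1) * b \<le> h \<and> h \<le> b + (k - 1) * m))"
    by (subst card_below_sets) (auto simp: card_strip_small[OF k'])
  also have "\<dots> = card {b. b \<le> m \<and> (k - 1) * b \<le> h \<and> h \<le> b + (k - 1) * m}"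
    by (subst sum_of_bool_eq) (auto intro!: arg_cong[where f = card])
  finally show ?thesis .
next
  case True
  let ?L = "\<lambda>b. 4 * b + min m (2 * b)"
  have "card {B \<in> below 6 m ` Collect (generic 6 m). card B = h}
      = (\<Sum>b\<le>m. of_bool (?L b \<le> h \<and> h \<le> b + 5 * m) + of_bool (extra m b h))"
    by (subst card_below_sets) (auto simp: card_strip_6)
  also have "\<dots> = card {b. b \<le> m \<and> ?L b \<le> h \<and> h \<le> b + 5 * m} + card {b. b \<le> m \<and> extra m b h}"
    unfolding sum.distrib
    by (intro arg_cong2[where f = "(+)"]; subst sum_of_bool_eq) (auto intro!: arg_cong[where f = card])
  also have "card {b. b \<le> m \<and> extra m b h} = card {B. B \<le> m \<and> 5 * B \<le> h \<and> h < ?L B}"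
    by (rule bij_betw_same_card[OF bij_betw_extra, symmetric])
  also have "card {b. b \<le> m \<and> ?L b \<le> h \<and> h \<le> b + 5 * m} + card {B. B \<le> m \<and> 5 * B \<le> h \<and> h < ?L B}
      = card ({b. b \<le> m \<and> ?L b \<le> h \<and> h \<le> b + 5 * m} \<union> {B. B \<le> m \<and> 5 * B \<le> h \<and> h < ?L B})"
    by (rule card_Un_disjoint[symmetric]) auto
  also have "{b. b \<le> m \<and> ?L b \<le> h \<and> h \<le> b + 5 * m} \<union> {B. B \<le> m \<and> 5 * B \<le> h \<and> h < ?L B}
      = {b. b \<le> m \<and> 5 * b \<le> h \<and> h \<le> b + 5 * m}"
  proof -
    have "5 * b \<le> ?L b" "?L b \<le> 5 * m" if "b \<le> m" for b using that by auto
    then show ?thesis by (intro set_eqI) (fastforce)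
  qed
  finally show ?thesis using True by simp
qed

text \<open>For \<open>h \<le> (k - 1) * m\<close> both upper bounds hold automatically and the two
  sets agree. Otherwise the lower bounds are automatic and \<open>b \<mapsto> m - b\<close>
  exchanges the upper ones.\<close>

lemma count_reflect:
  fixes k m h :: nat
  assumes "k \<ge> 1"
  shows "card {b. b \<le> m \<and> (k - 1) * b \<le> h \<and> h \<le> b + (k - 1) * m} = card {l. l \<le> m \<and> (k - 1) * l \<le> h \<and> h + l \<le> m * k}"
proof (cases "h \<le> (k - 1) * m")
  case True
  have mk: "m * k = m + (k - 1) * m" by (cases k) (use assms in auto)
  have "{b. b \<le> m \<and> (k - 1) * b \<le> h \<and> h \<le> b + (k - 1) * m} = {l. l \<le> m \<and> (k - 1) * l \<le> h \<and> h + l \<le> m * k}"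
    unfolding mk using True by auto
  then show ?thesis by simp
next
  case False
  have mk: "m * k = m + (k - 1) * m" by (cases k) (use assms in auto)
  have le: "(k - 1) * b \<le> h" if "b \<le> m" for b
    using mult_le_mono2[OF that, of "k - 1"] False by linarith
  have "bij_betw (\<lambda>b. m - b) {b. b \<le> m \<and> (k - 1) * b \<le> h \<and> h \<le> b + (k - 1) * m}
     {l. l \<le> m \<and> (k - 1) * l \<le> h \<and> h + l \<le> m * k}"
    by (rule bij_betw_byWitness[where f' = "\<lambda>b. m - b"]) (auto simp: le[simplified] mk)
  then show ?thesis by (rule bij_betw_same_card)
qed

subsection \<open>Regions of the Shi arrangement\<close>

text \<open>The simple roots are the first and the last positive root in the order of their
  angles.\<close>

definition rootof :: "nat \<Rightarrow> nat \<times> nat \<Rightarrow> real \<times> real" where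
  "rootof k e = real (fst e) *\<^sub>R Defs.root k 0 + real (snd e) *\<^sub>R Defs.root k (k - 1)"

definition coords :: "nat \<Rightarrow> real \<times> real \<Rightarrow> real \<times> real" where
  "coords k x = (Defs.root k 0 \<bullet> x, Defs.root k (k - 1) \<bullet> x)"

lemma inner_rootof: "rootof k e \<bullet> x = lin e (coords k x)"
  by (simp add: rootof_def lin_def coords_def inner_add_left)

lemma root_values:
  "Defs.root k 0 = (1, 0)"
  "Defs.root 2 1 = (0, 1)"
  "Defs.root 3 1 = (1/2, sqrt 3 / 2)" "Defs.root 3 2 = (-1/2, sqrt 3 / 2)"
  "Defs.root 4 1 = (1, 1)" "Defs.root 4 2 = (0, 1)" "Defs.root 4 3 = (-1, 1)"
  "Defs.root 6 1 = (3/2, sqrt 3 / 2)" "Defs.root 6 2 = (1/2, sqrt 3 / 2)" "Defs.root 6 3 = (0, sqrt 3)"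
  "Defs.root 6 4 = (-1/2, sqrt 3 / 2)" "Defs.root 6 5 = (-3/2, sqrt 3 / 2)"
proof -
  have a: "2 * pi / 3 = pi - pi / 3" "3 * pi / 4 = pi - pi / 4" "2 * pi / 4 = pi / 2"
    "2 * pi / 6 = pi / 3" "3 * pi / 6 = pi / 2" "4 * pi / 6 = pi - pi / 3" "5 * pi / 6 = pi - pi / 6"
    by simp_all
  show "Defs.root k 0 = (1, 0)"
    "Defs.root 2 1 = (0, 1)"
    "Defs.root 3 1 = (1/2, sqrt 3 / 2)" "Defs.root 3 2 = (-1/2, sqrt 3 / 2)"
    "Defs.root 4 1 = (1, 1)" "Defs.root 4 2 = (0, 1)" "Defs.root 4 3 = (-1, 1)"
    "Defs.root 6 1 = (3/2, sqrt 3 / 2)" "Defs.root 6 2 = (1/2, sqrt 3 / 2)" "Defs.root 6 3 = (0, sqrt 3)"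
    "Defs.root 6 4 = (-1/2, sqrt 3 / 2)" "Defs.root 6 5 = (-3/2, sqrt 3 / 2)"
    unfolding Defs.root_def root_len_def of_nat_numeral of_nat_1 mult_1 a cos_pi_minus sin_pi_minus
    by (simp_all add: cos_30 cos_45 cos_60 sin_30 sin_45 sin_60)
qed

lemma snd_last_root: "k \<in> {2, 3, 4, 6} \<Longrightarrow> snd (Defs.root k (k - 1)) > 0"
  using root_values(2,4,7,12) by auto

lemma pos_roots_eq: "pos_roots k = Defs.root k ` {..<k}"
  unfolding pos_roots_def by auto

lemma rootof_coefs:
  assumes "k \<in> {2, 3, 4, 6}" shows "rootof k ` coefs k = pos_roots k"
proof -
  have n: "{..<2} = {0, 1 :: nat}" "{..<3} = {0, 1, 2 :: nat}" "{..<4} = {0, 1, 2, 3 :: nat}"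
    "{..<6} = {0, 1, 2, 3, 4, 5 :: nat}"
    by auto
  have c: "coefs 2 = {(1, 0), (0, 1)}" "coefs 3 = {(1, 0), (1, 1), (0, 1)}"
    "coefs 4 = {(1, 0), (2, 1), (1, 1), (0, 1)}" "coefs 6 = {(1, 0), (3, 1), (2, 1), (3, 2), (1, 1), (0, 1)}"
    unfolding coefs_def by auto
  consider "k = 2" | "k = 3" | "k = 4" | "k = 6" using assms by blast
  then show ?thesis
  proof cases
    case 1
    have "rootof 2 (1, 0) = Defs.root 2 0" "rootof 2 (0, 1) = Defs.root 2 1"
      by (simp_all add: rootof_def)
    then show ?thesis unfolding 1 pos_roots_eq n c by simp
  next
    case 2
    have "rootof 3 (1, 0) = Defs.root 3 0" "rootof 3 (1, 1) = Defs.root 3 1" "rootof 3 (0, 1) = Defs.root 3 2"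
      using root_values(1)[of 3] root_values(3,4) by (simp_all add: rootof_def)
    then show ?thesis unfolding 2 pos_roots_eq n c by simp
  next
    case 3
    have "rootof 4 (1, 0) = Defs.root 4 0" "rootof 4 (2, 1) = Defs.root 4 1"
      "rootof 4 (1, 1) = Defs.root 4 2" "rootof 4 (0, 1) = Defs.root 4 3"
      using root_values(1)[of 4] root_values(5-7) by (simp_all add: rootof_def)
    then show ?thesis unfolding 3 pos_roots_eq n c by simp
  next
    case 4
    have "rootof 6 (1, 0) = Defs.root 6 0" "rootof 6 (3, 1) = Defs.root 6 1" "rootof 6 (2, 1) = Defs.root 6 2"
      "rootof 6 (3, 2) = Defs.root 6 3" "rootof 6 (1, 1) = Defs.root 6 4" "rootof 6 (0, 1) = Defs.root 6 5"
      using root_values(1)[of 6] root_values(8-12) by (simp_all add: rootof_def)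
    then show ?thesis unfolding 4 pos_roots_eq n c by simp
  qed
qed

lemma inj_rootof: assumes "k \<in> {2, 3, 4, 6}" shows "inj (rootof k)"
proof (rule injI)
  fix e e' assume eq: "rootof k e = rootof k e'"
  have "snd (rootof k x) = real (snd x) * snd (Defs.root k (k - 1))"
    "fst (rootof k x) = real (fst x) + real (snd x) * fst (Defs.root k (k - 1))" for x
    by (simp_all add: rootof_def root_values(1))
  with eq snd_last_root[OF assms] show "e = e'"
    by (metis add_right_cancel less_irrefl mult_cancel_right of_nat_eq_iff prod_eqI)
qed

lemma card_coefs: assumes "k \<in> {2, 3, 4, 6}" shows "card (coefs k) = k"
proof -
  have "(0, 1) \<notin> pcoefs k" by (simp add: pcoefs_def)
  then have "card (coefs k) = Suc (card (pcoefs k))"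
    unfolding coefs_eq by (simp add: finite_pcoefs)
  moreover have "k \<ge> 2" using assms by auto
  ultimately show ?thesis using card_pcoefs[OF assms] by linarith
qed

lemma card_pos_roots: assumes "k \<in> {2, 3, 4, 6}" shows "card (pos_roots k) = k"
  using card_image[OF inj_on_subset[OF inj_rootof[OF assms] subset_UNIV], of "coefs k"]
  by (simp add: rootof_coefs[OF assms] card_coefs[OF assms])

lemma surj_coords: assumes "k \<in> {2, 3, 4, 6}" shows "surj (coords k)"
proof (rule surjI)
  fix p :: "real \<times> real"
  let ?r = "Defs.root k (k - 1)"
  show "coords k (fst p, (snd p - fst p * fst ?r) / snd ?r) = p"
    using snd_last_root[OF assms] by (cases p) (auto simp: coords_def root_values(1) inner_prod_def)
qed

lemma coefs_dominant:
  "(\<forall>e\<in>coefs k. lin e p > 0) \<longleftrightarrow> fst p > 0 \<and> snd p > 0"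
proof
  assume "\<forall>e\<in>coefs k. lin e p > 0"
  moreover have "(1, 0) \<in> coefs k" "(0, 1) \<in> coefs k" by (auto simp: coefs_def)
  ultimately have "lin (1, 0) p > 0" "lin (0, 1) p > 0" by blast+
  then show "fst p > 0 \<and> snd p > 0" by (simp add: lin_def)
next
  assume "fst p > 0 \<and> snd p > 0"
  then show "\<forall>e\<in>coefs k. lin e p > 0"
    by (auto simp: coefs_def lin_def add_pos_pos)
qed

section \<open>Positive regions and the sets of lines below them\<close>

context
  fixes k m :: nat
  assumes k: "k \<in> {2, 3, 4, 6}" and m: "m \<ge> 1"
begin

lemma ball_pos_roots: "(\<forall>a\<in>pos_roots k. P a) \<longleftrightarrow> (\<forall>e\<in>coefs k. P (rootof k e))"
  unfolding rootof_coefs[OF k, symmetric] by blast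

text \<open>A point on which all positive roots are positive avoids every hyperplane with
  \<open>j \<le> 0\<close>, so only the indices from 1 to \<open>m\<close> remain.\<close>

lemma generic_coords_iff:
  "generic k m (coords k x) \<longleftrightarrow> x \<in> shi_complement k m \<and> (\<forall>a\<in>pos_roots k. a \<bullet> x > 0)"
proof -
  have "(\<forall>j\<in>{1..m}. y \<noteq> real j) \<longleftrightarrow> (\<forall>j\<in>{- int m + 1..int m}. y \<noteq> of_int j)" if y: "y > 0" for y
  proof (intro iffI ballI)
    fix j assume *: "\<forall>j\<in>{1..m}. y \<noteq> real j" "j \<in> {- int m + 1..int m}"
    show "y \<noteq> of_int j"
    proof
      assume yj: "y = of_int j"
      then have "j > 0" using y by simp
      then obtain n where n: "j = int n" "n > 0" using zero_less_imp_eq_int by blast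
      then have "n \<in> {1..m}" "y = real n" using *(2) yj by auto
      then show False using *(1) by blast
    qed
  next
    fix j assume *: "\<forall>j\<in>{- int m + 1..int m}. y \<noteq> of_int j" "j \<in> {1..m}"
    then have "int j \<in> {- int m + 1..int m}" by auto
    then have "y \<noteq> of_int (int j)" using *(1) by blast
    then show "y \<noteq> real j" by simp
  qed
  moreover have "generic k m (coords k x) \<longleftrightarrow> (\<forall>e\<in>coefs k. lin e (coords k x) > 0) \<and>
      (\<forall>e\<in>coefs k. \<forall>j\<in>{1..m}. lin e (coords k x) \<noteq> real j)"
    unfolding generic_def coefs_dominant by blast
  ultimately have "generic k m (coords k x) \<longleftrightarrow> (\<forall>e\<in>coefs k. lin e (coords k x) > 0) \<and>
      (\<forall>e\<in>coefs k. \<forall>j\<in>{- int m + 1..int m}. lin e (coords k x) \<noteq> of_int j)"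
    by blast
  then show ?thesis
    unfolding shi_complement_def mem_Collect_eq ball_pos_roots inner_rootof by blast
qed

definition region_of :: "((nat \<times> nat) \<times> nat) set \<Rightarrow> (real \<times> real) set" where
  "region_of B = {y. generic k m (coords k y) \<and> below k m (coords k y) = B}"

lemma convex_region_of: "convex (region_of B)"
proof (rule convexI)
  fix x y :: "real \<times> real" and u v :: real
  assume xy: "x \<in> region_of B" "y \<in> region_of B" and uv: "0 \<le> u" "0 \<le> v" "u + v = 1"
  have u: "u = 1 - v" using uv by simp
  have "coords k (u *\<^sub>R x + v *\<^sub>R y) =
      ((1 - v) * fst (coords k x) + v * fst (coords k y), (1 - v) * snd (coords k x) + v * snd (coords k y))"
    unfolding u by (simp add: coords_def inner_add_right)
  then show "u *\<^sub>R x + v *\<^sub>R y \<in> region_of B"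
    using convex_below[of k m "coords k x" "coords k y" v] xy uv by (simp add: region_of_def)
qed

text \<open>The points sharing a set \<open>below\<close> form a convex subset of the complement,
  which gives one inclusion. For the other, a connected set avoiding a hyperplane stays on one side
  of it.\<close>

lemma connected_component_eq_region_of:
  assumes x: "generic k m (coords k x)"
  shows "connected_component_set (shi_complement k m) x = region_of (below k m (coords k x))"
proof
  let ?C = "connected_component_set (shi_complement k m) x"
  have xc: "x \<in> shi_complement k m" using x generic_coords_iff by blast
  then have xC: "x \<in> ?C" by simp
  have C: "?C \<subseteq> shi_complement k m" by (rule connected_component_subset)
  show "region_of (below k m (coords k x)) \<subseteq> ?C"
  proof (rule connected_component_maximal)
    show "x \<in> region_of (below k m (coords k x))" using x by (simp add: region_of_def)
    show "connected (region_of (below k m (coords k x)))" by (intro convex_connected convex_region_of)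
    show "region_of (below k m (coords k x)) \<subseteq> shi_complement k m"
      using generic_coords_iff by (auto simp: region_of_def)
  qed
  show "?C \<subseteq> region_of (below k m (coords k x))"
  proof
    fix y assume y: "y \<in> ?C"
    have side: "a \<bullet> x > of_int j \<longleftrightarrow> a \<bullet> y > of_int j"
      if a: "a \<in> pos_roots k" and j: "j \<in> {- int m + 1..int m}" for a j
    proof -
      have ne: "a \<bullet> z \<noteq> of_int j" if "z \<in> ?C" for z
        using that C a j unfolding shi_complement_def by blast
      show ?thesis
        using connected_ivt_hyperplane[OF connected_connected_component xC y, of a "of_int j"]
          connected_ivt_hyperplane[OF connected_connected_component y xC, of a "of_int j"] ne xC y
        by (meson less_le_not_le linear not_less)
    qed
    have "\<forall>a\<in>pos_roots k. a \<bullet> y > 0"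
    proof
      fix a assume "a \<in> pos_roots k"
      \<comment> \<open>Since \<open>m \<ge> 1\<close>, the hyperplane with \<open>j = 0\<close>
        belongs to the arrangement and keeps the component in the dominant chamber.\<close>
      then show "a \<bullet> y > 0" using side[of a 0] m x generic_coords_iff by auto
    qed
    then have gy: "generic k m (coords k y)" using generic_coords_iff y C by blast
    have "real j < lin e (coords k y) \<longleftrightarrow> real j < lin e (coords k x)" if "e \<in> coefs k" "j \<in> {1..m}" for e j
      using side[of "rootof k e" "int j"] that rootof_coefs[OF k] by (auto simp: inner_rootof)
    then have "below k m (coords k y) = below k m (coords k x)"
      unfolding below_def by auto
    with gy show "y \<in> region_of (below k m (coords k x))" by (simp add: region_of_def)
  qed
qed

lemma positive_regions_eq:
  "{R \<in> shi_regions k m. positive_region k R} = region_of ` below k m ` Collect (generic k m)"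
proof
  show "{R \<in> shi_regions k m. positive_region k R} \<subseteq> region_of ` below k m ` Collect (generic k m)"
  proof
    fix R assume "R \<in> {R \<in> shi_regions k m. positive_region k R}"
    then obtain x where R: "R = connected_component_set (shi_complement k m) x" "x \<in> shi_complement k m"
      and pos: "positive_region k R" unfolding shi_regions_def by blast
    have "x \<in> R" using R by simp
    then have "\<forall>a\<in>pos_roots k. a \<bullet> x > 0" using pos unfolding positive_region_def by blast
    then have "generic k m (coords k x)" using R(2) generic_coords_iff by blast
    then show "R \<in> region_of ` below k m ` Collect (generic k m)"
      unfolding R(1) using connected_component_eq_region_of by blast
  qed
  show "region_of ` below k m ` Collect (generic k m) \<subseteq> {R \<in> shi_regions k m. positive_region k R}"
  proof
    fix R assume "R \<in> region_of ` below k m ` Collect (generic k m)"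
    then obtain p where p: "generic k m p" "R = region_of (below k m p)" by blast
    obtain x where x: "p = coords k x" using surj_coords[OF k] by (metis surjD)
    have R: "R = connected_component_set (shi_complement k m) x"
      using connected_component_eq_region_of p x by simp
    moreover have "x \<in> shi_complement k m" using p(1) x generic_coords_iff by blast
    moreover have "positive_region k R"
      unfolding positive_region_def p(2) region_of_def using generic_coords_iff by blast
    ultimately show "R \<in> {R \<in> shi_regions k m. positive_region k R}"
      unfolding shi_regions_def by blast
  qed
qed

lemma inj_on_region_of: "inj_on region_of (below k m ` Collect (generic k m))"
proof (rule inj_onI)
  fix B B' assume B: "B \<in> below k m ` Collect (generic k m)" and eq: "region_of B = region_of B'"
  then obtain p where p: "generic k m p" "B = below k m p" by blast
  obtain x where x: "p = coords k x" using surj_coords[OF k] by (metis surjD)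
  have "x \<in> region_of B" using p x by (simp add: region_of_def)
  moreover from this have "x \<in> region_of B'" using eq by simp
  ultimately show "B = B'" by (simp add: region_of_def)
qed

lemma fund_alcove_nonempty: "fund_alcove k \<noteq> {}"
proof -
  obtain y where y: "coords k y = (1/10, 1/10)" using surj_coords[OF k] by (metis surjD)
  have "0 < lin e (coords k y) \<and> lin e (coords k y) < 1" if "e \<in> coefs k" for e
    using that unfolding y by (auto simp: coefs_def lin_def split: if_splits)
  then have "y \<in> fund_alcove k"
    unfolding fund_alcove_def mem_Collect_eq ball_pos_roots inner_rootof by blast
  then show ?thesis by blast
qed

text \<open>Roots take values between 0 and 1 on the fundamental alcove and positive values on the
  region, so exactly the hyperplanes with positive \<open>j\<close> below the value of the root
  separate. The answer is the same for all pairs of points, which settles the existential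
  quantifiers in \<open>shi_height\<close>.\<close>

lemma shi_height_region_of:
  assumes "B \<in> below k m ` Collect (generic k m)"
  shows "shi_height k m (region_of B) = card B"
proof -
  obtain p where p: "generic k m p" "B = below k m p" using assms by blast
  obtain x0 where x0: "p = coords k x0" using surj_coords[OF k] by (metis surjD)
  then have x0R: "x0 \<in> region_of B" using p by (simp add: region_of_def)
  obtain y0 where y0: "y0 \<in> fund_alcove k" using fund_alcove_nonempty by blast
  let ?f = "\<lambda>(e, j). (rootof k e, int j)"
  have sep: "(\<exists>x \<in> region_of B. \<exists>y \<in> fund_alcove k. (rootof k e \<bullet> x < of_int j) \<noteq> (rootof k e \<bullet> y < of_int j))
      \<longleftrightarrow> j > 0 \<and> (e, nat j) \<in> B" if e: "e \<in> coefs k" and j: "j \<in> {- int m + 1..int m}" for e j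
  proof -
    have re: "rootof k e \<in> pos_roots k" using e rootof_coefs[OF k] by blast
    have neq: "(rootof k e \<bullet> x < of_int j) \<noteq> (rootof k e \<bullet> y < of_int j) \<longleftrightarrow> j > 0 \<and> (e, nat j) \<in> B"
      if x: "x \<in> region_of B" and y: "y \<in> fund_alcove k" for x y
    proof -
      have gx: "generic k m (coords k x)" "below k m (coords k x) = B" using x by (auto simp: region_of_def)
      then have xpos: "rootof k e \<bullet> x > 0" using re generic_coords_iff by blast
      have y01: "0 < rootof k e \<bullet> y" "rootof k e \<bullet> y < 1" using y re by (auto simp: fund_alcove_def)
      show ?thesis
      proof (cases "j > 0")
        case False
        then have "real_of_int j \<le> 0" by simp
        then show ?thesis using False xpos y01 by linarith
      next
        case True
        then have nj: "nat j \<in> {1..m}" "real_of_int j = real (nat j)" "real_of_int j \<ge> 1" using j by auto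
        then have "lin e (coords k x) \<noteq> real (nat j)"
          using gx(1) e unfolding generic_def by blast
        moreover have "(e, nat j) \<in> B \<longleftrightarrow> real (nat j) < lin e (coords k x)"
          unfolding gx(2)[symmetric] below_def using e nj(1) by simp
        ultimately show ?thesis using y01 nj True unfolding inner_rootof by linarith
      qed
    qed
    then show ?thesis using x0R y0 by blast
  qed
  have "{(a, j). a \<in> pos_roots k \<and> j \<in> {- int m + 1 .. int m} \<and>
      (\<exists>x \<in> region_of B. \<exists>y \<in> fund_alcove k. (a \<bullet> x < of_int j) \<noteq> (a \<bullet> y < of_int j))} = ?f ` B" (is "?H = _")
  proof
    show "?H \<subseteq> ?f ` B"
    proof clarify
      fix a1 a2 j x1 x2 y1 y2
      assume a: "(a1, a2) \<in> pos_roots k" and j: "j \<in> {- int m + 1 .. int m}"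
        and xy: "(x1, x2) \<in> region_of B" "(y1, y2) \<in> fund_alcove k"
          "((a1, a2) \<bullet> (x1, x2) < of_int j) \<noteq> ((a1, a2) \<bullet> (y1, y2) < of_int j)"
      obtain e where e: "(a1, a2) = rootof k e" "e \<in> coefs k" using a rootof_coefs[OF k] by blast
      have "j > 0 \<and> (e, nat j) \<in> B" using sep[OF e(2) j] xy unfolding e(1) by blast
      then show "((a1, a2), j) \<in> ?f ` B"
        unfolding e(1) by (intro image_eqI[of _ _ "(e, nat j)"]) auto
    qed
    show "?f ` B \<subseteq> ?H"
    proof
      fix z assume "z \<in> ?f ` B"
      then obtain e j where eB: "(e, j) \<in> B" and z: "z = (rootof k e, int j)" by auto
      then have e: "e \<in> coefs k" "j \<in> {1..m}" unfolding p(2) below_def by auto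
      then have re: "rootof k e \<in> pos_roots k" using rootof_coefs[OF k] by blast
      have j: "int j \<in> {- int m + 1..int m}" using e(2) by auto
      have "int j > 0 \<and> (e, nat (int j)) \<in> B" using eB e(2) by simp
      then have "\<exists>x \<in> region_of B. \<exists>y \<in> fund_alcove k. (rootof k e \<bullet> x < of_int (int j)) \<noteq> (rootof k e \<bullet> y < of_int (int j))"
        unfolding sep[OF e(1) j] .
      then show "z \<in> ?H"
        unfolding z using re j by (intro CollectI case_prodI conjI)
    qed
  qed
  moreover have "inj_on ?f B"
    using inj_rootof[OF k] by (auto simp: inj_on_def dest: injD)
  ultimately show ?thesis unfolding shi_height_def by (simp add: card_image)
qed

lemma card_below_le: "card (below k m p) \<le> m * k"
proof -
  have "card (below k m p) \<le> card (coefs k \<times> {1..m})"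
    by (rule card_mono) (auto simp: below_def finite_coefs)
  then show ?thesis by (simp add: card_cartesian_product card_coefs[OF k] mult.commute)
qed

lemma card_positive_regions:
  "card {R \<in> shi_regions k m. positive_region k R \<and> shi_coh k m R = a}
    = card {l. l \<le> m \<and> l \<le> a \<and> a + (k - 1) * l \<le> m * k}"
proof -
  let ?S = "below k m ` Collect (generic k m)"
  have "{R \<in> shi_regions k m. positive_region k R \<and> shi_coh k m R = a}
      = {R \<in> {R \<in> shi_regions k m. positive_region k R}. shi_coh k m R = a}" by blast
  also have "\<dots> = region_of ` {B \<in> ?S. m * k - card B = a}"
    unfolding positive_regions_eq using shi_height_region_of
    by (auto simp: shi_coh_def card_pos_roots[OF k])
  finally have "card {R \<in> shi_regions k m. positive_region k R \<and> shi_coh k m R = a}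
      = card (region_of ` {B \<in> ?S. m * k - card B = a})" by simp
  also have "\<dots> = card {B \<in> ?S. m * k - card B = a}"
    by (rule card_image) (rule inj_on_subset[OF inj_on_region_of], blast)
  also have "\<dots> = card {l. l \<le> m \<and> l \<le> a \<and> a + (k - 1) * l \<le> m * k}"
  proof (cases "a \<le> m * k")
    case True
    \<comment> \<open>By \<open>card_below_le\<close> the subtraction is not truncated, so coheight
      \<open>a\<close> means height \<open>m * k - a\<close>.\<close>
    have "{B \<in> ?S. m * k - card B = a} = {B \<in> ?S. card B = m * k - a}"
    proof (intro Collect_cong conj_cong HOL.refl)
      fix B assume "B \<in> ?S"
      then have "card B \<le> m * k" using card_below_le by blast
      then show "(m * k - card B = a) = (card B = m * k - a)" using True by linarith
    qed
    moreover have "k \<ge> 1" using k by auto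
    ultimately have "card {B \<in> ?S. m * k - card B = a}
        = card {l. l \<le> m \<and> (k - 1) * l \<le> m * k - a \<and> m * k - a + l \<le> m * k}"
      using count_strips[OF k] count_reflect by simp
    also have "{l. l \<le> m \<and> (k - 1) * l \<le> m * k - a \<and> m * k - a + l \<le> m * k}
        = {l. l \<le> m \<and> l \<le> a \<and> a + (k - 1) * l \<le> m * k}"
      using True by auto
    finally show ?thesis .
  next
    case False
    then have "{B \<in> ?S. m * k - card B = a} = {}" by auto
    moreover have "{l. l \<le> m \<and> l \<le> a \<and> a + (k - 1) * l \<le> m * k} = {}" using False by auto
    ultimately show ?thesis by (simp only: card.empty)
  qed
  finally show ?thesis .
qed

end

subsection \<open>Comparison\<close>

text \<open>The parameter is the exponent \<open>l = m - j\<close> of \<open>Df\<close>. Then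
  \<open>i = a - l\<close>, and \<open>i \<le> j * k\<close> turns into
  \<open>a + (k - 1) * l \<le> m * k\<close>.\<close>

lemma card_idx_deg_x:
  assumes "k \<ge> 1"
  shows "card {g \<in> idx k m. deg_x m g = a} = card {l. l \<le> m \<and> l \<le> a \<and> a + (k - 1) * l \<le> m * k}"
proof -
  obtain r where r: "k = Suc r" using assms by (cases k) auto
  have "bij_betw (\<lambda>(j, i). m - j) {g \<in> idx k m. deg_x m g = a} {l. l \<le> m \<and> l \<le> a \<and> a + (k - 1) * l \<le> m * k}"
  proof (rule bij_betw_byWitness[where f' = "\<lambda>l. (m - l, a - l)"])
    show "\<forall>g\<in>{g \<in> idx k m. deg_x m g = a}. (m - (case g of (j, i) \<Rightarrow> m - j), a - (case g of (j, i) \<Rightarrow> m - j)) = g"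
      by (auto simp: idx_def deg_x_def)
    show "\<forall>l\<in>{l. l \<le> m \<and> l \<le> a \<and> a + (k - 1) * l \<le> m * k}. (case (m - l, a - l) of (j, i) \<Rightarrow> m - j) = l"
      by auto
    show "(\<lambda>(j, i). m - j) ` {g \<in> idx k m. deg_x m g = a} \<subseteq> {l. l \<le> m \<and> l \<le> a \<and> a + (k - 1) * l \<le> m * k}"
    proof clarify
      fix j i assume g: "(j, i) \<in> idx k m" "a = deg_x m (j, i)"
      then have j: "j \<le> m" "i \<le> j * k" "a = m - j + i" by (auto simp: idx_def deg_x_def)
      then obtain l where l: "m = j + l" using le_Suc_ex by blast
      show "m - j \<le> m \<and> m - j \<le> deg_x m (j, i) \<and> deg_x m (j, i) + (k - 1) * (m - j) \<le> m * k"
        unfolding g(2)[symmetric] using j(2,3) by (simp add: l r algebra_simps)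
    qed
    show "(\<lambda>l. (m - l, a - l)) ` {l. l \<le> m \<and> l \<le> a \<and> a + (k - 1) * l \<le> m * k} \<subseteq> {g \<in> idx k m. deg_x m g = a}"
    proof clarify
      fix l assume l: "l \<le> m" "l \<le> a" "a + (k - 1) * l \<le> m * k"
      then obtain j i where "m = l + j" "a = l + i" using le_Suc_ex by metis
      then show "(m - l, a - l) \<in> idx k m \<and> deg_x m (m - l, a - l) = a"
        using l(3) by (simp add: idx_def deg_x_def r algebra_simps)
    qed
  qed
  then show ?thesis by (rule bij_betw_same_card)
qed

theorem theorem3p19:
  fixes k m :: nat
  assumes "k \<in> {2, 3, 4, 6}" and "m \<ge> 1"
  shows "finite {(a, b). cat_coeff k m a b \<noteq> 0}
    \<and> (\<forall>a. (\<Sum>b \<in> {b. cat_coeff k m a b \<noteq> 0}. cat_coeff k m a b)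
           = card {R \<in> shi_regions k m. positive_region k R \<and> shi_coh k m R = a})"
proof -
  have k: "k \<ge> 2" "k \<ge> 1" using assms(1) by auto
  show ?thesis
    using cat_coeff_finite[OF k(1)] sum_cat_coeff[OF k(1)] card_idx_deg_x[OF k(2)]
      card_positive_regions[OF assms] by simp
qed

end
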